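(* Let $K_1,\dots,K_g\in\mathrm U(r)$. There is exactly one function $N:\mathbb C\setminus[a_0,b_g]\to\mathbb C^{2r\times2r}$ such that: (N0) $N$ is holomorphic on $\mathbb C\setminus[a_0,b_g]$; (N1) $N_+=N_-\begin{pmatrix}0&I_r\\-I_r&0\end{pmatrix}$ on $(a_k,b_k)$, $k=0,\dots,g$; (N2) $N_+=N_-\operatorname{diag}(K_j,K_j^{-1})$ on $(b_{j-1},a_j)$, $j=1,\dots,g$; (N3) $N(z)=I_{2r}+O(z^{-1})$ as $z\to\infty$; (N4) $N(z)=O(|z-e|^{-1/4})$ as $z\to e$, for each $e\in\{a_0,b_0,\dots,a_g,b_g\}$.
   Context: Fix $g\ge0$, $r\ge1$ and real numbers $a_0<b_0<a_1<b_1<\cdots<a_g<b_g$. $\mathrm U(r)$ is the group of $r\times r$ unitary matrices. For $x$ in an open cut $(a_k,b_k)$ or gap $(b_{j-1},a_j)$, $N_\pm(x)$ denotes the (continuous) boundary value of $N$ from $\{\pm\operatorname{Im}z>0\}$. *)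

theory Defs
  imports
    "HOL-Complex_Analysis.Complex_Analysis"
    "HOL-Library.Landau_Symbols"
    "HOL-Library.FuncSet"
begin

definition conj_transpose :: "complex^'n^'m \<Rightarrow> complex^'m^'n" where
  "conj_transpose A = (\<chi> i j. cnj (A $ j $ i))"

definition unitary_matrix :: "complex^'n^'n \<Rightarrow> bool" where
  "unitary_matrix A \<longleftrightarrow>
     conj_transpose A ** A = mat 1 \<and> A ** conj_transpose A = mat 1"

text \<open>A square matrix of size twice \<open>CARD('r)\<close> is indexed by \<open>'r + 'r\<close>: \<open>Inl\<close> selects the
  first block row or column, \<open>Inr\<close> the second.\<close>

definition block_matrix ::
    "'a^'r^'r \<Rightarrow> 'a^'r^'r \<Rightarrow> 'a^'r^'r \<Rightarrow> 'a^'r^'r \<Rightarrow> 'a^('r + 'r)^('r + 'r)" where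
  "block_matrix A B C D = (\<chi> i j.
     case i of
       Inl p \<Rightarrow> (case j of Inl q \<Rightarrow> A $ p $ q | Inr q \<Rightarrow> B $ p $ q)
     | Inr p \<Rightarrow> (case j of Inl q \<Rightarrow> C $ p $ q | Inr q \<Rightarrow> D $ p $ q))"

definition matrix_holomorphic_on ::
    "(complex \<Rightarrow> complex^'n^'m) \<Rightarrow> complex set \<Rightarrow> bool" where
  "matrix_holomorphic_on N S \<longleftrightarrow> (\<forall>i j. (\<lambda>z. N z $ i $ j) holomorphic_on S)"

text \<open>\<open>F\<close> is the continuous boundary value on \<open>I\<close>, a subset of the real line, of \<open>N\<close> taken from
  the half plane \<open>H\<close>. The limit is unrestricted within \<open>H\<close>, not merely along vertical lines.\<close>

definition has_boundary_values ::
    "(complex \<Rightarrow> complex^'n^'m) \<Rightarrow> complex set \<Rightarrow> real set \<Rightarrow> (real \<Rightarrow> complex^'n^'m) \<Rightarrow> bool" where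
  "has_boundary_values N H I F \<longleftrightarrow>
     continuous_on I F \<and>
     (\<forall>x\<in>I. (N \<longlongrightarrow> F x) (at (complex_of_real x) within H))"

text \<open>\<open>N\<close> has continuous boundary values on \<open>I\<close> from above and from below, and they satisfy the
  jump relation \<open>N\<^sub>+ = N\<^sub>- J\<close>.\<close>

definition has_jump ::
    "(complex \<Rightarrow> complex^'n^'m) \<Rightarrow> real set \<Rightarrow> complex^'n^'n \<Rightarrow> bool" where
  "has_jump N I J \<longleftrightarrow>
     (\<exists>Np Nm. has_boundary_values N {z. Im z > 0} I Np \<and>
              has_boundary_values N {z. Im z < 0} I Nm \<and>
              (\<forall>x\<in>I. Np x = Nm x ** J))"

end

theory Submission
  imports Defs
begin

no_notation fps_nth (infixl "$" 75)

text \<open>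
Uniqueness. If \<open>N\<close> solves the homogeneous problem (decay at infinity instead of normalization) and
\<open>(f, h)\<close> is a row of \<open>N\<close>, then \<open>F(z) = f(z) h(z\<^sup>*)\<^sup>*\<close> is analytic in the upper half plane, is
\<open>O(z\<^sup>-\<^sup>2)\<close> at infinity and has integrable boundary singularities, so its boundary values integrate to
zero over the real line. Combined with the same statement for \<open>h(z) f(z\<^sup>*)\<^sup>*\<close>, only the cuts
contribute, because the \<open>K\<^sub>j\<close> are unitary, and they contribute the integral of
\<open>|f|\<^sup>2 + |h|\<^sup>2\<close>. Hence \<open>N\<close> vanishes on the cuts and therefore identically.

Existence. Put \<open>\<gamma> = \<Prod>\<^sub>k ((z - b\<^sub>k) / (z - a\<^sub>k))\<^sup>1\<^sup>/\<^sup>4\<close>. An explicit matrix \<open>M(\<gamma>)\<close> solves the problem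
when all \<open>K\<^sub>j = 1\<close>. In a disc around the gap \<open>j\<close> a piecewise constant factor on the right produces
the jump \<open>diag(K\<^sub>j, K\<^sub>j\<^sup>-\<^sup>1)\<close>, so that \<open>N = (1 + X) M(\<gamma>)\<close> outside the discs and
\<open>N = Y\<^sub>j M(\<gamma>) diag(K\<^sub>j, 1)\<close> or \<open>Y\<^sub>j M(\<gamma>) diag(1, K\<^sub>j)\<close> in the two halves of the disc solves the
problem as soon as \<open>1 + X = Y\<^sub>j G(K\<^sub>j, \<tau>)\<close> on an annulus around each gap, where \<open>G(K\<^sub>j, \<tau>)\<close> is
analytic. This linear transmission problem is solved by Laurent splitting if all \<open>K\<^sub>j = 1\<close>. By
normal families and uniqueness its solutions satisfy an a priori bound that is uniform over all
unitary \<open>K\<^sub>j\<close>; hence solvability persists under perturbations of a fixed size and propagates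
along paths in the unitary group.
\<close>

section \<open>Complex matrices\<close>

text \<open>The obstacle to an explicit formula is that the K_j need not commute: each gap jump
  alone is removed by a piecewise constant gauge, but different gaps require different gauges. Such
  a gauge is compatible with the cuts because J diag(K, 1) = diag(1, K) J, and its conjugate by
  M(\<gamma>) depends only on \<gamma>^2 up to a sign, which continues analytically across the cuts.
  The transmission problem therefore sees analytic data on annuli that avoid all endpoints, and
  every singularity stays inside M(\<gamma>). The exponent 1/4 is what uniqueness needs: a product
  of two entries grows at most like an inverse square root, which is integrable on the line. The a
  priori bound can be uniform because the unitary group is compact and uniqueness holds at every one
  of its points; a single step size then serves a whole path, and no estimate has to be tracked
  along it.\<close>

lemma norm_entry_le: "norm (A $ i $ j) \<le> norm A" for A :: "complex^'n^'m"
  by (rule order_trans[of _ "norm (A $ i)"]) (rule Finite_Cartesian_Product.norm_nth_le)+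

lemma norm_matrix_le_sum: "norm A \<le> (\<Sum>i\<in>UNIV. \<Sum>j\<in>UNIV. norm (A $ i $ j))" for A :: "complex^'n^'m"
proof -
  have "norm A \<le> (\<Sum>i\<in>UNIV. norm (A $ i))"
    by (simp add: norm_vec_def L2_set_le_sum)
  also have "\<dots> \<le> (\<Sum>i\<in>UNIV. \<Sum>j\<in>UNIV. norm (A $ i $ j))"
    by (intro sum_mono) (simp add: norm_vec_def L2_set_le_sum)
  finally show ?thesis .
qed

lemma norm_matrix_le: "norm A \<le> real CARD('m) * real CARD('n) * c"
  if "\<And>i j. norm (A $ i $ j) \<le> c" for A :: "complex^'n^'m"
proof -
  have "norm A \<le> (\<Sum>i\<in>(UNIV::'m set). \<Sum>j\<in>(UNIV::'n set). c)"
    by (rule order_trans[OF norm_matrix_le_sum]) (intro sum_mono that)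
  then show ?thesis by simp
qed

text \<open>Limits, continuity, infinite sums and norm estimates of matrix products all come from
  this one fact.\<close>

lemma bounded_bilinear_matrix_mult:
  "bounded_bilinear ((**) :: complex^'n^'m \<Rightarrow> complex^'k^'n \<Rightarrow> complex^'k^'m)"
proof
  fix A A' :: "complex^'n^'m" and B B' :: "complex^'k^'n" and c :: real
  show "(A + A') ** B = A ** B + A' ** B" by (simp add: matrix_matrix_mult_def vec_eq_iff distrib_right sum.distrib)
  show "A ** (B + B') = A ** B + A ** B'" by (simp add: matrix_matrix_mult_def vec_eq_iff distrib_left sum.distrib)
  show "(c *\<^sub>R A) ** B = c *\<^sub>R (A ** B)"
    by (simp add: matrix_matrix_mult_def vec_eq_iff scaleR_right.sum)
  show "A ** (c *\<^sub>R B) = c *\<^sub>R (A ** B)"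
    by (simp add: matrix_matrix_mult_def vec_eq_iff scaleR_right.sum)
next
  have "norm (A ** B) \<le> norm A * norm B * (real CARD('m) * real CARD('k) * real CARD('n))"
    for A :: "complex^'n^'m" and B :: "complex^'k^'n"
  proof -
    have entry: "norm ((A ** B) $ i $ j) \<le> real CARD('n) * (norm A * norm B)" for i j
    proof -
      have "norm ((A ** B) $ i $ j) \<le> (\<Sum>k\<in>UNIV. norm (A $ i $ k * B $ k $ j))"
        unfolding matrix_matrix_mult_def vec_lambda_beta by (rule norm_sum)
      also have "\<dots> \<le> (\<Sum>k\<in>(UNIV::'n set). norm A * norm B)"
        unfolding norm_mult by (intro sum_mono mult_mono norm_entry_le) auto
      finally show ?thesis by simp
    qed
    show ?thesis
      by (rule order_trans[OF norm_matrix_le[OF entry]]) (simp add: mult_ac)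
  qed
  then show "\<exists>K. \<forall>A B. norm (A ** B :: complex^'k^'m) \<le> norm (A::complex^'n^'m) * norm B * K"
    by (intro exI[of _ "real CARD('m) * real CARD('k) * real CARD('n)"] allI)
qed

lemmas tendsto_matrix_mult = bounded_bilinear.tendsto[OF bounded_bilinear_matrix_mult]
lemmas continuous_on_matrix_mult = bounded_bilinear.continuous_on[OF bounded_bilinear_matrix_mult]

lemma matrix_mult_bound:
  obtains c where "c > 0"
    "\<And>A B. norm (A ** B :: complex^'k^'m) \<le> c * norm (A::complex^'n^'m) * norm B"
proof -
  from bounded_bilinear.pos_bounded[OF bounded_bilinear_matrix_mult]
  obtain K where "K > 0" "\<And>A B. norm (A ** B :: complex^'k^'m) \<le> norm (A::complex^'n^'m) * norm B * K"
    by blast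
  then show thesis by (intro that[of K]) (simp_all add: mult_ac)
qed

lemma tendsto_matrix_iff: "(f \<longlongrightarrow> A) F \<longleftrightarrow> (\<forall>i j. ((\<lambda>z. f z $ i $ j) \<longlongrightarrow> A $ i $ j) F)"
  for f :: "'a \<Rightarrow> complex^'n^'m"
proof
  show "\<forall>i j. ((\<lambda>z. f z $ i $ j) \<longlongrightarrow> A $ i $ j) F" if "(f \<longlongrightarrow> A) F"
    by (intro allI tendsto_vec_nth that)
  show "(f \<longlongrightarrow> A) F" if "\<forall>i j. ((\<lambda>z. f z $ i $ j) \<longlongrightarrow> A $ i $ j) F"
    by (intro vec_tendstoI) (use that in simp)
qed

lemma continuous_on_matrix_iff:
  "continuous_on S f \<longleftrightarrow> (\<forall>i j. continuous_on S (\<lambda>z. f z $ i $ j))"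
  for f :: "'a::topological_space \<Rightarrow> complex^'n^'m"
  unfolding continuous_on_def tendsto_matrix_iff by auto

lemma matrix_holomorphic_on_const [simp]: "matrix_holomorphic_on (\<lambda>z. A) S"
  by (simp add: matrix_holomorphic_on_def)

lemma matrix_holomorphic_on_subset:
  "matrix_holomorphic_on f S \<Longrightarrow> T \<subseteq> S \<Longrightarrow> matrix_holomorphic_on f T"
  unfolding matrix_holomorphic_on_def by (meson holomorphic_on_subset)

lemma matrix_holomorphic_on_cong:
  "(\<And>z. z \<in> S \<Longrightarrow> f z = h z) \<Longrightarrow> matrix_holomorphic_on f S \<longleftrightarrow> matrix_holomorphic_on h S"
  unfolding matrix_holomorphic_on_def by (intro iff_allI holomorphic_cong) auto

lemma matrix_holomorphic_on_add:
  "matrix_holomorphic_on f S \<Longrightarrow> matrix_holomorphic_on h S \<Longrightarrow> matrix_holomorphic_on (\<lambda>z. f z + h z) S"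
  unfolding matrix_holomorphic_on_def vector_add_component by (intro allI holomorphic_on_add) auto

lemma matrix_holomorphic_on_diff:
  "matrix_holomorphic_on f S \<Longrightarrow> matrix_holomorphic_on h S \<Longrightarrow> matrix_holomorphic_on (\<lambda>z. f z - h z) S"
  unfolding matrix_holomorphic_on_def vector_minus_component by (intro allI holomorphic_on_diff) auto

lemma matrix_holomorphic_on_scaleR:
  "matrix_holomorphic_on f S \<Longrightarrow> matrix_holomorphic_on (\<lambda>z. c *\<^sub>R f z) S"
  unfolding matrix_holomorphic_on_def vector_scaleR_component
  unfolding scaleR_conv_of_real by (intro allI holomorphic_on_mult holomorphic_on_const) auto

lemma matrix_holomorphic_on_sum:
  "(\<And>i. i \<in> I \<Longrightarrow> matrix_holomorphic_on (f i) S) \<Longrightarrow> matrix_holomorphic_on (\<lambda>z. \<Sum>i\<in>I. f i z) S"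
  unfolding matrix_holomorphic_on_def sum_component by (intro allI holomorphic_on_sum) auto

lemma matrix_holomorphic_on_mult:
  "matrix_holomorphic_on f S \<Longrightarrow> matrix_holomorphic_on h S \<Longrightarrow> matrix_holomorphic_on (\<lambda>z. f z ** h z) S"
  unfolding matrix_holomorphic_on_def matrix_matrix_mult_def vec_lambda_beta
  by (intro allI holomorphic_on_sum holomorphic_on_mult) auto

lemma matrix_holomorphic_on_continuous:
  "matrix_holomorphic_on f S \<Longrightarrow> continuous_on S f"
  unfolding matrix_holomorphic_on_def continuous_on_matrix_iff
  by (intro allI holomorphic_on_imp_continuous_on) auto

lemma matrix_holomorphic_on_Un:
  "\<lbrakk>matrix_holomorphic_on f S; matrix_holomorphic_on f T; open S; open T\<rbrakk>
    \<Longrightarrow> matrix_holomorphic_on f (S \<union> T)"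
  unfolding matrix_holomorphic_on_def by (intro allI holomorphic_on_Un) auto

lemma matrix_holomorphic_on_UN:
  "\<lbrakk>\<And>i. i \<in> I \<Longrightarrow> matrix_holomorphic_on f (S i); \<And>i. i \<in> I \<Longrightarrow> open (S i)\<rbrakk>
    \<Longrightarrow> matrix_holomorphic_on f (\<Union>i\<in>I. S i)"
  unfolding matrix_holomorphic_on_def by (intro allI holomorphic_on_UN_open) auto

section \<open>Two-by-two block matrices\<close>

lemma sum_UNIV_Plus: "(\<Sum>i\<in>(UNIV::('a::finite + 'b::finite) set). f i)
   = (\<Sum>i\<in>UNIV. f (Inl i)) + (\<Sum>i\<in>UNIV. f (Inr i))"
  by (simp add: UNIV_Plus_UNIV[symmetric] sum.Plus del: UNIV_Plus_UNIV)

lemma block_matrix_nth [simp]: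
  "block_matrix A B C D $ Inl p $ Inl q = A $ p $ q"
  "block_matrix A B C D $ Inl p $ Inr q = B $ p $ q"
  "block_matrix A B C D $ Inr p $ Inl q = C $ p $ q"
  "block_matrix A B C D $ Inr p $ Inr q = D $ p $ q"
  by (simp_all add: block_matrix_def)

lemma block_matrix_eqI:
  assumes "\<And>p q. X $ Inl p $ Inl q = Y $ Inl p $ Inl q" "\<And>p q. X $ Inl p $ Inr q = Y $ Inl p $ Inr q"
    "\<And>p q. X $ Inr p $ Inl q = Y $ Inr p $ Inl q" "\<And>p q. X $ Inr p $ Inr q = Y $ Inr p $ Inr q"
  shows "X = (Y :: 'a^('r::finite + 'r)^('r + 'r))"
  unfolding vec_eq_iff
proof (intro allI)
  fix i j show "X $ i $ j = Y $ i $ j" using assms by (cases i; cases j) auto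
qed

lemma block_matrix_mult:
  "block_matrix A B C D ** block_matrix A' B' C' D' =
   block_matrix (A ** A' + B ** C') (A ** B' + B ** D') (C ** A' + D ** C') (C ** B' + D ** D')"
  for A B C D :: "'a::semiring_1^'r^'r"
  by (rule block_matrix_eqI) (simp_all add: matrix_matrix_mult_def sum_UNIV_Plus)

lemma block_matrix_one: "block_matrix (mat 1) 0 0 (mat 1) = mat 1"
  by (rule block_matrix_eqI) (simp_all add: mat_def)

lemma mult_block_nth:
  "(A ** block_matrix B1 B2 B3 B4) $ i $ Inl q = (\<Sum>p\<in>UNIV. A $ i $ Inl p * B1 $ p $ q) + (\<Sum>p\<in>UNIV. A $ i $ Inr p * B3 $ p $ q)"
  "(A ** block_matrix B1 B2 B3 B4) $ i $ Inr q = (\<Sum>p\<in>UNIV. A $ i $ Inl p * B2 $ p $ q) + (\<Sum>p\<in>UNIV. A $ i $ Inr p * B4 $ p $ q)"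
  for A :: "'a::semiring_1^('r::finite + 'r)^'m"
  by (simp_all add: matrix_matrix_mult_def sum_UNIV_Plus)

section \<open>Inverses, adjoints and unitary matrices\<close>

lemma matrix_inv_eq:
  assumes "A ** B = mat 1" "B ** A = mat 1" shows "matrix_inv A = (B :: complex^'n^'n)"
proof -
  have "A ** matrix_inv A = mat 1 \<and> matrix_inv A ** A = mat 1"
    unfolding matrix_inv_def by (rule someI[of _ B]) (use assms in auto)
  then show ?thesis by (metis assms(2) matrix_mul_assoc matrix_mul_lid matrix_mul_rid)
qed

lemma matrix_inv_unitary: "unitary_matrix A \<Longrightarrow> matrix_inv A = conj_transpose A"
  by (rule matrix_inv_eq) (auto simp: unitary_matrix_def)

lemma conj_transpose_nth [simp]: "conj_transpose A $ i $ j = cnj (A $ j $ i)"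
  by (simp add: conj_transpose_def)

lemma conj_transpose_conj_transpose [simp]: "conj_transpose (conj_transpose A) = A"
  by (simp add: vec_eq_iff)

lemma conj_transpose_mult: "conj_transpose (A ** B) = conj_transpose B ** conj_transpose A"
  by (simp add: vec_eq_iff matrix_matrix_mult_def mult.commute)

lemma conj_transpose_mat_1 [simp]: "conj_transpose (mat 1) = mat 1"
  by (auto simp: vec_eq_iff mat_def)

lemma unitary_matrix_conj_transpose: "unitary_matrix A \<Longrightarrow> unitary_matrix (conj_transpose A)"
  by (simp add: unitary_matrix_def)

lemma unitary_matrix_mat_1 [simp]: "unitary_matrix (mat 1)"
  by (simp add: unitary_matrix_def)

text \<open>Each row of a unitary matrix is a unit vector. This bound gives the compactness of the
  unitary group used for the a priori estimate.\<close>

lemma norm_unitary_entry: assumes "unitary_matrix A" shows "norm (A $ i $ j) \<le> 1"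
proof -
  have "(A ** conj_transpose A) $ i $ i = mat 1 $ i $ i"
    using assms by (simp only: unitary_matrix_def)
  then have "(\<Sum>k\<in>UNIV. A $ i $ k * cnj (A $ i $ k)) = 1"
    by (simp add: matrix_matrix_mult_def mat_def)
  then have "complex_of_real (\<Sum>k\<in>UNIV. (norm (A $ i $ k))\<^sup>2) = 1"
    by (simp add: complex_norm_square del: of_real_power)
  then have "(\<Sum>k\<in>UNIV. (norm (A $ i $ k))\<^sup>2) = 1" using of_real_eq_1_iff by blast
  moreover have "(norm (A $ i $ j))\<^sup>2 \<le> (\<Sum>k\<in>UNIV. (norm (A $ i $ k))\<^sup>2)"
    by (rule member_le_sum) auto
  ultimately show ?thesis by (simp add: power_le_one_iff abs_square_le_1)
qed

section \<open>Boundary integrals on half planes\<close>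

text \<open>The majorant for boundary products: two factors of order -1/4 multiply to order
  -1/2.\<close>

lemma inverse_sqrt_integrable:
  fixes c d e :: real
  shows "(\<lambda>x. \<bar>x - e\<bar> powr (-1/2)) integrable_on {c..d}"
proof -
  define A where "A = \<bar>c\<bar> + \<bar>d\<bar> + \<bar>e\<bar>"
  have A: "A \<ge> 0" "e - A \<le> c" "d \<le> e + A" by (auto simp: A_def)
  have r: "(\<lambda>x::real. x powr (-1/2)) integrable_on {0..A}"
    using A by (intro integrable_on_powr_from_0) auto
  have 1: "(\<lambda>x. \<bar>x\<bar> powr (-1/2)) integrable_on {0..A}"
    by (rule integrable_eq[OF r]) auto
  have 2: "(\<lambda>x. \<bar>x\<bar> powr (-1/2)) integrable_on {-A..0}"
  proof -
    have "(\<lambda>x. \<bar>- x\<bar> powr (-1/2)) integrable_on {-A..-0}"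
      using 1 Henstock_Kurzweil_Integration.integrable_reflect_real[of "\<lambda>x. \<bar>x\<bar> powr (-1/2)" A 0] by simp
    then show ?thesis by simp
  qed
  have "(\<lambda>x. \<bar>x\<bar> powr (-1/2)) integrable_on {-A..A}"
    by (rule Henstock_Kurzweil_Integration.integrable_combine[OF _ _ 2 1]) (use A in auto)
  then have "((\<lambda>x. \<bar>x\<bar> powr (-1/2)) \<circ> (\<lambda>x. x - e)) integrable_on ((\<lambda>x. x + e) ` {-A..A})"
    using integrable_shift_real_ivl[of "\<lambda>x. \<bar>x\<bar> powr (-1/2)" "-A" A "-e"] by (simp add: o_def)
  then have "(\<lambda>x. \<bar>x - e\<bar> powr (-1/2)) integrable_on {e - A..e + A}"
    by (simp add: o_def add.commute)
  then show ?thesis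
    by (rule integrable_on_subinterval) (use A in auto)
qed

text \<open>Dominated convergence requires a majorant that is independent of the height Im z. It is
  found locally at each point of the compact rectangle [-R, R] x [0, 1]; near a singular point it
  may be written in Re z, since |Re z - e| <= |z - e| and the exponent is negative.\<close>

lemma upper_half_plane_boundary_bound:
  fixes F :: "complex \<Rightarrow> complex" and E :: "real set"
  assumes hol: "F holomorphic_on {z. Im z > 0}"
    and lim: "\<And>x. x \<notin> E \<Longrightarrow> \<exists>l. (F \<longlongrightarrow> l) (at (complex_of_real x) within {z. Im z > 0})"
    and sing: "\<And>e. e \<in> E \<Longrightarrow> \<exists>C. \<forall>\<^sub>F z in at (complex_of_real e) within {z. Im z > 0}.
                  norm (F z) \<le> C * norm (z - of_real e) powr (-1/2)"
    and E: "finite E"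
  obtains B where "\<And>z. \<lbrakk>\<bar>Re z\<bar> \<le> R; 0 < Im z; Im z \<le> 1; Re z \<notin> E\<rbrakk>
     \<Longrightarrow> norm (F z) \<le> B * (1 + (\<Sum>e\<in>E. \<bar>Re z - e\<bar> powr (-1/2)))"
proof -
  let ?H = "{z. Im z > 0}"
  define w where "w x = 1 + (\<Sum>e\<in>E. \<bar>x - e\<bar> powr (-1/2))" for x
  have w1: "w x \<ge> 1" for x unfolding w_def by (simp add: sum_nonneg)
  have we: "\<bar>x - e\<bar> powr (-1/2) \<le> w x" if "e \<in> E" for x e
  proof -
    have "\<bar>x - e\<bar> powr (-1/2) \<le> (\<Sum>e\<in>E. \<bar>x - e\<bar> powr (-1/2))"
      by (rule member_le_sum[OF that]) (use E in auto)
    then show ?thesis unfolding w_def by linarith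
  qed
  define K where "K = cbox (Complex (-R) 0) (Complex R 1)"
  have local: "\<exists>U B. open U \<and> p \<in> U \<and> (\<forall>z\<in>U. Im z > 0 \<longrightarrow> Re z \<notin> E \<longrightarrow> norm (F z) \<le> B * w (Re z))"
    if p: "p \<in> K" for p
  proof -
    have Imp: "Im p \<ge> 0" using p by (auto simp: K_def in_cbox_complex_iff)
    \<comment> \<open>The limit is punctured and says nothing at p itself; \<open>B\<close> accounts
      for the value F p.\<close>
    have bdd: ?thesis if "(F \<longlongrightarrow> l) (at p within ?H)" "B \<ge> norm (F p)" for l B
    proof -
      have "\<forall>\<^sub>F z in at p within ?H. norm (F z) < norm l + 1"
        by (rule order_tendstoD(2)[OF tendsto_norm[OF that(1)]]) simp
      then obtain U where U: "open U" "p \<in> U"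
        "\<And>z. z \<in> U \<Longrightarrow> z \<noteq> p \<Longrightarrow> Im z > 0 \<Longrightarrow> norm (F z) < norm l + 1"
        unfolding eventually_at_topological by auto
      have "norm (F z) \<le> (norm l + 1 + B) * w (Re z)" if z: "z \<in> U" "Im z > 0" for z
      proof -
        have B0: "B \<ge> 0" using \<open>B \<ge> norm (F p)\<close> norm_ge_zero order_trans by blast
        have "norm (F z) \<le> norm l + 1 + B"
          using U(3)[OF z(1) _ z(2)] \<open>B \<ge> norm (F p)\<close> B0 norm_ge_zero[of l] by (cases "z = p") (auto intro: add_increasing)
        also have "\<dots> \<le> (norm l + 1 + B) * w (Re z)"
          using mult_left_mono[OF w1[of "Re z"], of "norm l + 1 + B"] B0 by simp
        finally show ?thesis .
      qed
      then show ?thesis using U(1,2) by blast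
    qed
    show ?thesis
    proof (cases "Im p > 0")
      case True
      have "continuous_on ?H F" using hol holomorphic_on_imp_continuous_on by blast
      then have "(F \<longlongrightarrow> F p) (at p within ?H)" using True by (auto simp: continuous_on_def)
      then show ?thesis by (rule bdd[OF _ order_refl])
    next
      case False
      then have peq: "p = of_real (Re p)" using Imp by (simp add: complex_eq_iff)
      show ?thesis
      proof (cases "Re p \<in> E")
        case False
        from lim[OF this] obtain l where "(F \<longlongrightarrow> l) (at p within ?H)" using peq by auto
        then show ?thesis by (rule bdd[OF _ order_refl])
      next
        case True
        from sing[OF this] obtain C where
          "\<forall>\<^sub>F z in at p within ?H. norm (F z) \<le> C * norm (z - p) powr (-1/2)" using peq by metis
        then obtain U where U: "open U" "p \<in> U"
          "\<And>z. z \<in> U \<Longrightarrow> z \<noteq> p \<Longrightarrow> Im z > 0 \<Longrightarrow> norm (F z) \<le> C * norm (z - p) powr (-1/2)"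
          unfolding eventually_at_topological by auto
        have "norm (F z) \<le> \<bar>C\<bar> * w (Re z)" if z: "z \<in> U" "Im z > 0" "Re z \<notin> E" for z
        proof -
          have "z \<noteq> p" using z False by auto
          have le: "\<bar>Re z - Re p\<bar> \<le> norm (z - p)" using abs_Re_le_cmod[of "z - p"] by simp
          have "\<bar>Re z - Re p\<bar> > 0" using z(3) True by auto
          then have "norm (z - p) powr (-1/2) \<le> \<bar>Re z - Re p\<bar> powr (-1/2)"
            using le by (intro powr_mono2') auto
          also have "\<dots> \<le> w (Re z)" by (rule we[OF True])
          finally have "C * norm (z - p) powr (-1/2) \<le> \<bar>C\<bar> * w (Re z)"
            by (intro mult_mono) auto
          then show ?thesis using U(3)[OF z(1) \<open>z \<noteq> p\<close> z(2)] by linarith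
        qed
        then show ?thesis using U(1,2) by blast
      qed
    qed
  qed
  then obtain U B where UB: "\<And>p. p \<in> K \<Longrightarrow> open (U p)" "\<And>p. p \<in> K \<Longrightarrow> p \<in> U p"
    "\<And>p z. p \<in> K \<Longrightarrow> z \<in> U p \<Longrightarrow> Im z > 0 \<Longrightarrow> Re z \<notin> E \<Longrightarrow> norm (F z) \<le> B p * w (Re z)"
    by metis
  have "compact K" by (simp add: K_def)
  moreover have "K \<subseteq> (\<Union>p\<in>K. U p)" using UB(2) by blast
  ultimately obtain K' where K': "K' \<subseteq> K" "finite K'" "K \<subseteq> (\<Union>p\<in>K'. U p)"
    using compactE_image[of K K U] UB(1) by metis
  have "norm (F z) \<le> (\<Sum>p\<in>K'. \<bar>B p\<bar>) * (1 + (\<Sum>e\<in>E. \<bar>Re z - e\<bar> powr (-1/2)))"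
    if z: "\<bar>Re z\<bar> \<le> R" "0 < Im z" "Im z \<le> 1" "Re z \<notin> E" for z
  proof -
    have "z \<in> K" using z by (auto simp: K_def in_cbox_complex_iff)
    then obtain p where p: "p \<in> K'" "z \<in> U p" using K' by blast
    have "norm (F z) \<le> B p * w (Re z)" using UB(3)[of p z] p K'(1) z by blast
    also have "\<dots> \<le> (\<Sum>p\<in>K'. \<bar>B p\<bar>) * w (Re z)"
    proof (rule mult_right_mono)
      have "\<bar>B p\<bar> \<le> (\<Sum>p\<in>K'. \<bar>B p\<bar>)" by (rule member_le_sum) (use p K' in auto)
      then show "B p \<le> (\<Sum>p\<in>K'. \<bar>B p\<bar>)" by linarith
    qed (use w1[of "Re z"] in linarith)
    finally show ?thesis by (simp add: w_def)
  qed
  then show thesis using that by blast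
qed

text \<open>With a primitive G on the half plane the integral is an increment of G, estimated along
  the other three sides of the rectangle between the heights \<epsilon> and R. There |z| >= R, so
  |F| <= C / R^2, and these sides have total length at most 4 R.\<close>

lemma upper_half_plane_line_integral:
  fixes F :: "complex \<Rightarrow> complex"
  assumes hol: "F holomorphic_on {z. Im z > 0}"
    and decay: "\<And>z. Im z > 0 \<Longrightarrow> R \<le> norm z \<Longrightarrow> norm (F z) \<le> C / (norm z)\<^sup>2"
    and R: "R > 0" and \<epsilon>: "0 < \<epsilon>" "\<epsilon> \<le> R"
  shows "(\<lambda>x. F (Complex x \<epsilon>)) integrable_on {-R..R}"
    and "norm (integral {-R..R} (\<lambda>x. F (Complex x \<epsilon>))) \<le> 4 * C / R"
proof -
  let ?H = "{z. Im z > 0}"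
  have conv: "convex ?H" by (simp add: convex_halfspace_Im_gt)
  have opn: "open ?H" by (simp add: open_halfspace_Im_gt)
  obtain G where G: "\<And>z. z \<in> ?H \<Longrightarrow> (G has_field_derivative F z) (at z within ?H)"
    using holomorphic_convex_primitive'[OF conv opn hol] by blast
  have G': "(G has_field_derivative F z) (at z)" if "Im z > 0" for z
    using G[of z] that at_within_open[OF _ opn, of z] by auto
  have C0: "C \<ge> 0"
  proof -
    have "0 \<le> norm (F (Complex 0 R))" by simp
    also have "\<dots> \<le> C / (norm (Complex 0 R))\<^sup>2" by (rule decay) (use R in \<open>auto simp: cmod_def\<close>)
    finally show ?thesis using R by (simp add: cmod_def zero_le_divide_iff)
  qed
  have der: "((\<lambda>x. G (Complex x \<epsilon>)) has_vector_derivative F (Complex x \<epsilon>)) (at x within S)" for x S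
  proof -
    have "((\<lambda>x. of_real x + \<i> * of_real \<epsilon>) has_vector_derivative 1) (at x within S)"
      by (auto intro!: derivative_eq_intros)
    then have 1: "((\<lambda>x. Complex x \<epsilon>) has_vector_derivative 1) (at x within S)"
      by (simp add: Complex_eq)
    have "(G has_field_derivative F (Complex x \<epsilon>)) (at (Complex x \<epsilon>))" using \<epsilon> by (intro G') simp
    then have "(G has_field_derivative F (Complex x \<epsilon>)) (at (Complex x \<epsilon>) within (\<lambda>x. Complex x \<epsilon>) ` S)"
      by (rule has_field_derivative_at_within)
    from field_vector_diff_chain_within[OF 1 this] show ?thesis by (simp add: o_def)
  qed
  have hi: "((\<lambda>x. F (Complex x \<epsilon>)) has_integral (G (Complex R \<epsilon>) - G (Complex (-R) \<epsilon>))) {-R..R}"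
    by (rule fundamental_theorem_of_calculus) (use R der in auto)
  then show "(\<lambda>x. F (Complex x \<epsilon>)) integrable_on {-R..R}" by blast
  have step: "norm (G p - G q) \<le> C / R\<^sup>2 * norm (p - q)"
    if "convex S" "S \<subseteq> ?H \<inter> {z. R \<le> norm z}" "p \<in> S" "q \<in> S" for S p q
  proof (rule field_differentiable_bound[OF that(1) _ _ that(3,4)])
    fix z assume z: "z \<in> S"
    then have "Im z > 0" "R \<le> norm z" using that(2) by auto
    then show "(G has_field_derivative F z) (at z within S)"
      using G' has_field_derivative_at_within by blast
    have "norm (F z) \<le> C / (norm z)\<^sup>2" using decay \<open>Im z > 0\<close> \<open>R \<le> norm z\<close> by blast
    also have "\<dots> \<le> C / R\<^sup>2"
      using C0 R \<open>R \<le> norm z\<close> by (intro divide_left_mono power_mono mult_pos_pos zero_less_power) auto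
    finally show "norm (F z) \<le> C / R\<^sup>2" .
  qed
  have Rn: "R \<le> norm z" if "\<bar>Re z\<bar> = R \<or> Im z = R" for z
    using abs_Re_le_cmod[of z] abs_Im_le_cmod[of z] that R by auto
  have v: "norm (G (Complex s R) - G (Complex s \<epsilon>)) \<le> C / R\<^sup>2 * R" if "s = R \<or> s = - R" for s
  proof -
    have "norm (G (Complex s R) - G (Complex s \<epsilon>)) \<le> C / R\<^sup>2 * norm (Complex s R - Complex s \<epsilon>)"
    proof (rule step)
      show "convex ({z. Re z = s} \<inter> {z. Im z > 0})"
        by (intro convex_Int convex_halfspace_Im_gt) (auto simp: convex_def simp flip: distrib_right)
      show "{z. Re z = s} \<inter> {z. Im z > 0} \<subseteq> ?H \<inter> {z. R \<le> norm z}"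
        using Rn that R by auto
    qed (use R \<epsilon> in auto)
    also have "norm (Complex s R - Complex s \<epsilon>) = R - \<epsilon>"
      using \<epsilon> by (simp add: cmod_def)
    also have "C / R\<^sup>2 * (R - \<epsilon>) \<le> C / R\<^sup>2 * R" using C0 \<epsilon> by (intro mult_left_mono) auto
    finally show ?thesis .
  qed
  have h: "norm (G (Complex R R) - G (Complex (-R) R)) \<le> C / R\<^sup>2 * (2 * R)"
  proof -
    have "norm (G (Complex R R) - G (Complex (-R) R)) \<le> C / R\<^sup>2 * norm (Complex R R - Complex (-R) R)"
    proof (rule step)
      show "convex {z. Im z = R}" by (auto simp: convex_def simp flip: distrib_right)
      show "{z. Im z = R} \<subseteq> ?H \<inter> {z. R \<le> norm z}"
        using Rn R by auto
    qed auto
    also have "norm (Complex R R - Complex (-R) R) = 2 * R"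
      using R by (simp add: cmod_def real_sqrt_mult)
    finally show ?thesis .
  qed
  have "norm (G (Complex R \<epsilon>) - G (Complex (-R) \<epsilon>)) \<le>
     norm (G (Complex R R) - G (Complex R \<epsilon>)) + norm (G (Complex R R) - G (Complex (-R) R))
      + norm (G (Complex (-R) R) - G (Complex (-R) \<epsilon>))"
    using norm_triangle_ineq[of "(G (Complex R R) - G (Complex (-R) R)) - (G (Complex R R) - G (Complex R \<epsilon>))"
        "G (Complex (-R) R) - G (Complex (-R) \<epsilon>)"]
      norm_triangle_ineq4[of "G (Complex R R) - G (Complex (-R) R)" "G (Complex R R) - G (Complex R \<epsilon>)"]
    by simp
  also have "\<dots> \<le> C / R\<^sup>2 * R + C / R\<^sup>2 * (2 * R) + C / R\<^sup>2 * R"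
    using v[of R] v[of "-R"] h by linarith
  also have "\<dots> = 4 * C / R" using R by (simp add: power2_eq_square field_simps)
  finally show "norm (integral {-R..R} (\<lambda>x. F (Complex x \<epsilon>))) \<le> 4 * C / R"
    using integral_unique[OF hi] by simp
qed

text \<open>The lines Im z = 1 / (k + 1) descend to the real axis, and dominated convergence carries
  the bound of the horizontal integrals over to the boundary values.\<close>

lemma upper_half_plane_boundary_integral:
  fixes F :: "complex \<Rightarrow> complex" and E :: "real set" and \<phi> :: "real \<Rightarrow> complex"
  assumes hol: "F holomorphic_on {z. Im z > 0}"
    and lim: "\<And>x. x \<notin> E \<Longrightarrow> (F \<longlongrightarrow> \<phi> x) (at (complex_of_real x) within {z. Im z > 0})"
    and sing: "\<And>e. e \<in> E \<Longrightarrow> \<exists>C. \<forall>\<^sub>F z in at (complex_of_real e) within {z. Im z > 0}.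
                  norm (F z) \<le> C * norm (z - of_real e) powr (-1/2)"
    and E: "finite E"
    and decay: "\<And>z. Im z > 0 \<Longrightarrow> R \<le> norm z \<Longrightarrow> norm (F z) \<le> C / (norm z)\<^sup>2"
    and R: "R \<ge> 1"
  shows "\<phi> integrable_on {-R..R}" and "norm (integral {-R..R} \<phi>) \<le> 4 * C / R"
proof -
  obtain B where B: "\<And>z. \<lbrakk>\<bar>Re z\<bar> \<le> R; 0 < Im z; Im z \<le> 1; Re z \<notin> E\<rbrakk>
     \<Longrightarrow> norm (F z) \<le> B * (1 + (\<Sum>e\<in>E. \<bar>Re z - e\<bar> powr (-1/2)))"
    using upper_half_plane_boundary_bound[OF hol _ sing E, of R] lim by blast
  define h where "h x = \<bar>B\<bar> * (1 + (\<Sum>e\<in>E. \<bar>x - e\<bar> powr (-1/2)))" for x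
  define \<epsilon> :: "nat \<Rightarrow> real" where "\<epsilon> k = 1 / (real k + 1)" for k
  \<comment> \<open>The finite set E is masked by 0, because above its points neither convergence
    nor the majorant is available.\<close>
  define f where "f k x = (if x \<in> E then 0 else F (Complex x (\<epsilon> k)))" for k x
  define \<psi> where "\<psi> x = (if x \<in> E then 0 else \<phi> x)" for x
  have \<epsilon>: "\<epsilon> k > 0" "\<epsilon> k \<le> 1" for k by (auto simp: \<epsilon>_def)
  have \<epsilon>0: "\<epsilon> \<longlonglongrightarrow> 0" unfolding \<epsilon>_def by real_asymp
  have f_int: "f k integrable_on {-R..R}"
    and f_eq: "integral {-R..R} (f k) = integral {-R..R} (\<lambda>x. F (Complex x (\<epsilon> k)))" for k
  proof -
    have "(\<lambda>x. F (Complex x (\<epsilon> k))) integrable_on {-R..R}"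
      by (rule upper_half_plane_line_integral(1)[OF hol decay])
        (use R \<epsilon>[of k] in \<open>auto intro: order_trans\<close>)
    then show "f k integrable_on {-R..R}"
      by (rule integrable_spike_finite[OF E, rotated]) (auto simp: f_def)
    show "integral {-R..R} (f k) = integral {-R..R} (\<lambda>x. F (Complex x (\<epsilon> k)))"
      by (rule integral_spike[OF negligible_finite[OF E]]) (auto simp: f_def)
  qed
  have h_int: "h integrable_on {-R..R}"
    unfolding h_def
    by (intro integrable_on_mult_right integrable_add integrable_const_ivl integrable_sum
        inverse_sqrt_integrable E)
  have f_le: "norm (f k x) \<le> h x" if "x \<in> {-R..R}" for k x
  proof (cases "x \<in> E")
    case True then show ?thesis by (simp add: f_def h_def sum_nonneg)
  next
    case False
    have "norm (f k x) \<le> B * (1 + (\<Sum>e\<in>E. \<bar>x - e\<bar> powr (-1/2)))"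
      using B[of "Complex x (\<epsilon> k)"] that \<epsilon>[of k] False by (auto simp: f_def)
    also have "\<dots> \<le> h x" unfolding h_def by (intro mult_right_mono) (auto simp: sum_nonneg)
    finally show ?thesis .
  qed
  have f_lim: "(\<lambda>k. f k x) \<longlonglongrightarrow> \<psi> x" for x
  proof (cases "x \<in> E")
    case True then show ?thesis by (simp add: f_def \<psi>_def)
  next
    case False
    have "(\<lambda>k. of_real x + \<i> * of_real (\<epsilon> k)) \<longlonglongrightarrow> of_real x + \<i> * of_real 0"
      by (intro tendsto_intros \<epsilon>0)
    then have "(\<lambda>k. Complex x (\<epsilon> k)) \<longlonglongrightarrow> of_real x" by (simp add: Complex_eq)
    then have "filterlim (\<lambda>k. Complex x (\<epsilon> k)) (at (of_real x) within {z. Im z > 0}) sequentially"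
      using \<epsilon> by (auto simp: filterlim_at complex_eq_iff less_le)
    from filterlim_compose[OF lim[OF False] this] show ?thesis using False by (simp add: f_def \<psi>_def)
  qed
  note dc = dominated_convergence[OF f_int h_int f_le f_lim]
  show "\<phi> integrable_on {-R..R}"
    by (rule integrable_spike_finite[OF E _ dc(1)]) (auto simp: \<psi>_def)
  have "norm (integral {-R..R} \<psi>) \<le> 4 * C / R"
  proof (rule tendsto_upperbound[OF tendsto_norm[OF dc(2)]])
    show "\<forall>\<^sub>F k in sequentially. norm (integral {-R..R} (f k)) \<le> 4 * C / R"
      unfolding f_eq using R \<epsilon>
      by (intro always_eventually allI upper_half_plane_line_integral(2)[OF hol decay])
        (auto intro: order_trans)
  qed (assumption | rule sequentially_bot)+
  moreover have "integral {-R..R} \<phi> = integral {-R..R} \<psi>"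
    by (rule integral_spike[OF negligible_finite[OF E]]) (auto simp: \<psi>_def)
  ultimately show "norm (integral {-R..R} \<phi>) \<le> 4 * C / R" by simp
qed

text \<open>Extended by 0 into the upper half plane, f becomes continuous across the interval, hence
  holomorphic near it. Being zero on the upper side, the extension vanishes in a disc, and the
  identity theorem spreads this over S.\<close>

lemma zero_boundary_values_imp_zero:
  fixes f :: "complex \<Rightarrow> complex"
  assumes hol: "f holomorphic_on S" and S: "open S" "connected S" "{z. Im z < 0} \<subseteq> S"
    and cd: "c < d" and lim: "\<And>x. x \<in> {c<..<d} \<Longrightarrow> (f \<longlongrightarrow> 0) (at (complex_of_real x) within {z. Im z < 0})"
    and z: "z \<in> S"
  shows "f z = 0"
proof -
  define m where "m = complex_of_real ((c + d) / 2)"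
  define B where "B = ball m ((d - c) / 2)"
  define F where "F z = (if Im z < 0 then f z else 0)" for z
  have B: "open B" "connected B" by (auto simp: B_def)
  have inB: "Re z \<in> {c<..<d}" if "z \<in> B" for z
  proof -
    have "\<bar>Re z - (c + d) / 2\<bar> \<le> norm (z - m)" using abs_Re_le_cmod[of "z - m"] by (simp add: m_def)
    also have "norm (z - m) < (d - c) / 2" using that by (simp add: B_def dist_norm norm_minus_commute)
    finally show ?thesis by (auto simp: abs_less_iff field_simps)
  qed
  have near: "m + \<i> * of_real t \<in> B" if "\<bar>t\<bar> < (d - c) / 2" for t
    using that by (simp add: B_def dist_norm norm_mult)
  have opn: "open {z. Im z < 0}" by (simp add: open_halfspace_Im_lt)
  have cont: "continuous_on B F"
    unfolding continuous_on_eq_continuous_at[OF B(1)]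
  proof
    fix p assume p: "p \<in> B"
    consider "Im p < 0" | "Im p > 0" | "Im p = 0" by linarith
    then show "isCont F p"
    proof cases
      case 1
      have "isCont f p"
        using 1 S hol continuous_on_eq_continuous_at holomorphic_on_imp_continuous_on by blast
      moreover have "\<forall>\<^sub>F z in nhds p. F z = f z"
        using eventually_nhds_in_open[OF opn, of p] 1 by (auto elim!: eventually_mono simp: F_def)
      ultimately show ?thesis by (simp add: isCont_cong)
    next
      case 2
      have "\<forall>\<^sub>F z in nhds p. F z = (\<lambda>_. 0) z"
        using eventually_nhds_in_open[OF open_halfspace_Im_gt[of 0], of p] 2
        by (auto elim!: eventually_mono simp: F_def)
      from isCont_cong[OF this] show ?thesis by simp
    next
      case 3
      then have peq: "p = of_real (Re p)" by (simp add: complex_eq_iff)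
      have "(f \<longlongrightarrow> 0) (at p within {z. Im z < 0})" using lim[OF inB[OF p]] peq by simp
      then have "(F \<longlongrightarrow> 0) (at p within {z. Im z < 0})"
        by (rule Lim_transform_eventually) (auto simp: F_def eventually_at_filter)
      moreover have "(F \<longlongrightarrow> 0) (at p within {z. \<not> Im z < 0})"
        by (rule Lim_transform_eventually[OF tendsto_const]) (auto simp: F_def eventually_at_filter)
      ultimately have "(F \<longlongrightarrow> 0) (at p within ({z. Im z < 0} \<union> {z. \<not> Im z < 0}))"
        by (simp add: Lim_within_Un)
      moreover have "{z. Im z < 0} \<union> {z. \<not> Im z < 0} = UNIV" by auto
      ultimately have "(F \<longlongrightarrow> 0) (at p)" by simp
      then show ?thesis using 3 by (simp add: isCont_def F_def)
    qed
  qed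
  have F_hol: "F holomorphic_on B"
  proof (rule holomorphic_on_paste_across_line[OF B(1) _ _ _ cont])
    show "\<i> \<noteq> (0::complex)" by simp
    have "f holomorphic_on (B \<inter> {z. \<i> \<bullet> z < 0})"
      by (rule holomorphic_on_subset[OF hol]) (use S in \<open>auto simp: inner_complex_def\<close>)
    then show "F holomorphic_on (B \<inter> {z. \<i> \<bullet> z < 0})"
      by (rule holomorphic_transform) (auto simp: F_def inner_complex_def)
    show "F holomorphic_on (B \<inter> {z. 0 < \<i> \<bullet> z})"
      by (rule holomorphic_transform[OF holomorphic_on_const[of 0]]) (auto simp: F_def inner_complex_def)
  qed
  have F0: "F w = 0" if "w \<in> B" for w
  proof (rule analytic_continuation_open[OF _ B(1) _ B(2) _ F_hol holomorphic_on_const _ that])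
    show "open (B \<inter> {z. Im z > 0})" using B(1) by (simp add: open_Int open_halfspace_Im_gt)
    have "m + \<i> * of_real ((d - c) / 4) \<in> B \<inter> {z. Im z > 0}"
      using near[of "(d - c) / 4"] cd by (auto simp: m_def)
    then show "B \<inter> {z. Im z > 0} \<noteq> {}" by blast
  qed (auto simp: F_def)
  show ?thesis
  proof (rule analytic_continuation_open[OF _ S(1) _ S(2) _ hol holomorphic_on_const _ z])
    show "open (B \<inter> {z. Im z < 0})" using B(1) by (simp add: open_Int opn)
    have "m + \<i> * of_real (- (d - c) / 4) \<in> B \<inter> {z. Im z < 0}"
      using near[of "- (d - c) / 4"] cd by (auto simp: m_def)
    then show "B \<inter> {z. Im z < 0} \<noteq> {}" by blast
    show "f w = 0" if "w \<in> B \<inter> {z. Im z < 0}" for w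
      using F0[of w] that by (simp add: F_def)
  qed (use S in auto)
qed

section \<open>Vanishing of solutions of the homogeneous problem\<close>

locale bands =
  fixes g :: nat and a b :: "nat \<Rightarrow> real"
  assumes cuts: "\<And>k. k \<le> g \<Longrightarrow> a k < b k"
    and gaps: "\<And>j. j \<in> {1..g} \<Longrightarrow> b (j - 1) < a j"
begin

definition D :: "complex set" where "D = - complex_of_real ` {a 0..b g}"

definition E :: "real set" where "E = a ` {0..g} \<union> b ` {0..g}"

lemma finite_E: "finite E" by (simp add: E_def)

lemma gap_Suc: "k < g \<Longrightarrow> b k < a (Suc k)"
  using gaps[of "Suc k"] by simp

lemma b_less_a: "i < k \<Longrightarrow> k \<le> g \<Longrightarrow> b i < a k"
proof (induction k)
  case (Suc k)
  show ?case
  proof (cases "i = k")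
    case True then show ?thesis using gap_Suc Suc by simp
  next
    case False
    then have "b i < a k" using Suc by simp
    also have "\<dots> < b k" using cuts Suc by simp
    also have "\<dots> < a (Suc k)" using gap_Suc Suc by simp
    finally show ?thesis .
  qed
qed simp

lemma a_mono: "i \<le> k \<Longrightarrow> k \<le> g \<Longrightarrow> a i \<le> a k"
  using b_less_a[of i k] cuts[of i] by (cases "i = k") auto

lemma b_mono: "i \<le> k \<Longrightarrow> k \<le> g \<Longrightarrow> b i \<le> b k"
  using b_less_a[of i k] cuts[of k] by (cases "i = k") auto

lemma real_cases:
  assumes "x \<notin> E"
  obtains "x \<notin> {a 0..b g}" | k where "k \<in> {0..g}" "x \<in> {a k<..<b k}"
    | j where "j \<in> {1..g}" "x \<in> {b (j - 1)<..<a j}"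
proof (cases "x \<in> {a 0..b g}")
  case True
  define k where "k = Max {k. k \<le> g \<and> a k \<le> x}"
  have fin: "finite {k. k \<le> g \<and> a k \<le> x}" by simp
  have ne: "{k. k \<le> g \<and> a k \<le> x} \<noteq> {}" using True by auto
  have k: "k \<le> g" "a k \<le> x" using Max_in[OF fin ne] by (auto simp: k_def)
  have kmax: "i \<le> k" if "i \<le> g" "a i \<le> x" for i unfolding k_def by (rule Max_ge[OF fin]) (use that in auto)
  have ne': "x \<noteq> a k" "x \<noteq> b k" using assms k(1) by (auto simp: E_def)
  show thesis
  proof (cases "x < b k")
    case True
    then show thesis using that(2)[of k] k ne' by auto
  next
    case False
    then have "x > b k" using ne' by simp
    then have "k < g" using True k by (cases "k = g") auto
    then have "x < a (Suc k)" using kmax[of "Suc k"] by force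
    then show thesis using that(3)[of "Suc k"] \<open>x > b k\<close> \<open>k < g\<close> by auto
  qed
qed (use that in auto)

lemma cut_subset: "k \<le> g \<Longrightarrow> {a k..b k} \<subseteq> {a 0..b g}"
  using a_mono[of 0 k] b_mono[of k g] by auto

lemma cut_not_in_E: "k \<le> g \<Longrightarrow> x \<in> {a k<..<b k} \<Longrightarrow> x \<notin> E"
proof
  assume k: "k \<le> g" and x: "x \<in> {a k<..<b k}" and "x \<in> E"
  then obtain i where i: "i \<le> g" "x = a i \<or> x = b i" by (auto simp: E_def)
  then show False
    using x k b_less_a[of i k] b_less_a[of k i] cuts[of i] by (cases i k rule: linorder_cases) auto
qed

lemma gap_not_in_E: "j \<in> {1..g} \<Longrightarrow> x \<in> {b (j - 1)<..<a j} \<Longrightarrow> x \<notin> E"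
proof
  assume j: "j \<in> {1..g}" and x: "x \<in> {b (j - 1)<..<a j}" and "x \<in> E"
  then obtain i where i: "i \<le> g" "x = a i \<or> x = b i" by (auto simp: E_def)
  have "b i \<le> b (j - 1)" if "i < j" using that j b_mono[of i "j - 1"] by auto
  moreover have "a j \<le> a i" if "\<not> i < j" using that i a_mono[of j i] by auto
  ultimately show False using x i cuts[of i] by (cases "i < j") auto
qed

lemma E_subset: "E \<subseteq> {a 0..b g}"
  using cut_subset cuts by (fastforce simp: E_def)

lemma not_in_D: "z \<notin> D \<longleftrightarrow> Im z = 0 \<and> Re z \<in> {a 0..b g}"
  unfolding D_def by (auto simp: complex_eq_iff image_iff)

lemma in_D_if_Im: "Im z \<noteq> 0 \<Longrightarrow> z \<in> D"
  using not_in_D by blast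

lemma of_real_in_D: "x \<notin> {a 0..b g} \<Longrightarrow> of_real x \<in> D"
  using not_in_D[of "of_real x"] by auto

lemma compact_band: "compact (complex_of_real ` {a 0..b g})"
  by (intro compact_continuous_image continuous_intros) auto

lemma open_D: "open D"
  unfolding D_def using compact_band compact_imp_closed by blast

lemma connected_D: "connected D"
  unfolding D_def
proof (rule connected_complement_bounded_convex)
  show "bounded (complex_of_real ` {a 0..b g})" using compact_band compact_imp_bounded by blast
  show "convex (complex_of_real ` {a 0..b g})"
    by (intro convex_linear_image) (auto simp: linear_iff scaleR_conv_of_real)
qed simp

end

section \<open>Jump relations in terms of one-sided limits\<close>

lemma has_jumpD:
  assumes "has_jump N I J" "x \<in> I"
  shows "\<exists>P M. (N \<longlongrightarrow> P) (at (complex_of_real x) within {z. Im z > 0}) \<and>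
               (N \<longlongrightarrow> M) (at (complex_of_real x) within {z. Im z < 0}) \<and> P = M ** J"
  using assms unfolding has_jump_def has_boundary_values_def by blast

lemma at_lower_half_plane_neq_bot: "at (complex_of_real x) within {z. Im z < 0} \<noteq> bot"
proof -
  have "of_real x islimpt {z. Im z < 0}"
    unfolding islimpt_approachable
  proof (intro allI impI)
    fix e :: real assume "e > 0"
    then show "\<exists>z\<in>{z. Im z < 0}. z \<noteq> of_real x \<and> dist z (of_real x) < e"
      by (intro bexI[of _ "Complex x (- e / 2)"]) (auto simp: dist_norm cmod_def complex_eq_iff)
  qed
  then show ?thesis by (simp add: trivial_limit_within)
qed

text \<open>The limit is unrestricted within H: near x all values of N are close to F x, and hence
  so are the limits at neighbouring points. Jump relations may therefore be verified
  pointwise.\<close>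

lemma boundary_values_continuous:
  fixes N :: "complex \<Rightarrow> complex^'n^'m"
  assumes lim: "\<And>x. x \<in> I \<Longrightarrow> (N \<longlongrightarrow> F x) (at (complex_of_real x) within H)"
    and nb: "\<And>x. at (complex_of_real x) within H \<noteq> bot"
  shows "continuous_on I F"
proof (unfold continuous_on_iff, intro ballI allI impI)
  fix x and e :: real assume x: "x \<in> I" and e: "e > 0"
  from lim[OF x] e obtain d where d: "d > 0" "\<And>z. z \<in> H \<Longrightarrow> z \<noteq> of_real x \<Longrightarrow> dist z (of_real x) < d \<Longrightarrow> dist (N z) (F x) < e / 2"
    by (auto simp: tendsto_iff eventually_at dest!: spec[of _ "e / 2"])
  show "\<exists>d>0. \<forall>x'\<in>I. dist x' x < d \<longrightarrow> dist (F x') (F x) < e"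
  proof (intro exI[of _ d] conjI ballI impI)
    fix y assume y: "y \<in> I" "dist y x < d"
    show "dist (F y) (F x) < e"
    proof (cases "y = x")
      case False
      have "\<forall>\<^sub>F z in at (complex_of_real y) within H. dist (N z) (F x) \<le> e / 2"
        unfolding eventually_at
      proof (intro exI[of _ "min (d - dist y x) (dist y x)"] conjI ballI impI)
        show "min (d - dist y x) (dist y x) > 0" using y False by simp
        fix z assume z: "z \<in> H" "z \<noteq> of_real y \<and> dist z (of_real y) < min (d - dist y x) (dist y x)"
        have yx: "dist (complex_of_real y) (of_real x) = dist y x" by (simp add: dist_of_real)
        have "dist z (of_real x) < d" using z dist_triangle[of z "of_real x" "of_real y"] yx by linarith
        moreover have "z \<noteq> of_real x" using z yx by (auto simp: dist_commute)
        ultimately show "dist (N z) (F x) \<le> e / 2" using d(2)[OF z(1)] by (intro less_imp_le)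
      qed
      moreover have "((\<lambda>z. dist (N z) (F x)) \<longlongrightarrow> dist (F y) (F x)) (at (complex_of_real y) within H)"
        by (intro tendsto_dist lim y tendsto_const)
      ultimately have "dist (F y) (F x) \<le> e / 2" using nb by (intro tendsto_upperbound)
      then show ?thesis using e by simp
    qed (use e in simp)
  qed (use d in simp)
qed

lemma cmod_sum_mult_cnj_le:
  assumes "\<And>p. norm (f p) \<le> c" "\<And>p. norm (h p) \<le> d"
  shows "norm (\<Sum>p\<in>(UNIV::'r::finite set). f p * cnj (h p)) \<le> real CARD('r) * (c * d)"
proof -
  have "c \<ge> 0" using assms(1) norm_ge_zero order_trans by blast
  have "norm (\<Sum>p\<in>(UNIV::'r set). f p * cnj (h p)) \<le> (\<Sum>p\<in>(UNIV::'r set). c * d)"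
    by (intro sum_norm_le) (use assms \<open>c \<ge> 0\<close> in \<open>auto simp: norm_mult intro!: mult_mono\<close>)
  then show ?thesis by simp
qed

context bands
begin

theorem homogeneous_problem_zero:
  fixes N :: "complex \<Rightarrow> complex^('r::finite + 'r)^'m" and K :: "nat \<Rightarrow> complex^'r^'r"
  assumes hol: "matrix_holomorphic_on N D"
    and cutj: "\<And>k. k \<in> {0..g} \<Longrightarrow> has_jump N {a k<..<b k} (block_matrix 0 (mat 1) (- mat 1) 0)"
    and gapj: "\<And>j. j \<in> {1..g} \<Longrightarrow> has_jump N {b (j - 1)<..<a j} (block_matrix (K j) 0 0 (conj_transpose (K j)))"
    and inf: "(\<lambda>z. norm (N z)) \<in> O[at_infinity](\<lambda>z. norm (inverse z))"
    and sing: "\<And>e. e \<in> E \<Longrightarrow> (\<lambda>z. norm (N z)) \<in> O[at (complex_of_real e) within D](\<lambda>z. norm (z - of_real e) powr (- 1 / 4))"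
    and z: "z \<in> D"
  shows "N z = 0"
proof -
  let ?U = "{z. Im z > 0}" and ?L = "{z. Im z < 0}"
  let ?J = "block_matrix 0 (mat 1) (- mat 1) 0 :: complex^('r + 'r)^('r + 'r)"
  have UD: "?U \<subseteq> D" and LD: "?L \<subseteq> D" using in_D_if_Im by auto
  \<comment> \<open>One relation for the three kinds of real points, with trivial jump outside the
    band, so that the boundary values can be chosen as single functions \<open>Np\<close> and
    \<open>Nm\<close> on the complement of E.\<close>
  define rel where "rel x P M \<longleftrightarrow> (x \<notin> {a 0..b g} \<and> P = M) \<or> (\<exists>k\<in>{0..g}. x \<in> {a k<..<b k} \<and> P = M ** ?J)
      \<or> (\<exists>j\<in>{1..g}. x \<in> {b (j - 1)<..<a j} \<and> P = M ** block_matrix (K j) 0 0 (conj_transpose (K j)))" for x and P M :: "complex^('r + 'r)^'m"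
  have bv: "\<exists>P M. (N \<longlongrightarrow> P) (at (complex_of_real x) within ?U) \<and>
         (N \<longlongrightarrow> M) (at (complex_of_real x) within ?L) \<and> rel x P M"
    if x: "x \<notin> E" for x
    using x
  proof (cases rule: real_cases)
    case 1
    have "isCont N (of_real x)"
      using matrix_holomorphic_on_continuous[OF hol] open_D of_real_in_D[OF 1]
        continuous_on_eq_continuous_at by blast
    then have "(N \<longlongrightarrow> N (of_real x)) (at (complex_of_real x) within S)" for S
      by (simp add: continuous_at_imp_continuous_at_within continuous_within[symmetric])
    then show ?thesis using 1 unfolding rel_def by blast
  next
    case (2 k) then show ?thesis using has_jumpD[OF cutj 2(2)] unfolding rel_def by blast
  next
    case (3 j) then show ?thesis using has_jumpD[OF gapj 3(2)] unfolding rel_def by blast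
  qed
  then obtain Np Nm where
    Np: "\<And>x. x \<notin> E \<Longrightarrow> (N \<longlongrightarrow> Np x) (at (complex_of_real x) within ?U)" and
    Nm: "\<And>x. x \<notin> E \<Longrightarrow> (N \<longlongrightarrow> Nm x) (at (complex_of_real x) within ?L)" and
    rel: "\<And>x. x \<notin> E \<Longrightarrow> rel x (Np x) (Nm x)"
    by metis
  have row0: "Nm x $ i $ q = 0" if x: "x \<in> {a 0<..<b 0}" for x i q
  proof -
    define \<phi> where "\<phi> s t x = (\<Sum>p\<in>UNIV. Np x $ i $ s p * cnj (Nm x $ i $ t p))" for s t :: "'r \<Rightarrow> 'r + 'r" and x
    \<comment> \<open>Row i is fixed, and \<open>s\<close>, \<open>t\<close> select its left or
      right half. The conjugated factor is also reflected in the real axis, which makes the product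
      holomorphic.\<close>
    define F where "F s t z = (\<Sum>p\<in>UNIV. N z $ i $ s p * cnj (N (cnj z) $ i $ t p))" for s t :: "'r \<Rightarrow> 'r + 'r" and z
    have F_hol: "F s t holomorphic_on ?U" for s t
    proof -
      have "(cnj \<circ> (\<lambda>z. N z $ i $ t p) \<circ> cnj) holomorphic_on ?U" for p
      proof (rule holomorphic_on_compose_cnj_cnj)
        have "(\<lambda>z. N z $ i $ t p) holomorphic_on D" using hol by (simp add: matrix_holomorphic_on_def)
        then show "(\<lambda>z. N z $ i $ t p) holomorphic_on cnj ` ?U"
          by (rule holomorphic_on_subset) (use LD in auto)
      qed (simp add: open_halfspace_Im_gt)
      moreover have "(\<lambda>z. N z $ i $ s p) holomorphic_on ?U" for p
        using hol UD unfolding matrix_holomorphic_on_def by (meson holomorphic_on_subset)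
      ultimately show ?thesis
        unfolding F_def by (intro holomorphic_on_sum holomorphic_on_mult) (auto simp: o_def)
    qed
    have F_lim: "(F s t \<longlongrightarrow> \<phi> s t x) (at (complex_of_real x) within ?U)" if "x \<notin> E" for s t x
    proof -
      have "filterlim cnj (at (complex_of_real x) within ?L) (at (complex_of_real x) within ?U)"
        unfolding filterlim_at
        by (auto simp: eventually_at_filter complex_eq_iff intro!: tendsto_eq_intros always_eventually)
      from filterlim_compose[OF Nm[OF that] this]
      have "((\<lambda>z. N (cnj z)) \<longlongrightarrow> Nm x) (at (complex_of_real x) within ?U)" .
      then show ?thesis
        unfolding F_def \<phi>_def using Np[OF that]
        by (intro tendsto_sum tendsto_mult tendsto_cnj) (auto simp: tendsto_matrix_iff)
    qed
    have F_sing: "\<exists>C. \<forall>\<^sub>F z in at (complex_of_real e) within ?U. norm (F s t z) \<le> C * norm (z - of_real e) powr (-1/2)"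
      if "e \<in> E" for s t e
    proof -
      from landau_o.bigE[OF sing[OF that]] obtain c where c: "c > 0"
        "\<forall>\<^sub>F z in at (complex_of_real e) within D. norm (N z) \<le> c * norm (z - of_real e) powr (-1/4)"
        by auto
      then obtain d where d: "d > 0" "\<And>z. z \<in> D \<Longrightarrow> z \<noteq> of_real e \<Longrightarrow> dist z (of_real e) < d \<Longrightarrow>
          norm (N z) \<le> c * norm (z - of_real e) powr (-1/4)"
        unfolding eventually_at by blast
      have "norm (F s t z) \<le> real CARD('r) * c\<^sup>2 * norm (z - of_real e) powr (-1/2)"
        if z: "Im z > 0" "dist z (of_real e) < d" for z
      proof -
        let ?w = "norm (z - of_real e) powr (-1/4)"
        have n: "norm (cnj z - of_real e) = norm (z - of_real e)"
          using complex_mod_cnj[of "z - of_real e"] by simp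
        have ne: "z \<noteq> of_real e" "cnj z \<noteq> of_real e" using z by (auto simp: complex_eq_iff)
        have "norm (N z) \<le> c * ?w"
          by (rule d(2)) (use z UD ne in auto)
        moreover have "norm (N (cnj z)) \<le> c * norm (cnj z - of_real e) powr (-1/4)"
          by (rule d(2)) (use z LD ne n in \<open>auto simp: dist_norm\<close>)
        ultimately have "norm (F s t z) \<le> real CARD('r) * ((c * ?w) * (c * ?w))"
          unfolding F_def n by (intro cmod_sum_mult_cnj_le) (meson norm_entry_le order_trans)+
        also have "(c * ?w) * (c * ?w) = c\<^sup>2 * (?w * ?w)" by (simp add: power2_eq_square mult_ac)
        also have "?w * ?w = norm (z - of_real e) powr (-1/2)" by (simp flip: powr_add)
        finally show ?thesis by (simp add: mult_ac)
      qed
      then show ?thesis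
        by (intro exI[of _ "real CARD('r) * c\<^sup>2"]) (use d(1) in \<open>auto simp: eventually_at\<close>)
    qed
    from landau_o.bigE[OF inf] obtain c where c: "c > 0"
      "\<forall>\<^sub>F z in at_infinity. norm (N z) \<le> c * norm (inverse z)" by auto
    then obtain R0 where R0: "\<And>z. norm z \<ge> R0 \<Longrightarrow> norm (N z) \<le> c * norm (inverse z)"
      unfolding eventually_at_infinity by blast
    define C where "C = real CARD('r) * c\<^sup>2"
    have F_decay: "norm (F s t z) \<le> C / (norm z)\<^sup>2" if "R0 \<le> norm z" for s t z
    proof -
      have "norm (N z) \<le> c / norm z" "norm (N (cnj z)) \<le> c / norm z"
        using R0[of z] R0[of "cnj z"] that by (auto simp: norm_inverse divide_inverse)
      then have "norm (F s t z) \<le> real CARD('r) * ((c / norm z) * (c / norm z))"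
        unfolding F_def by (intro cmod_sum_mult_cnj_le) (meson norm_entry_le order_trans)+
      then show ?thesis by (simp add: C_def power2_eq_square)
    qed
    \<comment> \<open>The integrals of both products over [-R, R] tend to 0. Conjugating one of them
      aligns the integrands, so that they cancel on the gaps and outside the band and leave the
      positive density \<rho> on the cuts.\<close>
    define \<psi> where "\<psi> x = cnj (\<phi> Inr Inl x) - \<phi> Inl Inr x" for x
    define \<rho> where "\<rho> x = (\<Sum>p\<in>UNIV. (norm (Nm x $ i $ Inl p))\<^sup>2) + (\<Sum>p\<in>UNIV. (norm (Nm x $ i $ Inr p))\<^sup>2)" for x
    have \<psi>_cut: "\<psi> x = of_real (\<rho> x)" if "Np x = Nm x ** ?J" for x
    proof -
      have P: "Np x $ i $ Inl q = - Nm x $ i $ Inr q" "Np x $ i $ Inr q = Nm x $ i $ Inl q" for q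
        unfolding that by (simp_all add: mult_block_nth mat_def sum_negf if_distrib[of "\<lambda>c. _ * c"] cong: if_cong)
      show ?thesis
        unfolding \<psi>_def \<phi>_def \<rho>_def P
        by (simp add: complex_norm_square sum_negf mult_ac del: of_real_power)
    qed
    \<comment> \<open>With f and h the two halves of the row of \<open>Nm\<close>, both terms equal
      f K times the adjoint of h, because the lower block of the jump is the adjoint of the upper
      one.\<close>
    have \<psi>_gap: "\<psi> x = 0" if "Np x = Nm x ** block_matrix (K j) 0 0 (conj_transpose (K j))" for x j
    proof -
      have P: "Np x $ i $ Inl q = (\<Sum>p\<in>UNIV. Nm x $ i $ Inl p * K j $ p $ q)"
        "Np x $ i $ Inr q = (\<Sum>p\<in>UNIV. Nm x $ i $ Inr p * cnj (K j $ q $ p))" for q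
        unfolding that by (simp_all add: mult_block_nth)
      have "cnj (\<phi> Inr Inl x) = (\<Sum>q\<in>UNIV. \<Sum>p\<in>UNIV. cnj (Nm x $ i $ Inr p) * K j $ q $ p * Nm x $ i $ Inl q)"
        unfolding \<phi>_def P by (simp add: sum_distrib_right)
      also have "\<dots> = (\<Sum>p\<in>UNIV. \<Sum>q\<in>UNIV. cnj (Nm x $ i $ Inr p) * K j $ q $ p * Nm x $ i $ Inl q)"
        by (rule sum.swap)
      also have "\<dots> = \<phi> Inl Inr x"
        unfolding \<phi>_def P by (simp add: sum_distrib_right sum_distrib_left mult_ac)
      finally show ?thesis by (simp add: \<psi>_def)
    qed
    have \<psi>_out: "\<psi> x = 0" if "Np x = Nm x" for x
      unfolding \<psi>_def \<phi>_def that by (simp add: mult_ac)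
    have \<rho>0: "\<rho> x \<ge> 0" for x unfolding \<rho>_def by (intro add_nonneg_nonneg sum_nonneg) auto
    have \<psi>_pos: "Re (\<psi> x) \<ge> 0" if "x \<notin> E" for x
      using rel[OF that] \<psi>_cut[of x] \<psi>_gap[of x] \<psi>_out[of x] \<rho>0[of x] unfolding rel_def by fastforce
    have big: "\<exists>I. (\<psi> has_integral I) {-R..R} \<and> norm I \<le> 8 * C / R" if "R \<ge> max 1 R0" for R
    proof -
      have R: "R \<ge> 1" and dec: "\<And>s t z. R \<le> norm z \<Longrightarrow> norm (F s t z) \<le> C / (norm z)\<^sup>2"
        using that F_decay by auto
      note bi = upper_half_plane_boundary_integral[OF F_hol F_lim F_sing finite_E dec R]
      have 1: "(\<phi> s t has_integral integral {-R..R} (\<phi> s t)) {-R..R}" for s t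
        using bi(1) by (simp add: integrable_integral)
      have "((\<lambda>x. cnj (\<phi> Inr Inl x)) has_integral cnj (integral {-R..R} (\<phi> Inr Inl))) {-R..R}"
        using has_integral_linear[OF 1 bounded_linear_cnj] by (simp add: o_def)
      then have "(\<psi> has_integral cnj (integral {-R..R} (\<phi> Inr Inl)) - integral {-R..R} (\<phi> Inl Inr)) {-R..R}"
        unfolding \<psi>_def by (intro has_integral_diff 1)
      moreover have "norm (cnj (integral {-R..R} (\<phi> Inr Inl)) - integral {-R..R} (\<phi> Inl Inr)) \<le> 4 * C / R + 4 * C / R"
        using norm_triangle_ineq4[of "cnj (integral {-R..R} (\<phi> Inr Inl))" "integral {-R..R} (\<phi> Inl Inr)"]
          bi(2)[of Inr Inl] bi(2)[of Inl Inr] by simp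
      ultimately show ?thesis by auto
    qed
    \<comment> \<open>On a compact subinterval of the cut the density is continuous, so that a
      vanishing integral forces it to vanish at x.\<close>
    obtain c d where cd: "a 0 < c" "c < x" "x < d" "d < b 0"
      by (rule that[of "(a 0 + x) / 2" "(x + b 0) / 2"]) (use x in auto)
    have \<psi>_cd: "y \<notin> E \<and> \<psi> y = of_real (\<rho> y)" if "y \<in> {c..d}" for y
    proof -
      have y: "y \<in> {a 0<..<b 0}" using that cd by auto
      then have yE: "y \<notin> E" using cut_not_in_E[of 0] by simp
      have "y \<in> {a 0..b g}" using y b_mono[of 0 g] by auto
      moreover have "y \<notin> {b (j - 1)<..<a j}" if "j \<in> {1..g}" for j
        using y b_mono[of 0 "j - 1"] that by (cases j) auto
      ultimately have "Np y = Nm y ** ?J" using rel[OF yE] unfolding rel_def by blast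
      then show ?thesis using \<psi>_cut yE by blast
    qed
    have \<rho>_cont: "continuous_on {c..d} \<rho>"
    proof -
      have "continuous_on {a 0<..<b 0} Nm"
        by (rule boundary_values_continuous[OF Nm at_lower_half_plane_neq_bot]) (use cut_not_in_E[of 0] in auto)
      then have "continuous_on {c..d} Nm" by (rule continuous_on_subset) (use cd in auto)
      then have "continuous_on {c..d} (\<lambda>x. Nm x $ i $ q)" for q by (simp add: continuous_on_matrix_iff)
      then show ?thesis
        unfolding \<rho>_def by (intro continuous_on_add continuous_on_sum continuous_on_power continuous_on_norm)
    qed
    \<comment> \<open>Re \<psi> is nonnegative off E, so the integral over [c, d] is at most the one
      over [-R, R], for every large R.\<close>
    have le: "integral {c..d} \<rho> \<le> 8 * C / R" if R: "R \<ge> max (max 1 R0) (\<bar>c\<bar> + \<bar>d\<bar>)" for R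
    proof -
      obtain I where I: "(\<psi> has_integral I) {-R..R}" "norm I \<le> 8 * C / R" using big[of R] R by auto
      have I': "((\<lambda>x. Re (\<psi> x)) has_integral Re I) {-R..R}"
        using has_integral_linear[OF I(1) bounded_linear_Re] by (simp add: o_def)
      \<comment> \<open>At the finitely many endpoints \<psi> has no known sign; it is replaced by 0
        there.\<close>
      have I'': "((\<lambda>x. if x \<in> E then 0 else Re (\<psi> x)) has_integral Re I) {-R..R}"
        by (rule has_integral_spike_finite[OF finite_E _ I']) auto
      have "integral {c..d} \<rho> \<le> Re I"
      proof (rule has_integral_subset_le[OF _ _ I''])
        show "((\<lambda>x. if x \<in> E then 0 else Re (\<psi> x)) has_integral integral {c..d} \<rho>) {c..d}"
        proof (rule has_integral_eq[OF _ integrable_integral])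
          show "\<rho> integrable_on {c..d}" using \<rho>_cont by (rule integrable_continuous_interval)
          show "\<rho> y = (if y \<in> E then 0 else Re (\<psi> y))" if "y \<in> {c..d}" for y
            using \<psi>_cd[OF that] by simp
        qed
      qed (use R \<psi>_pos in auto)
      also have "Re I \<le> norm I" by (rule complex_Re_le_cmod)
      also note I(2)
      finally show ?thesis .
    qed
    have "integral {c..d} \<rho> \<le> 0"
    proof (rule tendsto_lowerbound)
      show "((\<lambda>R. 8 * C / R) \<longlongrightarrow> 0) at_top" by real_asymp
      show "\<forall>\<^sub>F R in at_top. integral {c..d} \<rho> \<le> 8 * C / R"
        using eventually_ge_at_top by (rule eventually_mono) (rule le)
    qed simp
    moreover have "integral {c..d} \<rho> \<ge> 0" by (rule integral_nonneg) (use \<rho>_cont \<rho>0 integrable_continuous_interval in auto)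
    ultimately have "integral {c..d} \<rho> = 0" by simp
    then have "\<rho> x = 0"
      using integral_eq_0_iff[OF \<rho>_cont _ \<rho>0] cd by auto
    then have "(\<Sum>p\<in>UNIV. (norm (Nm x $ i $ Inl p))\<^sup>2) = 0" "(\<Sum>p\<in>UNIV. (norm (Nm x $ i $ Inr p))\<^sup>2) = 0"
      unfolding \<rho>_def by (simp_all add: add_nonneg_eq_0_iff sum_nonneg)
    then have "Nm x $ i $ Inl p = 0" "Nm x $ i $ Inr p = 0" for p
      by (auto simp: sum_nonneg_eq_0_iff)
    then show ?thesis by (cases q) auto
  qed
  have "N z $ i $ q = 0" for i q
  proof (rule zero_boundary_values_imp_zero[OF _ open_D connected_D LD _ _ z])
    show "(\<lambda>z. N z $ i $ q) holomorphic_on D" using hol by (simp add: matrix_holomorphic_on_def)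
    show "a 0 < b 0" using cuts by simp
    fix x assume x: "x \<in> {a 0<..<b 0}"
    have "x \<notin> E" using cut_not_in_E[of 0] x by simp
    from Nm[OF this] have "((\<lambda>z. N z $ i $ q) \<longlongrightarrow> Nm x $ i $ q) (at (complex_of_real x) within ?L)"
      by (simp add: tendsto_matrix_iff)
    then show "((\<lambda>z. N z $ i $ q) \<longlongrightarrow> 0) (at (complex_of_real x) within ?L)" using row0[OF x] by simp
  qed
  then show ?thesis by (simp add: vec_eq_iff)
qed

end

section \<open>The fourth root \<open>\<gamma>\<close>\<close>

text \<open>This is the Schwarz lemma in the coordinate \<rho> / z, in which infinity becomes a
  removable zero.\<close>

lemma exterior_schwarz:
  fixes f :: "complex \<Rightarrow> complex"
  assumes hol: "f holomorphic_on {z. norm z > \<rho>}" and \<rho>: "\<rho> > 0" and lim: "(f \<longlongrightarrow> 0) at_infinity"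
    and le: "\<And>z. norm z > \<rho> \<Longrightarrow> norm (f z) \<le> B" and z: "norm z > \<rho>"
  shows "norm (f z) \<le> B * \<rho> / norm z"
proof -
  define F where "F w = (if w = 0 then 0 else f (of_real \<rho> / w))" for w :: complex
  have inv: "norm (of_real \<rho> / w) > \<rho>" if "w \<noteq> 0" "norm w < 1" for w :: complex
    using that \<rho> by (simp add: norm_divide field_simps)
  have F_hol: "F holomorphic_on ball 0 1"
  proof (rule no_isolated_singularity'[where K="{0}"])
    have "(\<lambda>w. f (of_real \<rho> / w)) holomorphic_on ball 0 1 - {0}"
    proof (rule holomorphic_on_compose_gen[of "\<lambda>w. of_real \<rho> / w" _ f, unfolded o_def, OF _ hol])
      show "(\<lambda>w. of_real \<rho> / w) holomorphic_on ball 0 1 - {0}" by (intro holomorphic_intros) auto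
    qed (use inv in auto)
    then show "F holomorphic_on ball 0 1 - {0}"
      by (rule holomorphic_transform) (auto simp: F_def)
    have "filterlim (\<lambda>w. of_real \<rho> / w) at_infinity (at (0::complex))"
      using tendsto_mult_filterlim_at_infinity[OF tendsto_const[of "complex_of_real \<rho>"] _ filterlim_inverse_at_infinity] \<rho>
      by (simp add: divide_inverse)
    from filterlim_compose[OF lim this] have "((\<lambda>w. f (of_real \<rho> / w)) \<longlongrightarrow> 0) (at 0)" .
    then have "(F \<longlongrightarrow> 0) (at 0)"
      by (rule Lim_transform_eventually) (auto simp: F_def eventually_at_filter)
    then show "(F \<longlongrightarrow> F w) (at w within ball 0 1)" if "w \<in> {0}" for w
      using that by (auto simp: F_def intro: tendsto_within_subset[OF _ subset_UNIV])
  qed auto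
  have B0: "B \<ge> 0" using le[OF z] norm_ge_zero order_trans by blast
  have FB: "norm (F w) \<le> B" if "norm w < 1" for w using le inv that B0 by (auto simp: F_def)
  \<comment> \<open>Dividing by some B' > B produces the strict bound that the Schwarz lemma asks
    for, also when B = 0.\<close>
  have main: "norm (f z) \<le> B' * \<rho> / norm z" if "B' > B" for B'
  proof -
    have "norm ((\<lambda>w. F w / of_real B') (of_real \<rho> / z)) \<le> norm (of_real \<rho> / z)"
    proof (rule Schwarz_Lemma(1))
      show "(\<lambda>w. F w / of_real B') holomorphic_on ball 0 1"
        using F_hol that B0 by (intro holomorphic_intros) auto
      show "norm (F w / of_real B') < 1" if "norm w < 1" for w
        using FB[OF that] \<open>B' > B\<close> B0 by (simp add: norm_divide)
      show "norm (of_real \<rho> / z) < 1" using z \<rho> by (simp add: norm_divide divide_less_eq)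
    qed (simp add: F_def)
    moreover have "F (of_real \<rho> / z) = f z" using z \<rho> by (auto simp: F_def)
    ultimately have "norm (f z) / B' \<le> \<rho> / norm z"
      using that B0 \<rho> by (simp add: norm_divide)
    then show ?thesis using that B0 by (simp add: field_simps)
  qed
  show ?thesis
  proof (rule field_le_epsilon)
    fix e :: real assume "e > 0"
    have "norm (f z) \<le> (B + e * norm z / \<rho>) * \<rho> / norm z"
    proof (rule main)
      have "norm z > 0" using z \<rho> by linarith
      then show "B < B + e * norm z / \<rho>" using \<open>e > 0\<close> \<rho> by simp
    qed
    also have "\<dots> = B * \<rho> / norm z + e"
    proof -
      have "norm z \<noteq> 0" "\<rho> \<noteq> 0" using z \<rho> by linarith+
      then show ?thesis by (simp add: field_simps)
    qed
    finally show "norm (f z) \<le> B * \<rho> / norm z + e" .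
  qed
qed

context bands
begin

definition w :: "nat \<Rightarrow> complex \<Rightarrow> complex" where "w k z = (z - b k) / (z - a k)"

definition \<gamma> :: "complex \<Rightarrow> complex" where "\<gamma> z = (\<Prod>k\<le>g. w k z powr (1 / 4))"

text \<open>The analytic continuation of \<open>\<gamma>\<close>, up to a constant, across the cut \<open>k\<close>.\<close>

definition \<gamma>c :: "nat \<Rightarrow> complex \<Rightarrow> complex" where
  "\<gamma>c k z = (- w k z) powr (1 / 4) * (\<Prod>i\<in>{..g} - {k}. w i z powr (1 / 4))"

text \<open>The domain of \<open>\<gamma>c k\<close>: the two half planes joined through the open
  cut k.\<close>

definition offcut :: "nat \<Rightarrow> complex set" where
  "offcut k = {z. Im z = 0 \<longrightarrow> Re z \<in> {a k<..<b k}}"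

lemma w_eq: "z \<noteq> of_real (a k) \<Longrightarrow> w k z = 1 - of_real (b k - a k) / (z - of_real (a k))"
  by (simp add: w_def field_simps)

text \<open>\<open>w k\<close> is a real Moebius map with determinant b_k - a_k > 0, so it preserves
  each half plane. Its values hence meet the branch cut of the principal root only over the closed
  cut k, and those of \<open>- w k\<close> only over the rest of the real line and the
  endpoints.\<close>

lemma Im_w: assumes "Im z \<noteq> 0" shows "Im (w k z) = (b k - a k) * Im z / (norm (z - a k))\<^sup>2"
proof -
  have "z \<noteq> a k" using assms by auto
  then show ?thesis by (simp add: w_eq Im_divide cmod_power2 algebra_simps diff_divide_distrib)
qed

lemma Im_w_pos: "k \<le> g \<Longrightarrow> Im z > 0 \<Longrightarrow> Im (w k z) > 0"
  using cuts[of k] by (subst Im_w) (auto simp: zero_less_mult_iff zero_less_divide_iff complex_eq_iff)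

lemma Im_w_neg: "k \<le> g \<Longrightarrow> Im z < 0 \<Longrightarrow> Im (w k z) < 0"
  using cuts[of k] by (subst Im_w) (auto simp: divide_less_0_iff mult_less_0_iff complex_eq_iff)

lemma w_of_real: "w k (of_real x) = of_real ((x - b k) / (x - a k))"
  by (simp add: w_def)

lemma w_nonpos: assumes "k \<le> g" "w k z \<in> \<real>\<^sub>\<le>\<^sub>0" shows "Im z = 0 \<and> Re z \<in> {a k..b k}"
proof -
  have "Im (w k z) = 0" using assms(2) by (auto simp: complex_nonpos_Reals_iff)
  then have "Im z = 0" using Im_w_pos[OF assms(1), of z] Im_w_neg[OF assms(1), of z] by linarith
  then have "z = of_real (Re z)" by (simp add: complex_eq_iff)
  then have "w k z = of_real ((Re z - b k) / (Re z - a k))" using w_of_real by metis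
  then have "(Re z - b k) / (Re z - a k) \<le> 0"
    using assms(2) by (simp only: complex_nonpos_Reals_iff Re_complex_of_real)
  then show ?thesis using cuts[OF assms(1)] \<open>Im z = 0\<close> by (auto simp: divide_le_0_iff)
qed

lemma neg_w_nonpos: assumes "k \<le> g" "- w k z \<in> \<real>\<^sub>\<le>\<^sub>0" shows "z \<notin> offcut k"
proof -
  have "Im (w k z) = 0" using assms(2) by (auto simp: complex_nonpos_Reals_iff)
  then have "Im z = 0" using Im_w_pos[OF assms(1), of z] Im_w_neg[OF assms(1), of z] by linarith
  then have "z = of_real (Re z)" by (simp add: complex_eq_iff)
  then have "w k z = of_real ((Re z - b k) / (Re z - a k))" using w_of_real by metis
  then have "(Re z - b k) / (Re z - a k) \<ge> 0"
    using assms(2) by (simp only: complex_nonpos_Reals_iff Re_complex_of_real uminus_complex.simps neg_le_0_iff_le)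
  then show ?thesis using cuts[OF assms(1)] \<open>Im z = 0\<close> by (auto simp: zero_le_divide_iff offcut_def)
qed

lemma open_offcut: "open (offcut k)"
proof -
  have "offcut k = {z. Im z \<noteq> 0} \<union> {z. a k < Re z \<and> Re z < b k}" by (auto simp: offcut_def)
  moreover have "open {z::complex. Im z \<noteq> 0}"
    by (intro open_Collect_neq continuous_intros)
  moreover have "open {z::complex. a k < Re z \<and> Re z < b k}"
    by (intro open_Collect_conj open_Collect_less continuous_intros)
  ultimately show ?thesis by (metis open_Un)
qed

lemma w_holomorphic: "(\<lambda>z. w k z) holomorphic_on - {of_real (a k)}"
  unfolding w_def by (intro holomorphic_intros) auto

lemma \<gamma>_holomorphic: "\<gamma> holomorphic_on {z. \<forall>k\<le>g. Im z = 0 \<longrightarrow> Re z \<notin> {a k..b k}}"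
  unfolding \<gamma>_def
proof (intro holomorphic_on_prod holomorphic_on_powr holomorphic_on_const)
  fix k assume k: "k \<in> {..g}"
  show "w k holomorphic_on {z. \<forall>k\<le>g. Im z = 0 \<longrightarrow> Re z \<notin> {a k..b k}}"
    by (rule holomorphic_on_subset[OF w_holomorphic]) (use k cuts[of k] in auto)
  show "w k z \<notin> \<real>\<^sub>\<le>\<^sub>0" if "z \<in> {z. \<forall>k\<le>g. Im z = 0 \<longrightarrow> Re z \<notin> {a k..b k}}" for z
    using that w_nonpos[of k z] k by auto
qed

lemma open_\<gamma>_domain: "open {z. \<forall>k\<le>g. Im z = 0 \<longrightarrow> Re z \<notin> {a k..b k}}"
proof -
  have "{z. \<forall>k\<le>g. Im z = 0 \<longrightarrow> Re z \<notin> {a k..b k}} = (\<Inter>k\<in>{..g}. {z. Im z \<noteq> 0 \<or> Re z < a k \<or> Re z > b k})"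
    by (auto simp: not_le)
  moreover have "open \<dots>"
    by (intro open_INT ballI open_Collect_disj open_Collect_neq open_Collect_less continuous_intros) auto
  ultimately show ?thesis by simp
qed

lemma cuts_disjoint: "i \<le> g \<Longrightarrow> k \<le> g \<Longrightarrow> x \<in> {a k<..<b k} \<Longrightarrow> x \<in> {a i..b i} \<Longrightarrow> i = k"
  using b_less_a[of i k] b_less_a[of k i] by (cases i k rule: linorder_cases) auto

lemma \<gamma>c_holomorphic: assumes "k \<le> g" shows "\<gamma>c k holomorphic_on offcut k"
  unfolding \<gamma>c_def
proof (intro holomorphic_on_mult holomorphic_on_prod holomorphic_on_powr holomorphic_on_const holomorphic_on_minus)
  have ne: "offcut k \<subseteq> - {of_real (a i)}" if "i \<le> g" for i
    using cuts_disjoint[OF that assms, of "a i"] cuts[OF that] by (auto simp: offcut_def)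
  show "w k holomorphic_on offcut k"
    by (rule holomorphic_on_subset[OF w_holomorphic ne[OF assms]])
  show "- w k z \<notin> \<real>\<^sub>\<le>\<^sub>0" if "z \<in> offcut k" for z
    using neg_w_nonpos[OF assms] that by blast
  fix i assume i: "i \<in> {..g} - {k}"
  show "w i holomorphic_on offcut k"
    by (rule holomorphic_on_subset[OF w_holomorphic ne]) (use i in auto)
  show "w i z \<notin> \<real>\<^sub>\<le>\<^sub>0" if "z \<in> offcut k" for z
    using w_nonpos[of i z] cuts_disjoint[of i k "Re z"] i that assms by (auto simp: offcut_def)
qed

text \<open>The zero at a_k stems from the convention that division by 0 yields 0.\<close>

lemma w_eq_0: "w k z = 0 \<longleftrightarrow> z = of_real (b k) \<or> z = of_real (a k)"
  by (simp add: w_def)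

lemma \<gamma>_nonzero: assumes "Im z = 0 \<longrightarrow> Re z \<notin> E" shows "\<gamma> z \<noteq> 0"
  unfolding \<gamma>_def using assms by (auto simp: powr_def w_eq_0 E_def)

lemma \<gamma>c_nonzero: assumes "k \<le> g" "z \<in> offcut k" shows "\<gamma>c k z \<noteq> 0"
proof -
  have "Im z = 0 \<longrightarrow> Re z \<notin> E" using assms cut_not_in_E[of k "Re z"] by (auto simp: offcut_def)
  then show ?thesis
    unfolding \<gamma>c_def using assms(1) by (auto simp: powr_def w_eq_0 E_def)
qed

text \<open>The principal logarithms of u and -u differ by i pi when u is above the real axis and by
  -i pi when it is below. Passing from the lower to the upper side of a cut thus multiplies \<gamma>
  by i.\<close>

lemma powr_quarter_upper: "Im u > 0 \<Longrightarrow> u powr (1/4) = cis (pi / 4) * (- u) powr (1 / 4)"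
proof -
  assume u: "Im u > 0"
  then have "u \<noteq> 0" by auto
  have "Ln u = Ln (- u) + \<i> * of_real pi"
    using Ln_minus[of u] u by (auto simp: \<open>u \<noteq> 0\<close> split: if_splits)
  then show ?thesis using \<open>u \<noteq> 0\<close>
    by (simp add: powr_def cis_conv_exp flip: exp_add) (simp add: field_simps)
qed

lemma powr_quarter_lower: "Im u < 0 \<Longrightarrow> u powr (1/4) = cis (- pi / 4) * (- u) powr (1 / 4)"
proof -
  assume u: "Im u < 0"
  then have "u \<noteq> 0" by auto
  have "Ln u = Ln (- u) - \<i> * of_real pi"
    using Ln_minus[of u] u by (auto simp: \<open>u \<noteq> 0\<close> split: if_splits)
  then show ?thesis using \<open>u \<noteq> 0\<close>
    by (simp add: powr_def cis_conv_exp flip: exp_add) (simp add: field_simps)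
qed

lemma \<gamma>_split: "k \<le> g \<Longrightarrow> \<gamma> z = w k z powr (1 / 4) * (\<Prod>i\<in>{..g} - {k}. w i z powr (1 / 4))"
  unfolding \<gamma>_def by (subst prod.remove[of _ k]) auto

lemma \<gamma>_upper: "k \<le> g \<Longrightarrow> Im z > 0 \<Longrightarrow> \<gamma> z = cis (pi / 4) * \<gamma>c k z"
  using powr_quarter_upper[OF Im_w_pos[of k z]] by (simp add: \<gamma>_split \<gamma>c_def)

lemma \<gamma>_lower: "k \<le> g \<Longrightarrow> Im z < 0 \<Longrightarrow> \<gamma> z = cis (- pi / 4) * \<gamma>c k z"
  using powr_quarter_lower[OF Im_w_neg[of k z]] by (simp add: \<gamma>_split \<gamma>c_def)

lemma w_at_infinity: "(w k \<longlongrightarrow> 1) at_infinity"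
proof -
  have "filterlim (\<lambda>z. - of_real (a k) + z) at_infinity (at_infinity :: complex filter)"
    by (rule tendsto_add_filterlim_at_infinity[OF tendsto_const filterlim_ident])
  then have *: "filterlim (\<lambda>z. z - of_real (a k)) at_infinity (at_infinity :: complex filter)"
    by simp
  then have "((\<lambda>z::complex. 1 - of_real (b k - a k) / (z - of_real (a k))) \<longlongrightarrow> 1 - 0) at_infinity"
    by (intro tendsto_diff tendsto_const tendsto_divide_0[OF tendsto_const *])
  then have "((\<lambda>z::complex. 1 - of_real (b k - a k) / (z - of_real (a k))) \<longlongrightarrow> 1) at_infinity" by simp
  moreover have "\<forall>\<^sub>F z in at_infinity. 1 - of_real (b k - a k) / (z - of_real (a k)) = w k z"
    unfolding eventually_at_infinity
  proof (intro exI allI impI)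
    fix z :: complex assume "\<bar>a k\<bar> + 1 \<le> norm z"
    then have "z \<noteq> of_real (a k)" by auto
    then show "1 - of_real (b k - a k) / (z - of_real (a k)) = w k z" by (simp add: w_eq)
  qed
  ultimately show ?thesis using Lim_transform_eventually by blast
qed

lemma \<gamma>_at_infinity: "(\<gamma> \<longlongrightarrow> 1) at_infinity"
proof -
  have "(\<gamma> \<longlongrightarrow> (\<Prod>k\<le>g. 1 powr (1 / 4))) at_infinity"
    unfolding \<gamma>_def by (intro tendsto_prod tendsto_powr_complex w_at_infinity tendsto_const) auto
  then show ?thesis by simp
qed

end

text \<open>By injectivity of q at most one factor has a pole at e, and it is simple; the factor z -
  e cancels it.\<close>

lemma rational_product_bounded:
  fixes p q :: "nat \<Rightarrow> complex"
  assumes "inj_on q {..g}"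
  shows "\<exists>C. \<forall>\<^sub>F z in at e. norm ((z - e) * (\<Prod>k\<le>g. (z - p k) / (z - q k))) \<le> C"
proof -
  have "\<exists>l. ((\<lambda>z. (z - e) * (\<Prod>k\<le>g. (z - p k) / (z - q k))) \<longlongrightarrow> l) (at e)"
  proof (cases "\<exists>k\<le>g. q k = e")
    case True
    then obtain k where k: "k \<le> g" "q k = e" by blast
    have ne: "e - q i \<noteq> 0" if "i \<in> {..g} - {k}" for i
      using that k assms by (auto simp: inj_on_def)
    have "((\<lambda>z. (z - p k) * (\<Prod>k\<in>{..g} - {k}. (z - p k) / (z - q k))) \<longlongrightarrow>
       (e - p k) * (\<Prod>k\<in>{..g} - {k}. (e - p k) / (e - q k))) (at e)"
      by (intro tendsto_intros ne)
    moreover have "\<forall>\<^sub>F z in at e. (z - p k) * (\<Prod>k\<in>{..g} - {k}. (z - p k) / (z - q k)) =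
        (z - e) * (\<Prod>k\<le>g. (z - p k) / (z - q k))"
    proof -
      have eq: "(\<Prod>i\<le>g. (z - p i) / (z - q i)) = (z - p k) / (z - e) * (\<Prod>i\<in>{..g} - {k}. (z - p i) / (z - q i))" for z
        using prod.remove[of "{..g}" k "\<lambda>i. (z - p i) / (z - q i)"] k by simp
      have cancel: "(z - e) * (c / (z - e) * X) = c * X" if "z \<noteq> e" for z c X :: complex
        using that by simp
      show ?thesis
        unfolding eventually_at_filter eq by (rule always_eventually) (intro allI impI, rule cancel[symmetric])
    qed
    ultimately show ?thesis by (intro exI) (rule Lim_transform_eventually)
  next
    case False
    then have "((\<lambda>z. (z - e) * (\<Prod>k\<le>g. (z - p k) / (z - q k))) \<longlongrightarrow>
       (e - e) * (\<Prod>k\<le>g. (e - p k) / (e - q k))) (at e)"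
      by (intro tendsto_intros) auto
    then show ?thesis by blast
  qed
  then obtain l where l: "((\<lambda>z. (z - e) * (\<Prod>k\<le>g. (z - p k) / (z - q k))) \<longlongrightarrow> l) (at e)" ..
  have "\<forall>\<^sub>F z in at e. norm ((z - e) * (\<Prod>k\<le>g. (z - p k) / (z - q k))) < norm l + 1"
    by (rule order_tendstoD(2)[OF tendsto_norm[OF l]]) simp
  then show ?thesis by (intro exI[of _ "norm l + 1"]) (auto elim: eventually_mono)
qed

context bands
begin

lemma norm_\<gamma>: "norm (\<gamma> z) = norm (\<Prod>k\<le>g. w k z) powr (1 / 4)"
proof -
  have "norm (u powr (1/4)) = norm u powr (1/4)" for u :: complex
    using norm_powr_real_powr'[of "1/4" u] by simp
  then show ?thesis unfolding \<gamma>_def prod_norm[symmetric] by (simp add: prod_powr_distrib)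
qed

lemma inj_a: "inj_on (\<lambda>k. complex_of_real (a k)) {..g}"
proof (rule inj_onI)
  fix i k assume "i \<in> {..g}" "k \<in> {..g}" "complex_of_real (a i) = complex_of_real (a k)"
  then show "i = k"
    using b_less_a[of i k] b_less_a[of k i] cuts[of i] cuts[of k]
    by (cases i k rule: linorder_cases) auto
qed

lemma inj_b: "inj_on (\<lambda>k. complex_of_real (b k)) {..g}"
proof (rule inj_onI)
  fix i k assume "i \<in> {..g}" "k \<in> {..g}" "complex_of_real (b i) = complex_of_real (b k)"
  then show "i = k"
    using b_less_a[of i k] b_less_a[of k i] cuts[of i] cuts[of k]
    by (cases i k rule: linorder_cases) auto
qed

text \<open>The fourth power of \<gamma> and its inverse are rational with simple poles, and the
  root turns order -1 into order -1/4. Both bounds are needed because \<open>M\<close> mixes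
  \<gamma> and 1 / \<gamma>.\<close>

lemma \<gamma>_endpoint:
  "\<exists>C. \<forall>\<^sub>F z in at e. norm (\<gamma> z) \<le> C * norm (z - e) powr (- 1 / 4)"
  "\<exists>C. \<forall>\<^sub>F z in at e. norm (1 / \<gamma> z) \<le> C * norm (z - e) powr (- 1 / 4)"
proof -
  have main: "P powr (1/4) \<le> C powr (1/4) * d powr - (1 / 4)" if "d * P \<le> C" "d > 0" "P \<ge> 0" for P C d :: real
  proof -
    have "P \<le> C / d" using that by (simp add: field_simps)
    then have "P powr (1/4) \<le> (C / d) powr (1/4)" using that by (intro powr_mono2) auto
    also have "\<dots> = C powr (1/4) * d powr - (1 / 4)"
    proof -
      have 1: "(C / d) powr (1/4) = C powr (1/4) / d powr (1/4)"
        by (rule powr_divide)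
      have 2: "d powr - (1/4) = inverse (d powr (1/4))" by (rule powr_minus)
      show ?thesis unfolding 1 2 by (rule divide_inverse)
    qed
    finally show ?thesis .
  qed
  obtain C where C: "\<forall>\<^sub>F z in at e. norm ((z - e) * (\<Prod>k\<le>g. w k z)) \<le> C"
    using rational_product_bounded[OF inj_a, of e "\<lambda>k. of_real (b k)"] unfolding w_def by (elim exE)
  have "\<forall>\<^sub>F z in at e. norm (\<gamma> z) \<le> C powr (1/4) * norm (z - e) powr (- 1 / 4)"
    using C unfolding eventually_at_filter
    by eventually_elim (simp add: norm_\<gamma> norm_mult main)
  then show "\<exists>C. \<forall>\<^sub>F z in at e. norm (\<gamma> z) \<le> C * norm (z - e) powr (- 1 / 4)" by blast
  have inv: "(\<Prod>k\<le>g. (z - of_real (a k)) / (z - of_real (b k))) = inverse (\<Prod>k\<le>g. w k z)" for z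
    by (simp add: w_def prod_inversef[symmetric] o_def)
  obtain C' where C': "\<forall>\<^sub>F z in at e. norm ((z - e) * inverse (\<Prod>k\<le>g. w k z)) \<le> C'"
    using rational_product_bounded[OF inj_b, of e "\<lambda>k. of_real (a k)"] unfolding inv by (elim exE)
  have eq: "norm (1 / \<gamma> z) = norm (inverse (\<Prod>k\<le>g. w k z)) powr (1 / 4)" for z
    by (simp add: norm_divide norm_\<gamma> norm_inverse powr_divide inverse_eq_divide)
  have "\<forall>\<^sub>F z in at e. norm (1 / \<gamma> z) \<le> C' powr (1/4) * norm (z - e) powr (- 1 / 4)"
    using C' unfolding eventually_at_filter
    unfolding eq norm_mult by eventually_elim (simp add: main del: norm_inverse norm_mult)
  then show "\<exists>C. \<forall>\<^sub>F z in at e. norm (1 / \<gamma> z) \<le> C * norm (z - e) powr (- 1 / 4)" by blast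
qed

end

section \<open>The model solution and the transition matrices\<close>

abbreviation (input) J :: "complex^('r::finite + 'r)^('r + 'r)" where
  "J \<equiv> block_matrix 0 (mat 1) (- mat 1) 0"

lemma mat_mult_nth [simp]: "(mat c ** A) $ i $ j = c * A $ i $ j" for A :: "complex^'n^'n"
  by (simp add: matrix_matrix_mult_def mat_def if_distrib[of "\<lambda>c. c * _"] cong: if_cong)

lemma mult_mat_nth [simp]: "(A ** mat c) $ i $ j = A $ i $ j * c" for A :: "complex^'n^'n"
  by (simp add: matrix_matrix_mult_def mat_def if_distrib[of "\<lambda>c. _ * c"] cong: if_cong)

lemma mat_nth: "mat c $ i $ j = (if i = j then c else 0)"
  by (simp add: mat_def)

text \<open>A power function of the matrix J: M c acts as c on the eigenspace of J for i and as 1 /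
  c on that for -i. Hence M is multiplicative in c, M (1 / c) inverts M c, and M i = J, which is how
  the factor i of \<gamma> becomes the jump on the cuts.\<close>

definition M :: "complex \<Rightarrow> complex^('r::finite + 'r)^('r + 'r)" where
  "M c = block_matrix (mat ((c + 1 / c) / 2)) (mat ((c - 1 / c) / (2 * \<i>)))
                      (mat (- ((c - 1 / c) / (2 * \<i>)))) (mat ((c + 1 / c) / 2))"

lemma M_mult_inverse: "c \<noteq> 0 \<Longrightarrow> M c ** M (1 / c) = mat 1"
  unfolding M_def block_matrix_mult block_matrix_one[symmetric]
  by (intro block_matrix_eqI) (auto simp: mat_nth field_simps)

lemma M_jump: "c \<noteq> 0 \<Longrightarrow> M (\<i> * c) = M c ** J"
  unfolding M_def block_matrix_mult
  by (intro block_matrix_eqI) (simp_all add: mat_nth field_simps)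

lemma M_1: "M 1 = mat 1"
  unfolding M_def block_matrix_one[symmetric] by (intro block_matrix_eqI) (simp_all add: mat_nth)

lemma M_nth_cases:
  assumes "\<P> 0" "\<P> ((c + 1 / c) / 2)" "\<P> ((c - 1 / c) / (2 * \<i>))" "\<P> (- ((c - 1 / c) / (2 * \<i>)))"
  shows "\<P> (M c $ i $ j)"
  using assms by (cases i; cases j) (auto simp: M_def mat_nth)

lemma norm_M_le: "norm (M c :: complex^('r::finite + 'r)^('r + 'r)) \<le>
   real CARD('r + 'r) * real CARD('r + 'r) * (norm c + norm (1 / c))"
proof (rule norm_matrix_le)
  fix i j :: "'r + 'r"
  show "norm (M c $ i $ j) \<le> norm c + norm (1 / c)"
  proof (rule M_nth_cases[where \<P>="\<lambda>x. norm x \<le> norm c + norm (1 / c)"])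
    have "norm ((c + 1 / c) / 2) \<le> norm (c + 1 / c)" "norm ((c - 1 / c) / (2 * \<i>)) \<le> norm (c - 1 / c)"
      by (simp_all only: norm_divide norm_mult, simp_all)
    then show "norm ((c + 1 / c) / 2) \<le> norm c + norm (1 / c)"
      and *: "norm ((c - 1 / c) / (2 * \<i>)) \<le> norm c + norm (1 / c)"
      using norm_triangle_ineq[of c "1/c"] norm_triangle_ineq4[of c "1/c"] by linarith+
    then show "norm (- ((c - 1 / c) / (2 * \<i>))) \<le> norm c + norm (1 / c)" by (simp only: norm_minus_cancel)
  qed simp
qed

lemma tendsto_M:
  assumes "(f \<longlongrightarrow> c) F" "c \<noteq> 0"
  shows "((\<lambda>x. M (f x) :: complex^('r::finite + 'r)^('r + 'r)) \<longlongrightarrow> M c) F"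
  unfolding tendsto_matrix_iff
proof (intro allI)
  fix i j :: "'r + 'r"
  have 1: "((\<lambda>x. 1 / f x) \<longlongrightarrow> 1 / c) F" using assms by (intro tendsto_intros)
  show "((\<lambda>x. M (f x) $ i $ j) \<longlongrightarrow> M c $ i $ j) F"
    by (cases i; cases j) (auto simp: M_def mat_nth intro!: tendsto_intros assms 1)
qed

lemma holomorphic_on_mat_nth: "f holomorphic_on S \<Longrightarrow> (\<lambda>z. mat (f z) $ i $ j) holomorphic_on S"
  by (cases "i = j") (simp_all add: mat_nth)

lemma matrix_holomorphic_on_M:
  assumes "f holomorphic_on S" "\<And>z. z \<in> S \<Longrightarrow> f z \<noteq> 0"
  shows "matrix_holomorphic_on (\<lambda>z. M (f z) :: complex^('r::finite + 'r)^('r + 'r)) S"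
  unfolding matrix_holomorphic_on_def
proof (intro allI)
  fix i j :: "'r + 'r"
  show "(\<lambda>z. M (f z) $ i $ j) holomorphic_on S"
    using assms by (cases i; cases j) (simp_all add: M_def, (intro holomorphic_on_mat_nth holomorphic_intros; simp)+)
qed

text \<open>Let S = diag(1, -1), so that diag(K, 1) = (1 + K) / 2 - S (1 - K) / 2, blockwise in K.
  As S anticommutes with J, conjugating S by M c gives M (c^2) S; the formula is (1 + K) / 2 - M t S
  (1 - K) / 2. Since M (-t) = - M t, changing the sign of t exchanges the two diagonal
  blocks.\<close>

definition G :: "complex^'r^'r \<Rightarrow> complex \<Rightarrow> complex^('r::finite + 'r)^('r + 'r)" where
  "G K t = block_matrix
     (mat (1 / 2) ** (mat 1 + K) - mat ((t + 1 / t) / 4) ** (mat 1 - K)) (mat ((t - 1 / t) / (4 * \<i>)) ** (mat 1 - K))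
     (mat ((t - 1 / t) / (4 * \<i>)) ** (mat 1 - K)) (mat (1 / 2) ** (mat 1 + K) + mat ((t + 1 / t) / 4) ** (mat 1 - K))"

text \<open>\<open>G K\<close> is the conjugate of a constant block diagonal matrix by \<open>M\<close>; the block into which \<open>K\<close>
  goes depends on which of the two square roots of \<open>\<plusminus> t\<close> is taken.\<close>

lemma G_upper: "c \<noteq> 0 \<Longrightarrow> G K (c\<^sup>2) ** M c = M c ** block_matrix K 0 0 (mat 1)"
  unfolding M_def G_def block_matrix_mult
  by (intro block_matrix_eqI)
    (auto simp: mat_nth field_simps power2_eq_square)

lemma G_lower: "c \<noteq> 0 \<Longrightarrow> G K (- (c\<^sup>2)) ** M c = M c ** block_matrix (mat 1) 0 0 K"
  unfolding M_def G_def block_matrix_mult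
  by (intro block_matrix_eqI)
    (auto simp: mat_nth field_simps power2_eq_square)

lemma G_mat_1: "G (mat 1) t = mat 1"
  unfolding G_def block_matrix_one[symmetric]
  by (intro block_matrix_eqI) (simp_all add: mat_nth)

text \<open>Conjugation by a fixed matrix is multiplicative; here c is a square root of -t, which
  makes \<open>G K t\<close> a conjugate of diag(1, K).\<close>

lemma G_mult:
  fixes K K' :: "complex^'r::finite^'r"
  assumes "t \<noteq> 0" shows "G K t ** G K' t = G (K ** K') t"
proof -
  define c where "c = csqrt (- t)"
  have c: "c \<noteq> 0" "t = - (c\<^sup>2)" using assms by (auto simp: c_def)
  let ?D = "\<lambda>K. block_matrix (mat 1) 0 0 K"
  have eq: "G L t ** M c = M c ** ?D L" for L :: "complex^'r^'r" using G_lower[OF c(1), of L] c(2) by simp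
  have "G K t ** G K' t ** M c = G K t ** (G K' t ** M c)" by (simp add: matrix_mul_assoc)
  also have "\<dots> = G K t ** M c ** ?D K'" by (simp only: eq[of K'] matrix_mul_assoc)
  also have "\<dots> = M c ** (?D K ** ?D K')" by (simp only: eq[of K] matrix_mul_assoc)
  also have "?D K ** ?D K' = ?D (K ** K')" by (simp add: block_matrix_mult)
  also have "M c ** ?D (K ** K') = G (K ** K') t ** M c" by (rule eq[symmetric])
  finally have "G K t ** G K' t ** M c ** M (1 / c) = G (K ** K') t ** M c ** M (1 / c)" by simp
  then show ?thesis by (simp add: matrix_mul_assoc[symmetric] M_mult_inverse[OF c(1)])
qed

lemma G_inverse: assumes "t \<noteq> 0" "unitary_matrix K" shows "G K t ** G (conj_transpose K) t = mat 1"
  using assms by (simp add: G_mult G_mat_1 unitary_matrix_def)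

text \<open>G is affine in K: up to sign, each entry of the difference is an entry of K - K' times
  1/2 + (t + 1/t)/4, 1/2 - (t + 1/t)/4 or (t - 1/t)/(4 i).\<close>

lemma G_diff_nth:
  assumes "norm t \<le> B" "norm (1 / t) \<le> B"
  shows "norm ((G K t - G K' t) $ i $ j) \<le> (1 + B) * norm (K - K')"
proof -
  have B: "B \<ge> 0" using assms norm_ge_zero order_trans by blast
  have 1: "norm (1 / 2 - (t + 1 / t) / 4 :: complex) \<le> 1 + B" "norm (1 / 2 + (t + 1 / t) / 4 :: complex) \<le> 1 + B"
    "norm ((t - 1 / t) / (4 * \<i>)) \<le> 1 + B"
  proof -
    have s: "norm (t + 1 / t) \<le> 2 * B" "norm (t - 1 / t) \<le> 2 * B"
      using norm_triangle_ineq[of t "1/t"] norm_triangle_ineq4[of t "1/t"] assms by linarith+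
    have "norm ((t + 1 / t) / 4) \<le> B / 2" using s(1) by (simp only: norm_divide) simp
    moreover have "norm (1 / 2 :: complex) = 1 / 2" by simp
    ultimately show "norm (1 / 2 - (t + 1 / t) / 4 :: complex) \<le> 1 + B" "norm (1 / 2 + (t + 1 / t) / 4 :: complex) \<le> 1 + B"
      using norm_triangle_ineq[of "1/2" "(t + 1 / t) / 4"] norm_triangle_ineq4[of "1/2" "(t + 1 / t) / 4"] B by linarith+
    show "norm ((t - 1 / t) / (4 * \<i>)) \<le> 1 + B"
      using s(2) B by (simp only: norm_divide norm_mult) simp
  qed
  have mul: "norm (c * (K - K') $ p $ q) \<le> (1 + B) * norm (K - K')" if "norm c \<le> 1 + B" for c p q
    unfolding norm_mult by (intro mult_mono that norm_entry_le) (use B in auto)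
  have "\<exists>c p q. norm c \<le> 1 + B \<and> (G K t - G K' t) $ i $ j = c * (K - K') $ p $ q"
  proof (cases i; cases j)
    fix p q assume "i = Inl p" "j = Inl q"
    then have "(G K t - G K' t) $ i $ j = (1 / 2 + (t + 1 / t) / 4) * (K - K') $ p $ q"
      by (simp add: G_def mat_nth algebra_simps add_divide_distrib diff_divide_distrib)
    then show ?thesis using 1(2) by blast
  next
    fix p q assume "i = Inr p" "j = Inr q"
    then have "(G K t - G K' t) $ i $ j = (1 / 2 - (t + 1 / t) / 4) * (K - K') $ p $ q"
      by (simp add: G_def mat_nth algebra_simps add_divide_distrib diff_divide_distrib)
    then show ?thesis using 1(1) by blast
  next
    fix p q assume "i = Inl p" "j = Inr q"
    then have "(G K t - G K' t) $ i $ j = (- ((t - 1 / t) / (4 * \<i>))) * (K - K') $ p $ q"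
      by (simp add: G_def mat_nth algebra_simps add_divide_distrib diff_divide_distrib)
    then show ?thesis using 1(3) by (metis norm_minus_cancel)
  next
    fix p q assume "i = Inr p" "j = Inl q"
    then have "(G K t - G K' t) $ i $ j = (- ((t - 1 / t) / (4 * \<i>))) * (K - K') $ p $ q"
      by (simp add: G_def mat_nth algebra_simps add_divide_distrib diff_divide_distrib)
    then show ?thesis using 1(3) by (metis norm_minus_cancel)
  qed
  then show ?thesis using mul by metis
qed

lemma G_diff_le:
  fixes K K' :: "complex^'r^'r"
  assumes "norm t \<le> B" "norm (1 / t) \<le> B"
  shows "norm (G K t - G K' t) \<le> (real CARD('r + 'r) * real CARD('r + 'r) * (1 + B)) * norm (K - K')"
  using norm_matrix_le[OF G_diff_nth[OF assms]] by (simp add: mult.assoc)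

lemma norm_unitary_le: "unitary_matrix K \<Longrightarrow> norm K \<le> real CARD('r) * real CARD('r)" for K :: "complex^'r^'r"
  using norm_matrix_le[OF norm_unitary_entry, of K] by simp

text \<open>Comparison with K = 1, where G is the identity; the unitary matrices lie within bounded
  distance of it.\<close>

lemma G_norm_bound:
  obtains C where "C > 0" "\<And>(K :: complex^'r^'r) t. \<lbrakk>norm t \<le> B; norm (1 / t) \<le> B; unitary_matrix K\<rbrakk> \<Longrightarrow> norm (G K t) \<le> C"
proof -
  define C where "C = (real CARD('r + 'r) * real CARD('r + 'r) * (1 + \<bar>B\<bar>)) * (norm (mat 1 :: complex^'r^'r) + real CARD('r) * real CARD('r))
      + norm (mat 1 :: complex^('r + 'r)^('r + 'r)) + 1"
  have "norm (G K t) \<le> C" if "norm t \<le> B" "norm (1 / t) \<le> B" "unitary_matrix K" for K :: "complex^'r^'r" and t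
  proof -
    have "norm (G K t - mat 1) \<le> (real CARD('r + 'r) * real CARD('r + 'r) * (1 + \<bar>B\<bar>)) * norm (K - mat 1)"
      using G_diff_le[of t "\<bar>B\<bar>" K "mat 1"] that by (simp add: G_mat_1 del: card_sum)
    also have "\<dots> \<le> (real CARD('r + 'r) * real CARD('r + 'r) * (1 + \<bar>B\<bar>)) * (norm (mat 1 :: complex^'r^'r) + real CARD('r) * real CARD('r))"
      using norm_triangle_ineq4[of K "mat 1"] norm_unitary_le[OF that(3)] by (intro mult_left_mono) auto
    finally show ?thesis
      using norm_triangle_ineq[of "G K t - mat 1" "mat 1"] unfolding C_def by simp
  qed
  moreover have "C > 0" unfolding C_def by (intro add_nonneg_pos add_nonneg_nonneg mult_nonneg_nonneg) auto
  ultimately show thesis using that by blast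
qed

lemma matrix_holomorphic_on_G:
  assumes "f holomorphic_on S" "\<And>z. z \<in> S \<Longrightarrow> f z \<noteq> 0"
  shows "matrix_holomorphic_on (\<lambda>z. G K (f z)) S"
  unfolding matrix_holomorphic_on_def
proof (intro allI)
  fix i j
  show "(\<lambda>z. G K (f z) $ i $ j) holomorphic_on S"
    using assms by (cases i; cases j) (simp_all add: G_def, (intro holomorphic_intros; simp)+)
qed

section \<open>Discs around the gaps\<close>

lemma at_upper_half_plane_neq_bot: "at (complex_of_real x) within {z. Im z > 0} \<noteq> bot"
proof -
  have "of_real x islimpt {z. Im z > 0}"
    unfolding islimpt_approachable
  proof (intro allI impI)
    fix e :: real assume "e > 0"
    then show "\<exists>z\<in>{z. Im z > 0}. z \<noteq> of_real x \<and> dist z (of_real x) < e"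
      by (intro bexI[of _ "Complex x (e / 2)"]) (auto simp: dist_norm cmod_def complex_eq_iff)
  qed
  then show ?thesis by (simp add: trivial_limit_within)
qed

text \<open>Continuity of the boundary values is supplied by
  \<open>boundary_values_continuous\<close>.\<close>

lemma has_jumpI:
  assumes "\<And>x. x \<in> I \<Longrightarrow> \<exists>P M. (N \<longlongrightarrow> P) (at (complex_of_real x) within {z. Im z > 0}) \<and>
               (N \<longlongrightarrow> M) (at (complex_of_real x) within {z. Im z < 0}) \<and> P = M ** V"
  shows "has_jump N I V"
proof -
  from assms obtain P M where PM: "\<And>x. x \<in> I \<Longrightarrow> (N \<longlongrightarrow> P x) (at (complex_of_real x) within {z. Im z > 0})"
    "\<And>x. x \<in> I \<Longrightarrow> (N \<longlongrightarrow> M x) (at (complex_of_real x) within {z. Im z < 0})" "\<And>x. x \<in> I \<Longrightarrow> P x = M x ** V"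
    by metis
  have "continuous_on I P" by (rule boundary_values_continuous[OF PM(1) at_upper_half_plane_neq_bot])
  moreover have "continuous_on I M" by (rule boundary_values_continuous[OF PM(2) at_lower_half_plane_neq_bot])
  ultimately show ?thesis
    unfolding has_jump_def has_boundary_values_def using PM by metis
qed

text \<open>The Schwarz lemma at infinity, applied entrywise, upgrades a mere limit to order 1 /
  z.\<close>

lemma matrix_decay_at_infinity:
  fixes F :: "complex \<Rightarrow> complex^'n^'m"
  assumes hol: "matrix_holomorphic_on F {z. norm z > \<rho>}" and lim: "(F \<longlongrightarrow> 0) at_infinity"
  shows "(\<lambda>z. norm (F z)) \<in> O[at_infinity](\<lambda>z. norm (inverse z))"
proof -
  have "\<forall>\<^sub>F z in at_infinity. dist (F z) 0 < 1" by (rule tendstoD[OF lim]) simp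
  then obtain \<rho>1 where \<rho>1: "\<And>z. norm z \<ge> \<rho>1 \<Longrightarrow> norm (F z) < 1"
    unfolding eventually_at_infinity dist_norm by auto
  define r where "r = max 1 (max \<rho> \<rho>1)"
  have "norm (F z) \<le> (real CARD('m) * real CARD('n) * r) * norm (norm (inverse z))" if "norm z > r" for z
  proof -
    have "norm (F z $ i $ j) \<le> 1 * r / norm z" for i j
    proof (rule exterior_schwarz[OF _ _ _ _ that])
      show "(\<lambda>z. F z $ i $ j) holomorphic_on {z. r < norm z}"
        using hol unfolding matrix_holomorphic_on_def by (auto intro: holomorphic_on_subset simp: r_def)
      show "((\<lambda>z. F z $ i $ j) \<longlongrightarrow> 0) at_infinity" using lim by (simp add: tendsto_matrix_iff)
      show "norm (F z $ i $ j) \<le> 1" if "r < norm z" for z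
        using norm_entry_le[of "F z" i j] \<rho>1[of z] that by (auto simp: r_def)
    qed (simp add: r_def)
    from norm_matrix_le[OF this] show ?thesis by (simp add: norm_inverse divide_inverse mult_ac)
  qed
  moreover have "real CARD('m) * real CARD('n) * r > 0" by (simp add: r_def)
  ultimately show ?thesis
    by (intro landau_o.bigI[of "real CARD('m) * real CARD('n) * r"])
      (auto simp: eventually_at_infinity intro!: exI[of _ "r + 1"])
qed

context bands
begin

text \<open>The factor 1/4 makes a disc of radius \<open>rad 2 j\<close> reach at most halfway into
  each neighbouring cut. The open discs around different gaps are then disjoint, and the annuli
  between s = 1 and s = 2 cross the real axis only inside cuts.\<close>

definition del :: real where "del = Min ((\<lambda>k. b k - a k) ` {..g}) / 4"

definition mid :: "nat \<Rightarrow> real" where "mid j = (b (j - 1) + a j) / 2"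

definition rad :: "real \<Rightarrow> nat \<Rightarrow> real" where "rad s j = (a j - b (j - 1)) / 2 + s * del"

lemma del_le: "k \<le> g \<Longrightarrow> 4 * del \<le> b k - a k"
  unfolding del_def by (simp add: Min_le_iff)

lemma del_pos: "del > 0"
  unfolding del_def using cuts by (simp add: Min_gr_iff)

lemma rad_pos: "j \<in> {1..g} \<Longrightarrow> s \<ge> 0 \<Longrightarrow> rad s j > 0"
  unfolding rad_def using gaps[of j] del_pos by (intro add_pos_nonneg) auto

lemma rad_mono: "s < t \<Longrightarrow> rad s j < rad t j"
  unfolding rad_def using del_pos by simp

lemma gap_in_disc: "x \<in> {b (j - 1)..a j} \<Longrightarrow> \<bar>x - mid j\<bar> \<le> rad 0 j"
  unfolding mid_def rad_def by (auto simp: abs_le_iff field_simps)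

lemma disc_real: assumes "j \<in> {1..g}" "\<bar>x - mid j\<bar> \<le> rad 2 j" shows "a (j - 1) < x" "x < b j"
proof -
  have "j - 1 \<le> g" "j \<le> g" using assms by auto
  then show "a (j - 1) < x" "x < b j"
    using assms(2) del_le[of j] del_le[of "j - 1"] del_pos unfolding mid_def rad_def
    by (auto simp: abs_le_iff field_simps)
qed

lemma outside_gap_real: assumes "j \<in> {1..g}" "rad 1 j \<le> \<bar>x - mid j\<bar>" "\<bar>x - mid j\<bar> \<le> rad 2 j"
  shows "x \<in> {a (j - 1)<..<b (j - 1)} \<or> x \<in> {a j<..<b j}"
proof -
  have "x < b (j - 1) \<or> x > a j"
    using assms(2) del_pos unfolding mid_def rad_def by (auto simp: abs_if field_simps split: if_splits)
  then show ?thesis using disc_real[OF assms(1,3)] by auto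
qed

lemma discs_apart: assumes "i \<in> {1..g}" "j \<in> {1..g}" "i < j" shows "rad 2 i + rad 2 j \<le> mid j - mid i"
proof -
  have "b i \<le> b (j - 1)" using assms by (intro b_mono) auto
  then show ?thesis using del_le[of i] assms unfolding mid_def rad_def by (auto simp: field_simps)
qed

text \<open>X will live on \<open>Q\<close> and Y_j on \<open>P j\<close>. They cover the plane by
  \<open>Q_Un_P\<close> and overlap in the annuli \<open>Ann j\<close>.\<close>

definition Q :: "complex set" where "Q = {z. \<forall>j\<in>{1..g}. rad 1 j < cmod (z - complex_of_real (mid j))}"

definition P :: "nat \<Rightarrow> complex set" where "P j = ball (of_real (mid j)) (rad 2 j)"

lemma in_P: "z \<in> P j \<longleftrightarrow> cmod (z - complex_of_real (mid j)) < rad 2 j"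
  by (simp add: P_def dist_norm norm_minus_commute)

lemma open_Q: "open Q"
proof -
  have "Q = (\<Inter>j\<in>{1..g}. {z. rad 1 j < cmod (z - complex_of_real (mid j))})" by (auto simp: Q_def)
  moreover have "open \<dots>" by (intro open_INT ballI open_Collect_less continuous_intros) auto
  ultimately show ?thesis by simp
qed

lemma open_P: "open (P j)" by (simp add: P_def)

text \<open>One inequality is strict because two neighbouring closed discs touch when the cut
  between them is a shortest one.\<close>

lemma discs_disjoint:
  assumes "i \<in> {1..g}" "j \<in> {1..g}" "cmod (z - complex_of_real (mid i)) < rad 2 i" "cmod (z - complex_of_real (mid j)) \<le> rad 2 j"
  shows "i = j"
proof (rule ccontr)
  assume "i \<noteq> j"
  have "norm (complex_of_real (mid i) - of_real (mid j)) \<le> cmod (z - complex_of_real (mid i)) + cmod (z - complex_of_real (mid j))"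
    using norm_triangle_ineq4[of "z - of_real (mid j)" "z - of_real (mid i)"] by (simp add: add.commute)
  moreover have "norm (complex_of_real (mid i) - of_real (mid j)) = \<bar>mid i - mid j\<bar>"
    by (metis norm_of_real of_real_diff)
  moreover have "rad 2 i + rad 2 j \<le> \<bar>mid i - mid j\<bar>"
    using discs_apart[of i j] discs_apart[of j i] assms \<open>i \<noteq> j\<close> by (cases "i < j") auto
  ultimately show False using assms by linarith
qed

lemma Q_Un_P: "z \<in> Q \<or> (\<exists>j\<in>{1..g}. z \<in> P j)"
proof (cases "\<exists>j\<in>{1..g}. z \<in> P j")
  case False
  then have "rad 1 j < cmod (z - complex_of_real (mid j))" if "j \<in> {1..g}" for j
    using that rad_mono[of 1 2 j] by (force simp: in_P)
  then show ?thesis by (simp add: Q_def)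
qed simp

lemma annulus_in_Q: "j \<in> {1..g} \<Longrightarrow> rad 1 j < cmod (z - complex_of_real (mid j)) \<Longrightarrow> cmod (z - complex_of_real (mid j)) \<le> rad 2 j \<Longrightarrow> z \<in> Q"
  unfolding Q_def
proof (intro CollectI ballI)
  fix i assume z: "j \<in> {1..g}" "rad 1 j < cmod (z - complex_of_real (mid j))" "cmod (z - complex_of_real (mid j)) \<le> rad 2 j" and i: "i \<in> {1..g}"
  show "rad 1 i < cmod (z - complex_of_real (mid i))"
    using discs_disjoint[OF i z(1) _ z(3)] z(2) rad_mono[of 1 2 i] by (cases "i = j") force+
qed

text \<open>The discs reach no real point outside [a_0, b_g]. A gauge that switches at the real axis
  is therefore analytic on the part of D inside a disc.\<close>

lemma P_Int_D: "j \<in> {1..g} \<Longrightarrow> z \<in> P j \<Longrightarrow> z \<in> D \<Longrightarrow> Im z \<noteq> 0"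
proof
  assume j: "j \<in> {1..g}" and z: "z \<in> P j" "z \<in> D" and "Im z = 0"
  then have zx: "z = of_real (Re z)" by (simp add: complex_eq_iff)
  have "norm (z - of_real (mid j)) = \<bar>Re z - mid j\<bar>" by (subst zx) (metis norm_of_real of_real_diff)
  then have "a (j - 1) < Re z" "Re z < b j" using disc_real[OF j, of "Re z"] z(1) by (auto simp: in_P)
  moreover have "j - 1 \<le> g" "j \<le> g" using j by auto
  ultimately have "Re z \<in> {a 0..b g}" using a_mono[of 0 "j - 1"] b_mono[of j g] by auto
  then show False using z \<open>Im z = 0\<close> not_in_D by blast
qed

text \<open>The choice of the index matters only at real points of the cuts, since off the real axis
  all branches \<open>\<gamma>c k\<close> lead to the same \<tau>. The default 0 is just some
  admissible index.\<close>

definition \<kappa> :: "real \<Rightarrow> nat" where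
  "\<kappa> x = (if \<exists>k\<le>g. x \<in> {a k<..<b k} then SOME k. k \<le> g \<and> x \<in> {a k<..<b k} else 0)"

lemma \<kappa>_le: "\<kappa> x \<le> g"
  unfolding \<kappa>_def by (auto intro: someI2)

lemma \<kappa>_eq: assumes "k \<le> g" "x \<in> {a k<..<b k}" shows "\<kappa> x = k"
proof -
  have "(SOME k. k \<le> g \<and> x \<in> {a k<..<b k}) = k"
  proof (rule some_equality)
    fix i assume "i \<le> g \<and> x \<in> {a i<..<b i}"
    then show "i = k" using cuts_disjoint[of i k x] assms by auto
  qed (use assms in auto)
  then show ?thesis using assms by (auto simp: \<kappa>_def)
qed

text \<open>\<open>\<tau>\<close> is \<open>\<gamma>\<^sup>2\<close> in the upper and \<open>- \<gamma>\<^sup>2\<close> in the lower half plane; the sign makes it continue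
  analytically across the cuts.\<close>

definition \<tau> :: "complex \<Rightarrow> complex" where "\<tau> z = \<i> * (\<gamma>c (\<kappa> (Re z)) z)\<^sup>2"

lemma \<tau>_upper: assumes "Im z > 0" shows "\<tau> z = (\<gamma> z)\<^sup>2"
proof -
  have "(cis (pi / 4))\<^sup>2 = \<i>" by (simp add: power2_eq_square cis_mult)
  then show ?thesis by (simp add: \<tau>_def \<gamma>_upper[OF \<kappa>_le[of "Re z"] assms] power_mult_distrib)
qed

lemma \<tau>_lower: assumes "Im z < 0" shows "\<tau> z = - (\<gamma> z)\<^sup>2"
proof -
  have "(cis (- pi / 4))\<^sup>2 = - \<i>" by (simp add: power2_eq_square cis_mult)
  then show ?thesis by (simp add: \<tau>_def \<gamma>_lower[OF \<kappa>_le[of "Re z"] assms] power_mult_distrib)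
qed

lemma \<tau>_eq: assumes "k \<le> g" "z \<in> offcut k" shows "\<tau> z = \<i> * (\<gamma>c k z)\<^sup>2"
proof (cases "Im z = 0")
  case True
  then show ?thesis using \<kappa>_eq[OF assms(1)] assms(2) by (simp add: \<tau>_def offcut_def)
next
  case False
  then consider "Im z > 0" | "Im z < 0" by linarith
  then show ?thesis
  proof cases
    case 1
    have "(cis (pi / 4))\<^sup>2 = \<i>" by (simp add: power2_eq_square cis_mult)
    then show ?thesis using \<tau>_upper[OF 1] \<gamma>_upper[OF assms(1) 1] by (simp add: power_mult_distrib)
  next
    case 2
    have "(cis (- pi / 4))\<^sup>2 = - \<i>" by (simp add: power2_eq_square cis_mult)
    then show ?thesis using \<tau>_lower[OF 2] \<gamma>_lower[OF assms(1) 2] by (simp add: power_mult_distrib)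
  qed
qed

text \<open>The closed annuli are compact and still avoid the closed gaps, so \<tau> and 1 / \<tau>
  are bounded on them.\<close>

definition cl_Ann :: "nat \<Rightarrow> complex set" where
  "cl_Ann j = {z. rad 1 j \<le> cmod (z - complex_of_real (mid j)) \<and> cmod (z - complex_of_real (mid j)) \<le> rad 2 j}"

definition Ann :: "nat \<Rightarrow> complex set" where
  "Ann j = {z. rad 1 j < cmod (z - complex_of_real (mid j)) \<and> cmod (z - complex_of_real (mid j)) < rad 2 j}"

lemma Ann_subset_cl: "Ann j \<subseteq> cl_Ann j" by (auto simp: Ann_def cl_Ann_def)

lemma Ann_subset_P: "Ann j \<subseteq> P j" by (auto simp: Ann_def in_P)

lemma Ann_subset_Q: "j \<in> {1..g} \<Longrightarrow> Ann j \<subseteq> Q" using annulus_in_Q[of j] by (auto simp: Ann_def)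

lemma P_Int_Q: "j \<in> {1..g} \<Longrightarrow> z \<in> P j \<Longrightarrow> z \<in> Q \<Longrightarrow> z \<in> Ann j"
  by (auto simp: Ann_def in_P Q_def)

lemma compact_cl_Ann: "compact (cl_Ann j)"
proof -
  have "cl_Ann j = cball (of_real (mid j)) (rad 2 j) - ball (of_real (mid j)) (rad 1 j)"
    by (auto simp: cl_Ann_def dist_norm norm_minus_commute)
  then show ?thesis by (simp add: compact_diff)
qed

lemma cl_Ann_offcut: assumes "j \<in> {1..g}" shows "cl_Ann j \<subseteq> offcut (j - 1) \<union> offcut j"
proof
  fix z assume z: "z \<in> cl_Ann j"
  show "z \<in> offcut (j - 1) \<union> offcut j"
  proof (cases "Im z = 0")
    case True
    then have zx: "z = of_real (Re z)" by (simp add: complex_eq_iff)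
    have "norm (z - of_real (mid j)) = \<bar>Re z - mid j\<bar>" by (subst zx) (metis norm_of_real of_real_diff)
    then show ?thesis using outside_gap_real[OF assms, of "Re z"] z by (auto simp: cl_Ann_def offcut_def)
  qed (simp add: offcut_def)
qed

lemma \<tau>_offcut: assumes "k \<le> g" shows "\<tau> holomorphic_on offcut k" "\<And>z. z \<in> offcut k \<Longrightarrow> \<tau> z \<noteq> 0"
proof -
  show "\<tau> holomorphic_on offcut k"
    by (rule holomorphic_transform[of "\<lambda>z. \<i> * (\<gamma>c k z)\<^sup>2"])
      (use \<tau>_eq[OF assms] \<gamma>c_holomorphic[OF assms] in \<open>auto intro!: holomorphic_intros\<close>)
  show "\<tau> z \<noteq> 0" if "z \<in> offcut k" for z
    using \<tau>_eq[OF assms that] \<gamma>c_nonzero[OF assms that] by simp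
qed

lemma \<tau>_cl_Ann: assumes "j \<in> {1..g}"
  shows "\<tau> holomorphic_on (offcut (j - 1) \<union> offcut j)" "\<And>z. z \<in> offcut (j - 1) \<union> offcut j \<Longrightarrow> \<tau> z \<noteq> 0"
  using \<tau>_offcut[of j] \<tau>_offcut[of "j - 1"] assms open_offcut
  by (auto intro!: holomorphic_on_Un)

lemma \<tau>_bound:
  obtains B where "B > 0" "\<And>j z. j \<in> {1..g} \<Longrightarrow> z \<in> cl_Ann j \<Longrightarrow> norm (\<tau> z) \<le> B \<and> norm (1 / \<tau> z) \<le> B"
proof -
  have "\<exists>B. \<forall>z\<in>cl_Ann j. norm (\<tau> z) + norm (1 / \<tau> z) \<le> B" if j: "j \<in> {1..g}" for j
  proof -
    have "continuous_on (cl_Ann j) \<tau>"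
      using holomorphic_on_imp_continuous_on[OF \<tau>_cl_Ann(1)[OF j]] cl_Ann_offcut[OF j] continuous_on_subset by blast
    moreover have "\<forall>z\<in>cl_Ann j. \<tau> z \<noteq> 0" using \<tau>_cl_Ann(2)[OF j] cl_Ann_offcut[OF j] by blast
    ultimately have "continuous_on (cl_Ann j) (\<lambda>z. norm (\<tau> z) + norm (1 / \<tau> z))"
      by (intro continuous_intros) auto
    from compact_continuous_image[OF this compact_cl_Ann]
    have "bounded ((\<lambda>z. norm (\<tau> z) + norm (1 / \<tau> z)) ` cl_Ann j)" by (rule compact_imp_bounded)
    then show ?thesis unfolding bounded_iff by (auto simp: abs_le_iff)
  qed
  then obtain B where B: "\<And>j z. j \<in> {1..g} \<Longrightarrow> z \<in> cl_Ann j \<Longrightarrow> norm (\<tau> z) + norm (1 / \<tau> z) \<le> B j" by metis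
  define B' where "B' = (\<Sum>j\<in>{1..g}. \<bar>B j\<bar>) + 1"
  have "norm (\<tau> z) \<le> B' \<and> norm (1 / \<tau> z) \<le> B'" if "j \<in> {1..g}" "z \<in> cl_Ann j" for j z
  proof -
    have "\<bar>B j\<bar> \<le> (\<Sum>j\<in>{1..g}. \<bar>B j\<bar>)" by (rule member_le_sum) (use that in auto)
    then show ?thesis
      using B[OF that] norm_ge_zero[of "\<tau> z"] norm_ge_zero[of "1 / \<tau> z"] unfolding B'_def by linarith
  qed
  moreover have "B' > 0" unfolding B'_def by (intro add_nonneg_pos sum_nonneg) auto
  ultimately show thesis using that by blast
qed

end

section \<open>Gluing\<close>

lemma matrix_holomorphic_on_tendsto:
  assumes "matrix_holomorphic_on f S" "open S" "p \<in> S"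
  shows "(f \<longlongrightarrow> f p) (at p within T)"
proof -
  have "isCont f p"
    using matrix_holomorphic_on_continuous[OF assms(1)] assms(2,3) by (simp add: continuous_on_eq_continuous_at)
  then show ?thesis by (simp add: continuous_at_imp_continuous_at_within continuous_within[symmetric])
qed

context bands
begin

text \<open>Right multiplication by \<open>gauge K\<close> keeps the jump \<open>J\<close> on the cuts and creates the jump
  \<open>diag(K, K\<^sup>-\<^sup>1)\<close> on a gap.\<close>

definition gauge :: "complex^'r^'r \<Rightarrow> complex \<Rightarrow> complex^('r::finite + 'r)^('r + 'r)" where
  "gauge K z = (if Im z > 0 then block_matrix K 0 0 (mat 1) else block_matrix (mat 1) 0 0 K)"

definition disc_index :: "complex \<Rightarrow> nat" where
  "disc_index z = (SOME j. j \<in> {1..g} \<and> z \<in> P j)"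

definition glue :: "(nat \<Rightarrow> complex^'r^'r) \<Rightarrow> (complex \<Rightarrow> complex^('r + 'r)^('r + 'r)) \<Rightarrow>
    (nat \<Rightarrow> complex \<Rightarrow> complex^('r + 'r)^('r + 'r)) \<Rightarrow> complex \<Rightarrow> complex^('r::finite + 'r)^('r + 'r)" where
  "glue K X Y z = (if \<exists>j\<in>{1..g}. z \<in> P j
     then Y (disc_index z) z ** M (\<gamma> z) ** gauge (K (disc_index z)) z else X z ** M (\<gamma> z))"

lemma disc_index_eq: assumes "j \<in> {1..g}" "z \<in> P j" shows "disc_index z = j"
  unfolding disc_index_def
proof (rule some_equality)
  fix i assume "i \<in> {1..g} \<and> z \<in> P i"
  then show "i = j" using discs_disjoint[of i j z] assms by (auto simp: in_P)
qed (use assms in auto)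

lemma \<gamma>_nonzero_D: "z \<in> D \<Longrightarrow> \<gamma> z \<noteq> 0"
proof (intro \<gamma>_nonzero impI notI)
  assume "z \<in> D" "Im z = 0" "Re z \<in> E"
  then show False using not_in_D[of z] subsetD[OF E_subset, of "Re z"] by blast
qed

lemma \<gamma>_holomorphic_D: "\<gamma> holomorphic_on D"
proof (rule holomorphic_on_subset[OF \<gamma>_holomorphic])
  show "D \<subseteq> {z. \<forall>k\<le>g. Im z = 0 \<longrightarrow> Re z \<notin> {a k..b k}}"
    using not_in_D cut_subset by blast
qed

lemma G_gauge: assumes "Im z \<noteq> 0" shows "G K (\<tau> z) ** M (\<gamma> z) = M (\<gamma> z) ** gauge K z"
proof -
  have "\<gamma> z \<noteq> 0" using in_D_if_Im[OF assms] \<gamma>_nonzero_D by blast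
  then show ?thesis
    using \<tau>_upper[of z] \<tau>_lower[of z] G_upper[of "\<gamma> z" K] G_lower[of "\<gamma> z" K] assms
    by (cases "Im z > 0") (auto simp: gauge_def)
qed

lemma gauge_norm_bound:
  obtains c where "c > 0" "\<And>z. norm (gauge K z) \<le> c"
proof
  show "norm (block_matrix K 0 0 (mat 1)) + norm (block_matrix (mat 1) 0 0 K) + 1 > 0"
    by (intro add_nonneg_pos add_nonneg_nonneg) auto
  show "norm (gauge K z) \<le> norm (block_matrix K 0 0 (mat 1)) + norm (block_matrix (mat 1) 0 0 K) + 1" for z
    using norm_ge_zero[of "block_matrix K 0 0 (mat 1)"] norm_ge_zero[of "block_matrix (mat 1) 0 0 K"]
    by (auto simp: gauge_def)
qed

text \<open>\<open>C0\<close> is the value of X at infinity: 1 produces a solution of the original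
  problem, 0 one of the homogeneous problem.\<close>

context
  fixes K :: "nat \<Rightarrow> complex^'r::finite^'r"
    and X :: "complex \<Rightarrow> complex^('r + 'r)^('r + 'r)"
    and Y :: "nat \<Rightarrow> complex \<Rightarrow> complex^('r + 'r)^('r + 'r)" and C0
  assumes K: "\<And>j. j \<in> {1..g} \<Longrightarrow> unitary_matrix (K j)"
    and X_hol: "matrix_holomorphic_on X Q" and X_inf: "(X \<longlongrightarrow> C0) at_infinity"
    and Y_hol: "\<And>j. j \<in> {1..g} \<Longrightarrow> matrix_holomorphic_on (Y j) (P j)"
    and XY: "\<And>j z. j \<in> {1..g} \<Longrightarrow> z \<in> Ann j \<Longrightarrow> X z = Y j z ** G (K j) (\<tau> z)"
begin

lemma glue_P: "j \<in> {1..g} \<Longrightarrow> z \<in> P j \<Longrightarrow> glue K X Y z = Y j z ** M (\<gamma> z) ** gauge (K j) z"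
  using disc_index_eq[of j z] by (auto simp: glue_def)

text \<open>On an annulus the identity G M = M gauge turns the formula of the disc into the outer
  one.\<close>

lemma glue_Q: assumes z: "z \<in> Q" "z \<in> D" shows "glue K X Y z = X z ** M (\<gamma> z)"
proof (cases "\<exists>j\<in>{1..g}. z \<in> P j")
  case True
  then obtain j where j: "j \<in> {1..g}" "z \<in> P j" by blast
  have "Im z \<noteq> 0" using P_Int_D[OF j z(2)] .
  have "X z ** M (\<gamma> z) = Y j z ** (G (K j) (\<tau> z) ** M (\<gamma> z))"
    using XY[OF j(1) P_Int_Q[OF j z(1)]] by (simp add: matrix_mul_assoc)
  then show ?thesis using glue_P[OF j] G_gauge[OF \<open>Im z \<noteq> 0\<close>, of "K j"] by (simp add: matrix_mul_assoc)
next
  case False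
  then show ?thesis by (simp add: glue_def)
qed

lemma glue_holomorphic: "matrix_holomorphic_on (glue K X Y) D"
proof -
  let ?U = "{z. Im z > 0}" and ?L = "{z. Im z < 0}"
  have MD: "matrix_holomorphic_on (\<lambda>z. M (\<gamma> z) :: complex^('r + 'r)^('r + 'r)) D"
    by (rule matrix_holomorphic_on_M[OF \<gamma>_holomorphic_D \<gamma>_nonzero_D])
  have 1: "matrix_holomorphic_on (glue K X Y) (D \<inter> Q)"
  proof (subst matrix_holomorphic_on_cong)
    show "glue K X Y z = X z ** M (\<gamma> z)" if "z \<in> D \<inter> Q" for z using glue_Q that by blast
    show "matrix_holomorphic_on (\<lambda>z. X z ** M (\<gamma> z)) (D \<inter> Q)"
      by (intro matrix_holomorphic_on_mult matrix_holomorphic_on_subset[OF X_hol] matrix_holomorphic_on_subset[OF MD]) auto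
  qed
  \<comment> \<open>The disc is cut into halves because on each half the gauge is a constant
    matrix.\<close>
  have 2: "matrix_holomorphic_on (glue K X Y) (P j \<inter> S)" if j: "j \<in> {1..g}" and S: "S = ?U \<or> S = ?L" for j S
  proof (subst matrix_holomorphic_on_cong)
    let ?B = "if S = ?U then block_matrix (K j) 0 0 (mat 1) else block_matrix (mat 1) 0 0 (K j)"
    have ne: "?L \<noteq> ?U" by (auto simp: set_eq_iff intro!: exI[of _ \<i>])
    show "glue K X Y z = Y j z ** M (\<gamma> z) ** ?B" if "z \<in> P j \<inter> S" for z
      using glue_P[OF j, of z] that S ne by (auto simp: gauge_def)
    have "S \<subseteq> D" using S in_D_if_Im by auto
    then show "matrix_holomorphic_on (\<lambda>z. Y j z ** M (\<gamma> z) ** ?B) (P j \<inter> S)"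
      by (intro matrix_holomorphic_on_mult matrix_holomorphic_on_const
          matrix_holomorphic_on_subset[OF Y_hol[OF j]] matrix_holomorphic_on_subset[OF MD]) auto
  qed
  have oU: "open ?U" and oL: "open ?L" by (simp_all add: open_halfspace_Im_gt open_halfspace_Im_lt)
  have "matrix_holomorphic_on (glue K X Y) ((D \<inter> Q) \<union> ((\<Union>j\<in>{1..g}. P j \<inter> ?U) \<union> (\<Union>j\<in>{1..g}. P j \<inter> ?L)))"
    by (intro matrix_holomorphic_on_Un matrix_holomorphic_on_UN 1 2 open_Un open_UN open_Int ballI open_D open_Q open_P oU oL) auto
  then show ?thesis
  proof (rule matrix_holomorphic_on_subset, intro subsetI)
    fix z assume "z \<in> D"
    then show "z \<in> (D \<inter> Q) \<union> ((\<Union>j\<in>{1..g}. P j \<inter> ?U) \<union> (\<Union>j\<in>{1..g}. P j \<inter> ?L))"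
      using Q_Un_P[of z] P_Int_D[of _ z] by (force simp: neq_iff)
  qed
qed

lemma tendsto_X: "p \<in> Q \<Longrightarrow> (X \<longlongrightarrow> X p) (at p within S)"
  by (rule matrix_holomorphic_on_tendsto[OF X_hol open_Q])

lemma tendsto_Y: "j \<in> {1..g} \<Longrightarrow> p \<in> P j \<Longrightarrow> (Y j \<longlongrightarrow> Y j p) (at p within S)"
  by (rule matrix_holomorphic_on_tendsto[OF Y_hol open_P])

lemma eventually_at_open: "open S \<Longrightarrow> p \<in> S \<Longrightarrow> \<forall>\<^sub>F z in at p within T. z \<in> S \<and> z \<in> T"
  unfolding eventually_at_filter by (auto intro: eventually_mono[OF eventually_nhds_in_open])

lemma limits_cut:
  assumes k: "k \<le> g" and x: "x \<in> {a k<..<b k}"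
  shows "((\<lambda>z. M (\<gamma> z)) \<longlongrightarrow> M (cis (pi / 4) * \<gamma>c k (of_real x))) (at (of_real x) within {z. Im z > 0})"
    and "((\<lambda>z. M (\<gamma> z)) \<longlongrightarrow> M (cis (- pi / 4) * \<gamma>c k (of_real x))) (at (of_real x) within {z. Im z < 0})"
proof -
  have xo: "of_real x \<in> offcut k" using x by (simp add: offcut_def)
  have "continuous_on (offcut k) (\<gamma>c k)" using \<gamma>c_holomorphic[OF k] holomorphic_on_imp_continuous_on by blast
  then have "isCont (\<gamma>c k) (of_real x)" using continuous_on_eq_continuous_at open_offcut xo by blast
  then have lim: "(\<gamma>c k \<longlongrightarrow> \<gamma>c k (of_real x)) (at (of_real x) within S)" for S
    using continuous_at_imp_continuous_at_within continuous_within by blast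
  have nz: "\<gamma>c k (of_real x) \<noteq> 0" using \<gamma>c_nonzero[OF k xo] .
  show "((\<lambda>z. M (\<gamma> z)) \<longlongrightarrow> M (cis (pi / 4) * \<gamma>c k (of_real x))) (at (of_real x) within {z. Im z > 0})"
  proof (rule tendsto_M)
    show "(\<gamma> \<longlongrightarrow> cis (pi / 4) * \<gamma>c k (of_real x)) (at (of_real x) within {z. Im z > 0})"
      by (rule Lim_transform_eventually[OF tendsto_mult[OF tendsto_const lim]])
        (auto simp: eventually_at_filter \<gamma>_upper[OF k])
  qed (use nz in simp)
  show "((\<lambda>z. M (\<gamma> z)) \<longlongrightarrow> M (cis (- pi / 4) * \<gamma>c k (of_real x))) (at (of_real x) within {z. Im z < 0})"
  proof (rule tendsto_M)
    show "(\<gamma> \<longlongrightarrow> cis (- pi / 4) * \<gamma>c k (of_real x)) (at (of_real x) within {z. Im z < 0})"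
      by (rule Lim_transform_eventually[OF tendsto_mult[OF tendsto_const lim]])
        (auto simp: eventually_at_filter \<gamma>_lower[OF k])
  qed (use nz in simp)
qed

lemma glue_cut: assumes k: "k \<in> {0..g}" shows "has_jump (glue K X Y) {a k<..<b k} J"
proof (rule has_jumpI)
  fix x assume x: "x \<in> {a k<..<b k}"
  let ?U = "{z. Im z > 0}" and ?L = "{z. Im z < 0}"
  let ?p = "complex_of_real x"
  define u where "u = \<gamma>c k ?p"
  have u: "u \<noteq> 0" unfolding u_def using k x by (intro \<gamma>c_nonzero) (auto simp: offcut_def)
  note lims = limits_cut[OF _ x, folded u_def]
  have cis: "cis (pi / 4) * u = \<i> * (cis (- pi / 4) * u)"
  proof -
    have "cis (pi / 2) * cis (- pi / 4) = cis (pi / 4)" by (simp add: cis_mult del: cis_pi_half)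
    then show ?thesis unfolding cis_pi_half mult.assoc[symmetric] by simp
  qed
  have MJ: "M (cis (pi / 4) * u) = M (cis (- pi / 4) * u) ** J"
    unfolding cis by (rule M_jump) (use u in simp)
  show "\<exists>P Ma. (glue K X Y \<longlongrightarrow> P) (at ?p within ?U) \<and> (glue K X Y \<longlongrightarrow> Ma) (at ?p within ?L) \<and> P = Ma ** J"
    using Q_Un_P[of "complex_of_real x"]
  proof
    assume Q: "?p \<in> Q"
    have gl: "\<forall>\<^sub>F z in at ?p within S. X z ** M (\<gamma> z) = glue K X Y z" if "S = ?U \<or> S = ?L" for S
      using eventually_at_open[OF open_Q Q]
      by (rule eventually_mono) (use that in_D_if_Im glue_Q in auto)
    have "(glue K X Y \<longlongrightarrow> X ?p ** M (cis (pi / 4) * u)) (at ?p within ?U)"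
      by (rule Lim_transform_eventually[OF tendsto_matrix_mult[OF tendsto_X[OF Q] lims(1)] gl]) (use k in auto)
    moreover have "(glue K X Y \<longlongrightarrow> X ?p ** M (cis (- pi / 4) * u)) (at ?p within ?L)"
      by (rule Lim_transform_eventually[OF tendsto_matrix_mult[OF tendsto_X[OF Q] lims(2)] gl]) (use k in auto)
    moreover have "X ?p ** M (cis (pi / 4) * u) = X ?p ** M (cis (- pi / 4) * u) ** J"
      unfolding MJ by (rule matrix_mul_assoc)
    ultimately show ?thesis by (intro exI conjI)
  next
    assume "\<exists>j\<in>{1..g}. ?p \<in> P j"
    then obtain j where j: "j \<in> {1..g}" "?p \<in> P j" by blast
    let ?Bu = "block_matrix (K j) 0 0 (mat 1)" and ?Bl = "block_matrix (mat 1) 0 0 (K j)"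
    have glu: "\<forall>\<^sub>F z in at ?p within ?U. Y j z ** M (\<gamma> z) ** ?Bu = glue K X Y z"
      using eventually_at_open[OF open_P j(2)] by (rule eventually_mono) (simp add: glue_P[OF j(1)] gauge_def)
    have gll: "\<forall>\<^sub>F z in at ?p within ?L. Y j z ** M (\<gamma> z) ** ?Bl = glue K X Y z"
      using eventually_at_open[OF open_P j(2)] by (rule eventually_mono) (simp add: glue_P[OF j(1)] gauge_def)
    have "(glue K X Y \<longlongrightarrow> Y j ?p ** M (cis (pi / 4) * u) ** ?Bu) (at ?p within ?U)"
      by (rule Lim_transform_eventually[OF tendsto_matrix_mult[OF tendsto_matrix_mult[OF tendsto_Y[OF j] lims(1)] tendsto_const] glu])
        (use k in auto)
    moreover have "(glue K X Y \<longlongrightarrow> Y j ?p ** M (cis (- pi / 4) * u) ** ?Bl) (at ?p within ?L)"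
      by (rule Lim_transform_eventually[OF tendsto_matrix_mult[OF tendsto_matrix_mult[OF tendsto_Y[OF j] lims(2)] tendsto_const] gll])
        (use k in auto)
    \<comment> \<open>J exchanges the two diagonal blocks, so the gauges of the two sides pass
      through it and the jump J on the cut survives.\<close>
    moreover have JB: "J ** ?Bu = ?Bl ** J"
    proof -
      have "- mat 1 = (mat (- 1) :: complex^'r^'r)" by (simp add: vec_eq_iff mat_nth)
      then show ?thesis
        unfolding block_matrix_mult by (intro block_matrix_eqI) simp_all
    qed
    have "Y j ?p ** M (cis (pi / 4) * u) ** ?Bu = Y j ?p ** M (cis (- pi / 4) * u) ** (J ** ?Bu)"
      unfolding MJ by (simp only: matrix_mul_assoc)
    then have "Y j ?p ** M (cis (pi / 4) * u) ** ?Bu = Y j ?p ** M (cis (- pi / 4) * u) ** ?Bl ** J"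
      unfolding JB by (simp only: matrix_mul_assoc)
    ultimately show ?thesis by (intro exI conjI)
  qed
qed

lemma glue_gap: assumes j: "j \<in> {1..g}"
  shows "has_jump (glue K X Y) {b (j - 1)<..<a j} (block_matrix (K j) 0 0 (conj_transpose (K j)))"
proof (rule has_jumpI)
  fix x assume x: "x \<in> {b (j - 1)<..<a j}"
  let ?U = "{z. Im z > 0}" and ?L = "{z. Im z < 0}"
  let ?p = "complex_of_real x"
  have p: "?p \<in> P j"
  proof -
    have "cmod (?p - of_real (mid j)) = \<bar>x - mid j\<bar>" by (metis norm_of_real of_real_diff)
    then show ?thesis using gap_in_disc[of x j] x rad_mono[of 0 2 j] by (auto simp: in_P)
  qed
  have dom: "?p \<in> {z. \<forall>k\<le>g. Im z = 0 \<longrightarrow> Re z \<notin> {a k..b k}}"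
  proof -
    have "x \<notin> {a k..b k}" if "k \<le> g" for k
    proof -
      have "b k \<le> b (j - 1)" if "k < j" using that j by (intro b_mono) auto
      moreover have "a j \<le> a k" if "\<not> k < j" using that j \<open>k \<le> g\<close> by (intro a_mono) auto
      ultimately show ?thesis using x by (cases "k < j") auto
    qed
    then show ?thesis by simp
  qed
  have "isCont \<gamma> ?p"
    using \<gamma>_holomorphic open_\<gamma>_domain dom continuous_on_eq_continuous_at holomorphic_on_imp_continuous_on by blast
  then have "(\<gamma> \<longlongrightarrow> \<gamma> ?p) (at ?p within S)" for S
    using continuous_at_imp_continuous_at_within continuous_within by blast
  moreover have "\<gamma> ?p \<noteq> 0" using gap_not_in_E[OF j x] by (intro \<gamma>_nonzero) simp
  ultimately have lim: "((\<lambda>z. M (\<gamma> z)) \<longlongrightarrow> M (\<gamma> ?p)) (at ?p within S)" for S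
    by (rule tendsto_M)
  let ?Bu = "block_matrix (K j) 0 0 (mat 1)" and ?Bl = "block_matrix (mat 1) 0 0 (K j)"
  have glu: "\<forall>\<^sub>F z in at ?p within ?U. Y j z ** M (\<gamma> z) ** ?Bu = glue K X Y z"
    using eventually_at_open[OF open_P p] by (rule eventually_mono) (simp add: glue_P[OF j] gauge_def)
  have gll: "\<forall>\<^sub>F z in at ?p within ?L. Y j z ** M (\<gamma> z) ** ?Bl = glue K X Y z"
    using eventually_at_open[OF open_P p] by (rule eventually_mono) (simp add: glue_P[OF j] gauge_def)
  have "(glue K X Y \<longlongrightarrow> Y j ?p ** M (\<gamma> ?p) ** ?Bu) (at ?p within ?U)"
    by (rule Lim_transform_eventually[OF tendsto_matrix_mult[OF tendsto_matrix_mult[OF tendsto_Y[OF j p] lim] tendsto_const] glu])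
  moreover have "(glue K X Y \<longlongrightarrow> Y j ?p ** M (\<gamma> ?p) ** ?Bl) (at ?p within ?L)"
    by (rule Lim_transform_eventually[OF tendsto_matrix_mult[OF tendsto_matrix_mult[OF tendsto_Y[OF j p] lim] tendsto_const] gll])
  \<comment> \<open>The gap jump is created here: \<gamma> is continuous across the gap, and the two
    gauges differ by diag(K, K^-1).\<close>
  moreover have "?Bl ** block_matrix (K j) 0 0 (conj_transpose (K j)) = ?Bu"
    using K[OF j] by (simp add: block_matrix_mult unitary_matrix_def)
  then have "Y j ?p ** M (\<gamma> ?p) ** ?Bu = Y j ?p ** M (\<gamma> ?p) ** ?Bl ** block_matrix (K j) 0 0 (conj_transpose (K j))"
    by (metis matrix_mul_assoc)
  ultimately show "\<exists>P Ma. (glue K X Y \<longlongrightarrow> P) (at ?p within ?U) \<and> (glue K X Y \<longlongrightarrow> Ma) (at ?p within ?L) \<and>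
      P = Ma ** block_matrix (K j) 0 0 (conj_transpose (K j))" by (intro exI conjI)
qed

lemma glue_infinity: "(\<lambda>z. norm (glue K X Y z - C0)) \<in> O[at_infinity](\<lambda>z. norm (inverse z))"
proof (rule matrix_decay_at_infinity)
  define \<rho> where "\<rho> = \<bar>a 0\<bar> + \<bar>b g\<bar>"
  show "matrix_holomorphic_on (\<lambda>z. glue K X Y z - C0) {z. \<rho> < norm z}"
  proof (intro matrix_holomorphic_on_diff matrix_holomorphic_on_const matrix_holomorphic_on_subset[OF glue_holomorphic])
    show "{z. \<rho> < norm z} \<subseteq> D" by (auto simp: D_def \<rho>_def)
  qed
  have "((\<lambda>z. X z ** M (\<gamma> z)) \<longlongrightarrow> C0 ** M 1) at_infinity"
    by (intro tendsto_matrix_mult X_inf tendsto_M \<gamma>_at_infinity) simp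
  moreover have "\<forall>\<^sub>F z in at_infinity. X z ** M (\<gamma> z) = glue K X Y z"
    unfolding eventually_at_infinity
  proof (intro exI allI impI)
    fix z :: complex assume z: "\<rho> + (\<Sum>j\<in>{1..g}. \<bar>mid j\<bar> + \<bar>rad 2 j\<bar>) + 1 \<le> norm z"
    have "\<rho> \<ge> 0" by (simp add: \<rho>_def)
    have "z \<notin> P j" if "j \<in> {1..g}" for j
    proof -
      have "\<bar>mid j\<bar> + \<bar>rad 2 j\<bar> \<le> (\<Sum>j\<in>{1..g}. \<bar>mid j\<bar> + \<bar>rad 2 j\<bar>)"
        by (rule member_le_sum) (use that in auto)
      then have "\<bar>mid j\<bar> + \<bar>rad 2 j\<bar> < norm z" using z \<open>\<rho> \<ge> 0\<close> by linarith
      moreover have "norm z \<le> cmod (z - of_real (mid j)) + \<bar>mid j\<bar>"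
        using norm_triangle_ineq[of "z - of_real (mid j)" "of_real (mid j)"] by simp
      ultimately show ?thesis unfolding in_P by linarith
    qed
    then show "X z ** M (\<gamma> z) = glue K X Y z" by (simp add: glue_def)
  qed
  ultimately have "(glue K X Y \<longlongrightarrow> C0 ** M 1) at_infinity" by (rule Lim_transform_eventually)
  then show "((\<lambda>z. glue K X Y z - C0) \<longlongrightarrow> 0) at_infinity"
    by (simp add: M_1 LIM_zero_iff)
qed

lemma M_\<gamma>_endpoint: "\<exists>C>0. \<forall>\<^sub>F z in at e. norm (M (\<gamma> z) :: complex^('r + 'r)^('r + 'r)) \<le> C * norm (z - e) powr (- 1 / 4)"
proof -
  obtain C1 where C1: "\<forall>\<^sub>F z in at e. norm (\<gamma> z) \<le> C1 * norm (z - e) powr (- 1 / 4)"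
    by (rule exE[OF \<gamma>_endpoint(1)])
  obtain C2 where C2: "\<forall>\<^sub>F z in at e. norm (1 / \<gamma> z) \<le> C2 * norm (z - e) powr (- 1 / 4)"
    by (rule exE[OF \<gamma>_endpoint(2)])
  let ?n = "real CARD('r + 'r) * real CARD('r + 'r)"
  have "\<forall>\<^sub>F z in at e. norm (M (\<gamma> z) :: complex^('r + 'r)^('r + 'r)) \<le> (?n * (\<bar>C1\<bar> + \<bar>C2\<bar>) + 1) * norm (z - e) powr (- 1 / 4)"
    using C1 C2
  proof eventually_elim
    case (elim z)
    let ?d = "norm (z - e) powr (- 1 / 4)"
    have "C1 * ?d \<le> \<bar>C1\<bar> * ?d" "C2 * ?d \<le> \<bar>C2\<bar> * ?d" by (intro mult_right_mono; simp)+
    then have le: "norm (\<gamma> z) + norm (1 / \<gamma> z) \<le> (\<bar>C1\<bar> + \<bar>C2\<bar>) * ?d"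
      using elim unfolding distrib_right by linarith
    have "norm (M (\<gamma> z) :: complex^('r + 'r)^('r + 'r)) \<le> ?n * (norm (\<gamma> z) + norm (1 / \<gamma> z))"
      by (rule norm_M_le)
    also have "\<dots> \<le> ?n * ((\<bar>C1\<bar> + \<bar>C2\<bar>) * ?d)"
      by (intro mult_left_mono le) auto
    also have "\<dots> = (?n * (\<bar>C1\<bar> + \<bar>C2\<bar>)) * ?d" by (rule mult.assoc[symmetric])
    also have "\<dots> \<le> (?n * (\<bar>C1\<bar> + \<bar>C2\<bar>) + 1) * ?d" by (intro mult_right_mono) auto
    finally show ?case .
  qed
  moreover have "?n * (\<bar>C1\<bar> + \<bar>C2\<bar>) + 1 > 0" by (intro add_nonneg_pos mult_nonneg_nonneg add_nonneg_nonneg) auto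
  ultimately show ?thesis by blast
qed

lemma locally_bounded: "(f \<longlongrightarrow> f p) (at p) \<Longrightarrow> \<exists>C>0. \<forall>\<^sub>F z in at p. norm (f z) \<le> C"
  for f :: "complex \<Rightarrow> complex^'n^'m"
proof -
  assume "(f \<longlongrightarrow> f p) (at p)"
  then have "\<forall>\<^sub>F z in at p. norm (f z) < norm (f p) + 1"
    by (intro order_tendstoD(2)[OF tendsto_norm]) auto
  then have "\<forall>\<^sub>F z in at p. norm (f z) \<le> norm (f p) + 1" by (rule eventually_mono) simp
  then show ?thesis by (intro exI[of _ "norm (f p) + 1"]) (auto intro: add_nonneg_pos)
qed

text \<open>Every point is interior to Q or to some disc, where X or Y_j is locally bounded; the
  singularity comes from M(\<gamma>) alone.\<close>

lemma glue_endpoint: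
  "(\<lambda>z. norm (glue K X Y z)) \<in> O[at (complex_of_real e) within D](\<lambda>z. norm (z - of_real e) powr (- 1 / 4))"
proof -
  let ?p = "complex_of_real e" and ?d = "\<lambda>z. norm (z - complex_of_real e) powr (- 1 / 4)"
  obtain CM where CM: "CM > 0" "\<forall>\<^sub>F z in at ?p. norm (M (\<gamma> z) :: complex^('r + 'r)^('r + 'r)) \<le> CM * ?d z"
    using M_\<gamma>_endpoint by blast
  obtain c where c: "c > 0"
    "\<And>A B. norm (A ** B :: complex^('r + 'r)^('r + 'r)) \<le> c * norm (A :: complex^('r + 'r)^('r + 'r)) * norm B"
    using matrix_mult_bound by blast
  have prod: "norm (A ** B) \<le> c * C1 * C2" if "norm A \<le> C1" "norm B \<le> C2" for A B :: "complex^('r + 'r)^('r + 'r)" and C1 C2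
  proof -
    have "C1 \<ge> 0" using that(1) norm_ge_zero order_trans by blast
    have "norm (A ** B) \<le> c * (norm A * norm B)" using c(2)[of A B] by (simp add: mult.assoc)
    also have "\<dots> \<le> c * (C1 * C2)" using c(1) \<open>C1 \<ge> 0\<close> that by (intro mult_left_mono mult_mono) auto
    finally show ?thesis by (simp add: mult.assoc)
  qed
  have inD: "\<forall>\<^sub>F z in at ?p within D. z \<in> D" by (simp add: eventually_at_filter)
  have wD: "eventually R (at ?p within D)" if "eventually R (at ?p)" for R
    using that by (rule filter_leD[OF at_le, rotated]) simp
  have "\<exists>C. \<forall>\<^sub>F z in at ?p within D. norm (glue K X Y z) \<le> C * ?d z"
    using Q_Un_P[of "complex_of_real e"]
  proof
    assume Q: "?p \<in> Q"
    obtain C where C: "C > 0" "\<forall>\<^sub>F z in at ?p. norm (X z) \<le> C" using locally_bounded[OF tendsto_X[OF Q]] by blast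
    have "\<forall>\<^sub>F z in at ?p within D. norm (glue K X Y z) \<le> (c * C * CM) * ?d z"
      using inD wD[OF C(2)] wD[OF CM(2)] eventually_at_open[OF open_Q Q, of D]
    proof eventually_elim
      case (elim z)
      then show ?case using prod[of "X z" C "M (\<gamma> z)" "CM * ?d z"] glue_Q[of z] by (simp add: mult.assoc)
    qed
    then show ?thesis by blast
  next
    assume "\<exists>j\<in>{1..g}. ?p \<in> P j"
    then obtain j where j: "j \<in> {1..g}" "?p \<in> P j" by blast
    obtain C where C: "C > 0" "\<forall>\<^sub>F z in at ?p. norm (Y j z) \<le> C" using locally_bounded[OF tendsto_Y[OF j]] by blast
    obtain cg where cg: "cg > 0" "\<And>z. norm (gauge (K j) z) \<le> cg" using gauge_norm_bound by blast
    have "\<forall>\<^sub>F z in at ?p within D. norm (glue K X Y z) \<le> (c * (c * C * CM) * cg) * ?d z"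
      using inD wD[OF C(2)] wD[OF CM(2)] eventually_at_open[OF open_P j(2), of D]
    proof eventually_elim
      case (elim z)
      have "norm (Y j z ** M (\<gamma> z) ** gauge (K j) z) \<le> c * (c * C * (CM * ?d z)) * cg"
        by (intro prod cg elim)
      then show ?case using glue_P[OF j(1), of z] elim by (simp add: mult_ac)
    qed
    then show ?thesis by blast
  qed
  then obtain C where C: "\<forall>\<^sub>F z in at ?p within D. norm (glue K X Y z) \<le> C * ?d z" ..
  have "\<forall>\<^sub>F z in at ?p within D. norm (norm (glue K X Y z)) \<le> (\<bar>C\<bar> + 1) * norm (?d z)"
    using C
  proof eventually_elim
    case (elim z)
    have "C * ?d z \<le> (\<bar>C\<bar> + 1) * ?d z" by (intro mult_right_mono) auto
    then show ?case using elim by simp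
  qed
  then show ?thesis by (intro landau_o.bigI[of "\<bar>C\<bar> + 1"]) auto
qed

end

end

section \<open>Laurent splitting and normal families\<close>

text \<open>Since f tends to 0, it is below \<epsilon> on a large circle, and the maximum principle
  applies on the annulus in between. The Schwarz lemma at infinity then adds the factor \<rho> /
  |z|.\<close>

lemma exterior_max_modulus:
  fixes f :: "complex \<Rightarrow> complex"
  assumes hol: "f holomorphic_on {z. norm z > \<rho>'}" and \<rho>: "0 < \<rho>" "\<rho>' < \<rho>" and lim: "(f \<longlongrightarrow> 0) at_infinity"
    and le: "\<And>z. norm z = \<rho> \<Longrightarrow> norm (f z) \<le> \<epsilon>" and \<epsilon>: "\<epsilon> > 0" and z: "norm z > \<rho>"
  shows "norm (f z) \<le> \<epsilon> * \<rho> / norm z"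
proof (rule exterior_schwarz[OF _ \<rho>(1) lim _ z])
  show "f holomorphic_on {z. \<rho> < norm z}" by (rule holomorphic_on_subset[OF hol]) (use \<rho> in auto)
  fix z :: complex assume z: "norm z > \<rho>"
  have "\<forall>\<^sub>F z in at_infinity. dist (f z) 0 < \<epsilon>" by (rule tendstoD[OF lim \<epsilon>])
  then obtain T where T: "\<And>z. norm z \<ge> T \<Longrightarrow> norm (f z) < \<epsilon>"
    unfolding eventually_at_infinity dist_norm by auto
  define A where "A = ball 0 (max T (norm z) + 1) - cball (0::complex) \<rho>"
  have opn: "open A" by (simp add: A_def open_Diff)
  have cl: "closure A \<subseteq> cball 0 (max T (norm z) + 1) - ball 0 \<rho>"
    by (rule closure_minimal) (auto simp: A_def closed_Diff)
  show "norm (f z) \<le> \<epsilon>"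
  proof (rule maximum_modulus_frontier[of f A])
    show "f holomorphic_on interior A"
      by (rule holomorphic_on_subset[OF hol]) (use \<rho> opn in \<open>auto simp: interior_open A_def\<close>)
    show "continuous_on (closure A) f"
      by (rule continuous_on_subset[OF holomorphic_on_imp_continuous_on[OF hol]])
        (use cl \<rho> in \<open>force simp: dist_norm\<close>)
    show "bounded A" unfolding A_def by (rule bounded_subset[OF bounded_ball]) auto
    show "z \<in> A" using z by (simp add: A_def dist_norm)
    fix \<zeta> assume "\<zeta> \<in> frontier A"
    then have \<zeta>: "\<zeta> \<in> closure A" "\<zeta> \<notin> A" using opn by (auto simp: frontier_def interior_open)
    then have "norm \<zeta> = \<rho> \<or> norm \<zeta> \<ge> max T (norm z) + 1"
      using cl by (auto simp: A_def dist_norm subset_iff not_less)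
    then show "norm (f \<zeta>) \<le> \<epsilon>" using le[of \<zeta>] T[of \<zeta>] by force
  qed
qed

lemma Cauchy_transform_holomorphic:
  assumes cont: "continuous_on (sphere m \<rho>) f" and \<rho>: "\<rho> > 0"
  shows "(\<lambda>w. contour_integral (circlepath m \<rho>) (\<lambda>u. f u / (u - w))) holomorphic_on - sphere m \<rho>"
proof -
  have pi: "path_image (circlepath m \<rho>) = sphere m \<rho>" using \<rho> by simp
  have "(\<lambda>w. contour_integral (circlepath m \<rho>) (\<lambda>u. f u / (u - w))) field_differentiable at w"
    if w: "w \<in> - sphere m \<rho>" for w
  proof -
    have int: "((\<lambda>u. f u / (u - w) ^ 1) has_contour_integral contour_integral (circlepath m \<rho>) (\<lambda>u. f u / (u - w))) (circlepath m \<rho>)"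
      if w: "w \<in> UNIV - path_image (circlepath m \<rho>)" for w
    proof -
      have "(\<lambda>u. f u / (u - w)) contour_integrable_on circlepath m \<rho>"
        by (rule contour_integrable_continuous_circlepath) (use w cont pi \<rho> in \<open>auto intro!: continuous_intros\<close>)
      then show ?thesis by (simp add: has_contour_integral_integral)
    qed
    have "\<And>t. t \<in> {0..1} \<Longrightarrow> norm (vector_derivative (circlepath m \<rho>) (at t)) \<le> 2 * pi * \<bar>\<rho>\<bar>"
      by (simp add: vector_derivative_circlepath norm_mult)
    note bd = this
    show ?thesis
      unfolding field_differentiable_def
      by (intro exI, rule Cauchy_next_derivative(2)[where S=UNIV and k=1 and f'=f, OF _ bd int])
        (use w cont pi in auto)
  qed
  then show ?thesis by (simp add: holomorphic_on_def field_differentiable_at_within)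
qed

lemma Cauchy_transform_bound:
  assumes cont: "continuous_on (sphere m \<rho>) f" and \<rho>: "\<rho> > 0" and d: "d > 0"
    and B: "\<And>u. u \<in> sphere m \<rho> \<Longrightarrow> norm (f u) \<le> B"
    and w: "\<And>u. u \<in> sphere m \<rho> \<Longrightarrow> d \<le> norm (u - w)"
  shows "norm (contour_integral (circlepath m \<rho>) (\<lambda>u. f u / (u - w))) \<le> B / d * (2 * pi * \<rho>)"
proof -
  have "m + of_real \<rho> \<in> sphere m \<rho>" using \<rho> by (simp add: dist_norm)
  then have B0: "B \<ge> 0" using B norm_ge_zero order_trans by blast
  have int: "(\<lambda>u. f u / (u - w)) contour_integrable_on circlepath m \<rho>"
  proof (rule contour_integrable_continuous_circlepath)
    have "u \<noteq> w" if "u \<in> sphere m \<rho>" for u using w[OF that] d by auto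
    then show "continuous_on (path_image (circlepath m \<rho>)) (\<lambda>u. f u / (u - w))"
      using cont \<rho> by (auto intro!: continuous_intros)
  qed
  show ?thesis
  proof (rule has_contour_integral_bound_circlepath[OF has_contour_integral_integral[OF int]])
    fix u assume "norm (u - m) = \<rho>"
    then have u: "u \<in> sphere m \<rho>" by (simp add: dist_norm norm_minus_commute)
    show "norm (f u / (u - w)) \<le> B / d"
      unfolding norm_divide using B[OF u] w[OF u] d B0 by (intro frac_le) auto
  qed (use B0 d \<rho> in auto)
qed

text \<open>The difference quotient of f at z is analytic on the annulus, so its integrals over the
  two homotopic circles agree. The kernel 1 / (u - z) integrates to 2 pi i over the outer circle and
  to 0 over the inner one.\<close>

lemma Cauchy_formula_annulus:
  assumes hol: "f holomorphic_on {z. r < norm (z - m) \<and> norm (z - m) < R}"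
    and r: "0 \<le> r" "r < \<rho>1" "\<rho>1 < \<rho>2" "\<rho>2 < R" and z: "\<rho>1 < norm (z - m)" "norm (z - m) < \<rho>2"
  shows "2 * pi * \<i> * f z = contour_integral (circlepath m \<rho>2) (\<lambda>u. f u / (u - z))
                         - contour_integral (circlepath m \<rho>1) (\<lambda>u. f u / (u - z))"
proof -
  define A where "A = {z. r < norm (z - m) \<and> norm (z - m) < R}"
  have oA: "open A" unfolding A_def by (intro open_Collect_conj open_Collect_less continuous_intros)
  have zA: "z \<in> A" using z r by (simp add: A_def)
  define \<phi> where "\<phi> u = (if u = z then deriv f z else (f u - f z) / (u - z))" for u
  have \<phi>: "\<phi> holomorphic_on A"
    unfolding \<phi>_def by (rule pole_lemma_open[OF _ oA]) (use hol A_def in simp)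
  have sph: "sphere m \<rho> \<subseteq> A" if "\<rho> = \<rho>1 \<or> \<rho> = \<rho>2" for \<rho>
    using that r by (auto simp: A_def dist_norm norm_minus_commute)
  have pos: "\<rho>1 > 0" "\<rho>2 > 0" using r by auto
  have eq: "contour_integral (circlepath m \<rho>1) \<phi> = contour_integral (circlepath m \<rho>2) \<phi>"
  proof (rule Cauchy_theorem_homotopic_loops[OF homotopic_loops_linear oA \<phi>])
    fix t :: real
    show "closed_segment (circlepath m \<rho>1 t) (circlepath m \<rho>2 t) \<subseteq> A"
    proof
      fix u assume "u \<in> closed_segment (circlepath m \<rho>1 t) (circlepath m \<rho>2 t)"
      then obtain s where s: "0 \<le> s" "s \<le> 1" "u = (1 - s) *\<^sub>R circlepath m \<rho>1 t + s *\<^sub>R circlepath m \<rho>2 t"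
        by (auto simp: in_segment)
      have "u - m = of_real ((1 - s) * \<rho>1 + s * \<rho>2) * exp (2 * of_real pi * \<i> * of_real t)"
        unfolding s(3) circlepath by (simp add: scaleR_conv_of_real algebra_simps)
      then have "norm (u - m) = \<bar>(1 - s) * \<rho>1 + s * \<rho>2\<bar>"
        by (simp only: norm_mult norm_of_real) (simp add: norm_exp_eq_Re)
      moreover define v where "v = s * (\<rho>2 - \<rho>1)"
      have "(1 - s) * \<rho>1 + s * \<rho>2 = \<rho>1 + v" by (simp add: v_def algebra_simps)
      moreover have "0 \<le> v" "v \<le> \<rho>2 - \<rho>1"
        unfolding v_def using s r mult_right_mono[of s 1 "\<rho>2 - \<rho>1"] by auto
      ultimately show "u \<in> A" using r pos by (simp add: A_def)
    qed
  qed auto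
  have split: "contour_integral (circlepath m \<rho>) (\<lambda>u. f u / (u - z)) =
      contour_integral (circlepath m \<rho>) \<phi> + f z * contour_integral (circlepath m \<rho>) (\<lambda>u. 1 / (u - z))"
    if \<rho>: "\<rho> = \<rho>1 \<or> \<rho> = \<rho>2" for \<rho>
  proof -
    have ne: "u \<noteq> z" if "u \<in> sphere m \<rho>" for u
      using that \<rho> z by (auto simp: dist_norm norm_minus_commute)
    have pi: "path_image (circlepath m \<rho>) = sphere m \<rho>" using \<rho> pos by auto
    have "\<phi> contour_integrable_on circlepath m \<rho>"
      by (rule contour_integrable_continuous_circlepath, unfold pi)
        (rule continuous_on_subset[OF holomorphic_on_imp_continuous_on[OF \<phi>] sph[OF \<rho>]])
    moreover have "(\<lambda>u. 1 / (u - z)) contour_integrable_on circlepath m \<rho>"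
      by (rule contour_integrable_continuous_circlepath) (use ne pi in \<open>auto intro!: continuous_intros\<close>)
    ultimately have "((\<lambda>u. \<phi> u + f z * (1 / (u - z))) has_contour_integral
       contour_integral (circlepath m \<rho>) \<phi> + f z * contour_integral (circlepath m \<rho>) (\<lambda>u. 1 / (u - z))) (circlepath m \<rho>)"
      by (intro has_contour_integral_add has_contour_integral_lmul has_contour_integral_integral)
    then have "((\<lambda>u. f u / (u - z)) has_contour_integral
       contour_integral (circlepath m \<rho>) \<phi> + f z * contour_integral (circlepath m \<rho>) (\<lambda>u. 1 / (u - z))) (circlepath m \<rho>)"
    proof (rule has_contour_integral_eq)
      fix u assume "u \<in> path_image (circlepath m \<rho>)"
      then have "u \<noteq> z" using ne pi by blast
      then show "\<phi> u + f z * (1 / (u - z)) = f u / (u - z)" by (simp add: \<phi>_def diff_divide_distrib)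
    qed
    then show ?thesis by (rule contour_integral_unique)
  qed
  have "((\<lambda>u. 1 / (u - z)) has_contour_integral 2 * of_real pi * \<i> * 1) (circlepath m \<rho>2)"
    by (rule Cauchy_integral_circlepath_simple[of "\<lambda>_. 1"])
      (use z in \<open>auto simp: dist_norm norm_minus_commute\<close>)
  then have 2: "contour_integral (circlepath m \<rho>2) (\<lambda>u. 1 / (u - z)) = 2 * pi * \<i>"
    by (simp add: contour_integral_unique)
  have "((\<lambda>u. 1 / (u - z)) has_contour_integral 0) (circlepath m \<rho>1)"
  proof (rule Cauchy_theorem_convex_simple[of _ "ball m (norm (z - m))"])
    show "(\<lambda>u. 1 / (u - z)) holomorphic_on ball m (norm (z - m))"
      by (intro holomorphic_intros) (auto simp: dist_norm norm_minus_commute)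
    show "path_image (circlepath m \<rho>1) \<subseteq> ball m (norm (z - m))" using pos z by auto
  qed auto
  then have 1: "contour_integral (circlepath m \<rho>1) (\<lambda>u. 1 / (u - z)) = 0"
    by (rule contour_integral_unique)
  show ?thesis using split[of \<rho>1] split[of \<rho>2] eq by (simp add: 1 2)
qed

text \<open>The Cauchy integrals are taken over circles strictly inside the annulus and continued to
  all of it by their relation with f. This gives bounds up to the boundary, because at each point of
  the annulus the circle that is farther away can be used.\<close>

lemma Laurent_splitting:
  fixes f :: "complex \<Rightarrow> complex"
  assumes hol: "f holomorphic_on {z. r < norm (z - m) \<and> norm (z - m) < R}"
    and r: "0 \<le> r" "r < R"
    and B: "\<And>z. r < norm (z - m) \<Longrightarrow> norm (z - m) < R \<Longrightarrow> norm (f z) \<le> B"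
  shows "\<exists>p q. p holomorphic_on {z. r < norm (z - m)} \<and> q holomorphic_on ball m R \<and>
    (\<exists>C. \<forall>z. r < norm (z - m) \<longrightarrow> norm (p z) \<le> C / (1 + norm z)) \<and>
    (\<exists>C. \<forall>z\<in>ball m R. norm (q z) \<le> C) \<and>
    (\<forall>z. r < norm (z - m) \<longrightarrow> norm (z - m) < R \<longrightarrow> f z = p z - q z)"
proof -
  \<comment> \<open>Each integration circle has distance d both from the middle circle of radius
    \<rho> and from the nearest boundary circle.\<close>
  define \<rho>1 \<rho>2 \<rho> where "\<rho>1 = r + (R - r) / 4" and "\<rho>2 = r + 3 * (R - r) / 4" and "\<rho> = (r + R) / 2"
  define d where "d = (R - r) / 4"
  have \<rho>: "0 < \<rho>1" "r < \<rho>1" "\<rho>1 = \<rho> - d" "\<rho>2 = \<rho> + d" "\<rho>2 < R" "d > 0"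
    using r by (auto simp: \<rho>1_def \<rho>2_def \<rho>_def d_def field_simps)
  define T where "T s z = - contour_integral (circlepath m s) (\<lambda>u. f u / (u - z)) / (2 * pi * \<i>)" for s z
  have cont: "continuous_on (sphere m s) f" if "s = \<rho>1 \<or> s = \<rho>2" for s
    by (rule continuous_on_subset[OF holomorphic_on_imp_continuous_on[OF hol]])
      (use that \<rho> in \<open>auto simp: dist_norm norm_minus_commute\<close>)
  have Bs: "norm (f u) \<le> B" if "u \<in> sphere m s" "s = \<rho>1 \<or> s = \<rho>2" for s u
    using that \<rho> by (intro B) (auto simp: dist_norm norm_minus_commute)
  have B0: "B \<ge> 0"
  proof -
    have "m + of_real \<rho>1 \<in> sphere m \<rho>1" using \<rho>(1) by (simp add: dist_norm)
    then show ?thesis using Bs[of "m + of_real \<rho>1" \<rho>1] norm_ge_zero order_trans by blast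
  qed
  have T_hol: "T s holomorphic_on - sphere m s" if "s = \<rho>1 \<or> s = \<rho>2" for s
    unfolding T_def using that \<rho>
    by (intro holomorphic_intros Cauchy_transform_holomorphic cont) auto
  have T_bound: "norm (T s z) \<le> B / e * s"
    if s: "s = \<rho>1 \<or> s = \<rho>2" and e: "e > 0" "\<And>u. u \<in> sphere m s \<Longrightarrow> e \<le> norm (u - z)" for s z e
  proof -
    have "norm (contour_integral (circlepath m s) (\<lambda>u. f u / (u - z))) \<le> B / e * (2 * pi * s)"
      by (rule Cauchy_transform_bound[OF cont[OF s] _ e(1) Bs[OF _ s] e(2)]) (use s \<rho> in auto)
    then show ?thesis unfolding T_def by (simp add: norm_divide norm_mult field_simps)
  qed
  have cauchy: "f z = T \<rho>1 z - T \<rho>2 z" if "\<rho>1 < norm (z - m)" "norm (z - m) < \<rho>2" for z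
  proof -
    have "\<rho>1 < \<rho>2" using \<rho> by auto
    from Cauchy_formula_annulus[OF hol r(1) \<rho>(2) this \<rho>(5) that] show ?thesis
      unfolding T_def by (simp add: field_simps)
  qed
  define p where "p z = (if \<rho>1 < norm (z - m) then T \<rho>1 z else f z + T \<rho>2 z)" for z
  define q where "q z = (if norm (z - m) < \<rho>2 then T \<rho>2 z else T \<rho>1 z - f z)" for z
  have p_eq: "p z = f z + T \<rho>2 z" if "norm (z - m) < \<rho>2" for z using that cauchy[of z] by (auto simp: p_def)
  have q_eq: "q z = T \<rho>1 z - f z" if "\<rho>1 < norm (z - m)" for z using that cauchy[of z] by (auto simp: q_def)
  have opn: "open {z. s < norm (z - m)}" "open {z. s < norm (z - m) \<and> norm (z - m) < t}" "open {z. norm (z - m) < t}" for s t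
    by (intro open_Collect_conj open_Collect_less continuous_intros)+
  have p_hol: "p holomorphic_on {z. r < norm (z - m)}"
  proof -
    have "p holomorphic_on {z. \<rho>1 < norm (z - m)} \<union> {z. r < norm (z - m) \<and> norm (z - m) < \<rho>2}"
    proof (rule holomorphic_on_Un[OF _ _ opn(1) opn(2)])
      show "p holomorphic_on {z. \<rho>1 < norm (z - m)}"
        by (rule holomorphic_transform[OF holomorphic_on_subset[OF T_hol[of \<rho>1]]])
          (auto simp: p_def dist_norm norm_minus_commute)
      have "(\<lambda>z. f z + T \<rho>2 z) holomorphic_on {z. r < norm (z - m) \<and> norm (z - m) < \<rho>2}"
        by (intro holomorphic_on_add holomorphic_on_subset[OF hol] holomorphic_on_subset[OF T_hol[of \<rho>2]])
          (use \<rho> in \<open>auto simp: dist_norm norm_minus_commute\<close>)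
      then show "p holomorphic_on {z. r < norm (z - m) \<and> norm (z - m) < \<rho>2}"
        by (rule holomorphic_transform) (simp add: p_eq)
    qed
    then show ?thesis by (rule holomorphic_on_subset) (use \<rho> in auto)
  qed
  have q_hol: "q holomorphic_on ball m R"
  proof -
    have "q holomorphic_on {z. norm (z - m) < \<rho>2} \<union> {z. \<rho>1 < norm (z - m) \<and> norm (z - m) < R}"
    proof (rule holomorphic_on_Un[OF _ _ opn(3) opn(2)])
      show "q holomorphic_on {z. norm (z - m) < \<rho>2}"
        by (rule holomorphic_transform[OF holomorphic_on_subset[OF T_hol[of \<rho>2]]])
          (auto simp: q_def dist_norm norm_minus_commute)
      have "(\<lambda>z. T \<rho>1 z - f z) holomorphic_on {z. \<rho>1 < norm (z - m) \<and> norm (z - m) < R}"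
        by (intro holomorphic_on_diff holomorphic_on_subset[OF hol] holomorphic_on_subset[OF T_hol[of \<rho>1]])
          (use \<rho> in \<open>auto simp: dist_norm norm_minus_commute\<close>)
      then show "q holomorphic_on {z. \<rho>1 < norm (z - m) \<and> norm (z - m) < R}"
        by (rule holomorphic_transform) (simp add: q_eq)
    qed
    then show ?thesis
      by (rule holomorphic_on_subset) (use \<rho> in \<open>auto simp: dist_norm norm_minus_commute\<close>)
  qed
  have far: "norm (z - m) - s \<le> norm (u - z)" "s - norm (z - m) \<le> norm (u - z)" if "u \<in> sphere m s" for u s z
    using that norm_triangle_ineq4[of "u - m" "u - z"] norm_triangle_ineq4[of "u - m" "z - m"] norm_triangle_ineq[of "u - z" "z - m"]
    by (auto simp: dist_norm norm_minus_commute)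
  have T1: "norm (T \<rho>1 z) \<le> B / (norm (z - m) - \<rho>1) * \<rho>1" if "\<rho>1 < norm (z - m)" for z
    by (rule T_bound) (use that far in auto)
  have T2: "norm (T \<rho>2 z) \<le> B / (\<rho>2 - norm (z - m)) * \<rho>2" if "norm (z - m) < \<rho>2" for z
    by (rule T_bound) (use that far in auto)
  define c where "c = B + B / d * \<rho>1 + B / d * \<rho>2"
  have c: "B \<le> c" "B / d * \<rho>1 \<le> c" "B + B / d * \<rho>2 \<le> c" "B / d * \<rho>2 \<le> c" "B / d * \<rho>1 + B \<le> c"
    using B0 \<rho> by (auto simp: c_def)
  have p_b: "norm (p z) \<le> c" if z: "r < norm (z - m)" for z
  proof (cases "\<rho> \<le> norm (z - m)")
    case True
    have "B / (norm (z - m) - \<rho>1) * \<rho>1 \<le> B / d * \<rho>1"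
      using True \<rho> B0 by (intro mult_right_mono divide_left_mono mult_pos_pos) auto
    then show ?thesis using T1[of z] True \<rho> c by (simp add: p_def)
  next
    case False
    have "B / (\<rho>2 - norm (z - m)) * \<rho>2 \<le> B / d * \<rho>2"
      using False \<rho> B0 by (intro mult_right_mono divide_left_mono mult_pos_pos) auto
    then have "norm (T \<rho>2 z) \<le> B / d * \<rho>2" using T2[of z] False \<rho> by auto
    moreover have "norm (f z) \<le> B" using B[of z] z False \<rho> by auto
    ultimately show ?thesis using p_eq[of z] False \<rho> c norm_triangle_ineq[of "f z" "T \<rho>2 z"] by auto
  qed
  have q_b: "norm (q z) \<le> c" if z: "norm (z - m) < R" for z
  proof (cases "\<rho> \<le> norm (z - m)")
    case True
    have "B / (norm (z - m) - \<rho>1) * \<rho>1 \<le> B / d * \<rho>1"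
      using True \<rho> B0 by (intro mult_right_mono divide_left_mono mult_pos_pos) auto
    then have "norm (T \<rho>1 z) \<le> B / d * \<rho>1" using T1[of z] True \<rho> by auto
    moreover have "norm (f z) \<le> B" using B[of z] z True \<rho> by auto
    ultimately show ?thesis using q_eq[of z] True \<rho> c norm_triangle_ineq4[of "T \<rho>1 z" "f z"] by auto
  next
    case False
    have "B / (\<rho>2 - norm (z - m)) * \<rho>2 \<le> B / d * \<rho>2"
      using False \<rho> B0 by (intro mult_right_mono divide_left_mono mult_pos_pos) auto
    then show ?thesis using T2[of z] False \<rho> c by (auto simp: q_def)
  qed
  \<comment> \<open>Beyond |z| = S the distance |z - m| - \<rho>1 is at least (1 + |z|) / 4, so the
    Cauchy estimate yields decay; up to S boundedness suffices.\<close>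
  define S where "S = 2 * (norm m + \<rho>1 + 1)"
  have p_d: "norm (p z) \<le> (c * (1 + S) + 4 * B * \<rho>1) / (1 + norm z)" if z: "r < norm (z - m)" for z
  proof (cases "norm z \<le> S")
    case True
    have "norm (p z) * (1 + norm z) \<le> c * (1 + S)"
      using p_b[OF z] True c(1) B0 by (intro mult_mono) auto
    also have "\<dots> \<le> c * (1 + S) + 4 * B * \<rho>1" using B0 \<rho> by simp
    finally show ?thesis by (subst pos_le_divide_eq) (auto intro: add_pos_nonneg)
  next
    case False
    have "norm z \<le> norm (z - m) + norm m" using norm_triangle_ineq[of "z - m" m] by simp
    moreover have "norm z > 2 * norm m + 2 * \<rho>1 + 2" using False by (simp add: S_def)
    ultimately have "1 + norm z \<le> 4 * (norm (z - m) - \<rho>1)"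
      using \<rho>(1) norm_ge_zero[of m] by argo
    then have le: "(1 + norm z) / 4 \<le> norm (z - m) - \<rho>1" by simp
    moreover have "0 < (1 + norm z) / 4" by (simp add: add_pos_nonneg)
    ultimately have lt: "\<rho>1 < norm (z - m)" by linarith
    have "norm (p z) \<le> B / (norm (z - m) - \<rho>1) * \<rho>1" using T1[OF lt] lt by (simp add: p_def)
    also have "\<dots> \<le> B / ((1 + norm z) / 4) * \<rho>1"
      using le lt \<rho> B0 by (intro mult_right_mono divide_left_mono mult_pos_pos) (auto intro: add_pos_nonneg)
    also have "\<dots> = (4 * B * \<rho>1) / (1 + norm z)" by simp
    also have "\<dots> \<le> (c * (1 + S) + 4 * B * \<rho>1) / (1 + norm z)"
      using c(1) B0 \<rho> by (intro divide_right_mono) (auto simp: S_def)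
    finally show ?thesis .
  qed
  have pq: "f z = p z - q z" if "r < norm (z - m)" "norm (z - m) < R" for z
    using cauchy[of z] \<rho> by (auto simp: p_def q_def)
  have "\<exists>C. \<forall>z. r < norm (z - m) \<longrightarrow> norm (p z) \<le> C / (1 + norm z)" using p_d by blast
  moreover have "\<exists>C. \<forall>z\<in>ball m R. norm (q z) \<le> C"
    by (intro exI[of _ c] ballI q_b) (simp add: dist_norm norm_minus_commute)
  moreover have "\<forall>z. r < norm (z - m) \<longrightarrow> norm (z - m) < R \<longrightarrow> f z = p z - q z"
    by (intro allI impI pq)
  ultimately show ?thesis
    using p_hol q_hol by - (rule exI[of _ p], rule exI[of _ q], intro conjI)
qed

text \<open>Subsequences are extracted successively, one for each domain; convergence on the earlier
  domains persists.\<close>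

lemma Montel_finite_family:
  fixes f :: "'i \<Rightarrow> nat \<Rightarrow> complex \<Rightarrow> complex"
  assumes "finite I" "\<And>i. i \<in> I \<Longrightarrow> open (S i)"
    and hol: "\<And>i n. i \<in> I \<Longrightarrow> f i n holomorphic_on S i"
    and bd: "\<And>i n z. i \<in> I \<Longrightarrow> z \<in> S i \<Longrightarrow> norm (f i n z) \<le> B"
  shows "\<exists>(r :: nat \<Rightarrow> nat) h. strict_mono r \<and> (\<forall>i\<in>I. h i holomorphic_on S i \<and>
     (\<forall>C. compact C \<longrightarrow> C \<subseteq> S i \<longrightarrow> uniform_limit C (\<lambda>n. f i (r n)) (h i) sequentially))"
  using assms
proof (induction I)
  case empty
  show ?case by (intro exI[of _ id]) (simp add: strict_mono_def)
next
  case (insert k I)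
  have "\<exists>(r :: nat \<Rightarrow> nat) h. strict_mono r \<and> (\<forall>i\<in>I. h i holomorphic_on S i \<and>
     (\<forall>C. compact C \<longrightarrow> C \<subseteq> S i \<longrightarrow> uniform_limit C (\<lambda>n. f i (r n)) (h i) sequentially))"
    by (rule insert.IH) (use insert.prems in auto)
  then obtain r h where r: "strict_mono (r :: nat \<Rightarrow> nat)" and
    h: "\<forall>i\<in>I. h i holomorphic_on S i \<and>
       (\<forall>C. compact C \<longrightarrow> C \<subseteq> S i \<longrightarrow> uniform_limit C (\<lambda>n. f i (r n)) (h i) sequentially)"
    by (elim exE conjE) (rule that)
  obtain u s where us: "u holomorphic_on S k" "strict_mono (s :: nat \<Rightarrow> nat)"
    "\<And>C. compact C \<Longrightarrow> C \<subseteq> S k \<Longrightarrow> uniform_limit C ((\<lambda>n. f k (r n)) \<circ> s) u sequentially"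
  proof (rule Montel[of "S k" "range (\<lambda>n. f k (r n))" "\<lambda>n. f k (r n)"])
    show "open (S k)" using insert.prems by simp
    show "h holomorphic_on S k" if "h \<in> range (\<lambda>n. f k (r n))" for h using that insert.prems by auto
    show "\<exists>B. \<forall>h\<in>range (\<lambda>n. f k (r n)). \<forall>z\<in>C. norm (h z) \<le> B" if "compact C" "C \<subseteq> S k" for C
      using that insert.prems(3) by (intro exI[of _ B]) auto
  qed auto
  show ?case
  proof (intro exI conjI ballI allI impI)
    show "strict_mono (r \<circ> s)" using r us(2) by (rule strict_mono_o)
    fix i assume i: "i \<in> insert k I"
    show "(if i = k then u else h i) holomorphic_on S i" using i us(1) h by auto
    fix C assume C: "compact C" "C \<subseteq> S i"
    show "uniform_limit C (\<lambda>n. f i ((r \<circ> s) n)) (if i = k then u else h i) sequentially"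
    proof (cases "i = k")
      case True then show ?thesis using us(3)[of C] C by (simp add: o_def)
    next
      case False
      then have "uniform_limit C (\<lambda>n. f i (r n)) (h i) sequentially" using h i C by auto
      from filterlim_compose[OF this filterlim_subseq[OF us(2)]]
      show ?thesis using False by (simp add: o_def)
    qed
  qed
qed

lemma uniform_limit_matrix:
  fixes F :: "nat \<Rightarrow> 'a \<Rightarrow> complex^'n^'m"
  assumes "\<And>i j. uniform_limit C (\<lambda>n z. F n z $ i $ j) (\<lambda>z. L z $ i $ j) sequentially"
  shows "uniform_limit C F L sequentially"
proof (rule uniform_limitI)
  fix e :: real assume e: "e > 0"
  define c where "c = real CARD('m) * real CARD('n)"
  have c: "c > 0" by (simp add: c_def)
  have "\<forall>\<^sub>F n in sequentially. \<forall>i j. \<forall>z\<in>C. dist (F n z $ i $ j) (L z $ i $ j) < e / (2 * c)"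
    by (intro eventually_all_finite uniform_limitD assms) (use e c in auto)
  then show "\<forall>\<^sub>F n in sequentially. \<forall>z\<in>C. dist (F n z) (L z) < e"
  proof eventually_elim
    case (elim n)
    show ?case
    proof
      fix z assume "z \<in> C"
      then have "norm ((F n z - L z) $ i $ j) \<le> e / (2 * c)" for i j
        using elim by (auto simp: dist_norm intro: less_imp_le)
      from norm_matrix_le[OF this] have "norm (F n z - L z) \<le> e / 2" using c by (simp add: c_def)
      then show "dist (F n z) (L z) < e" using e by (simp add: dist_norm)
    qed
  qed
qed

lemma Montel_matrix_family:
  fixes F :: "'i \<Rightarrow> nat \<Rightarrow> complex \<Rightarrow> complex^'n^'m"
  assumes "finite I" "\<And>i. i \<in> I \<Longrightarrow> open (S i)"
    and hol: "\<And>i n. i \<in> I \<Longrightarrow> matrix_holomorphic_on (F i n) (S i)"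
    and bd: "\<And>i n z. i \<in> I \<Longrightarrow> z \<in> S i \<Longrightarrow> norm (F i n z) \<le> B"
  shows "\<exists>(r :: nat \<Rightarrow> nat) L. strict_mono r \<and> (\<forall>i\<in>I. matrix_holomorphic_on (L i) (S i) \<and>
     (\<forall>C. compact C \<longrightarrow> C \<subseteq> S i \<longrightarrow> uniform_limit C (\<lambda>n. F i (r n)) (L i) sequentially))"
proof -
  let ?I = "I \<times> (UNIV :: ('m \<times> 'n) set)"
  obtain r h where r: "strict_mono (r :: nat \<Rightarrow> nat)" and
    h: "\<And>k. k \<in> ?I \<Longrightarrow> h k holomorphic_on S (fst k)"
       "\<And>k C. k \<in> ?I \<Longrightarrow> compact C \<Longrightarrow> C \<subseteq> S (fst k) \<Longrightarrow>
           uniform_limit C (\<lambda>n z. F (fst k) (r n) z $ fst (snd k) $ snd (snd k)) (h k) sequentially"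
  proof -
    have "\<exists>(r :: nat \<Rightarrow> nat) h. strict_mono r \<and> (\<forall>k\<in>?I. h k holomorphic_on S (fst k) \<and>
     (\<forall>C. compact C \<longrightarrow> C \<subseteq> S (fst k) \<longrightarrow> uniform_limit C (\<lambda>n z. F (fst k) (r n) z $ fst (snd k) $ snd (snd k)) (h k) sequentially))"
    proof (rule Montel_finite_family[where f="\<lambda>k n z. F (fst k) n z $ fst (snd k) $ snd (snd k)"])
      show "norm (F (fst k) n z $ fst (snd k) $ snd (snd k)) \<le> B" if "k \<in> ?I" "z \<in> S (fst k)" for k n z
        using bd[of "fst k" z n] that norm_entry_le[of "F (fst k) n z" "fst (snd k)" "snd (snd k)"] by auto
    qed (use assms in \<open>auto simp: matrix_holomorphic_on_def\<close>)
    then show thesis using that by blast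
  qed
  define L where "L i z = (\<chi> p q. h (i, p, q) z)" for i z
  have "matrix_holomorphic_on (L i) (S i)" if "i \<in> I" for i
    using h(1) that by (force simp: matrix_holomorphic_on_def L_def)
  moreover have "uniform_limit C (\<lambda>n. F i (r n)) (L i) sequentially" if "i \<in> I" "compact C" "C \<subseteq> S i" for i C
  proof (rule uniform_limit_matrix)
    fix p q
    show "uniform_limit C (\<lambda>n z. F i (r n) z $ p $ q) (\<lambda>z. L i z $ p $ q) sequentially"
      using h(2)[of "(i, p, q)" C] that by (simp add: L_def)
  qed
  ultimately show ?thesis using r by (intro exI[of _ r] exI[of _ L]) auto
qed

section \<open>The transmission problem on the annuli\<close>

lemma sums_geometric_half: "(\<lambda>n. c / 2 ^ n :: real) sums (2 * c)"
proof -
  have "(\<lambda>n. (1 / 2) ^ n) sums (1 / (1 - 1 / 2 :: real))" by (rule geometric_sums) simp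
  then have "(\<lambda>n. c * (1 / 2) ^ n) sums (c * (1 / (1 - 1 / 2)))" by (rule sums_mult)
  moreover have "c * (1 / 2) ^ n = c / 2 ^ n" for n by (simp add: power_divide)
  ultimately show ?thesis by (simp add: mult.commute)
qed

lemmas summable_geometric_half = sums_summable[OF sums_geometric_half]
lemmas suminf_geometric_half = sums_unique[OF sums_geometric_half, symmetric]

lemma bounded_linear_entry: "bounded_linear (\<lambda>A :: complex^'n^'m. A $ i $ j)"
  by (rule bounded_linear_compose[OF bounded_linear_vec_nth bounded_linear_vec_nth])

lemma matrix_holomorphic_on_suminf:
  fixes f :: "nat \<Rightarrow> complex \<Rightarrow> complex^'n^'m"
  assumes hol: "\<And>n. matrix_holomorphic_on (f n) S" and S: "open S"
    and le: "\<And>n z. z \<in> S \<Longrightarrow> norm (f n z) \<le> B n" and B: "summable B"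
  shows "matrix_holomorphic_on (\<lambda>z. \<Sum>n. f n z) S"
  unfolding matrix_holomorphic_on_def
proof (intro allI)
  fix i j
  have h: "(\<lambda>z. \<Sum>n. f n z $ i $ j) holomorphic_on S"
  proof (rule holomorphic_uniform_sequence[OF S, of "\<lambda>n z. \<Sum>k<n. f k z $ i $ j"])
    show "(\<lambda>z. \<Sum>k<n. f k z $ i $ j) holomorphic_on S" for n
      using hol by (intro holomorphic_on_sum) (simp add: matrix_holomorphic_on_def)
    fix x assume "x \<in> S"
    then obtain d where d: "d > 0" "cball x d \<subseteq> S" using S open_contains_cball by blast
    have "uniform_limit (cball x d) (\<lambda>n z. \<Sum>k<n. f k z $ i $ j) (\<lambda>z. \<Sum>n. f n z $ i $ j) sequentially"
    proof (rule Weierstrass_m_test[OF _ B])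
      fix n z assume "z \<in> cball x d"
      then show "norm (f n z $ i $ j) \<le> B n" using le[of z n] d norm_entry_le[of "f n z" i j] by auto
    qed
    then show "\<exists>d>0. cball x d \<subseteq> S \<and> uniform_limit (cball x d) (\<lambda>n z. \<Sum>k<n. f k z $ i $ j) (\<lambda>z. \<Sum>n. f n z $ i $ j) sequentially"
      using d by blast
  qed
  have eq: "(\<Sum>n. f n z) $ i $ j = (\<Sum>n. f n z $ i $ j)" if "z \<in> S" for z
    by (rule bounded_linear.suminf[OF bounded_linear_entry])
      (rule summable_comparison_test'[OF B], use le that in auto)
  from h show "(\<lambda>z. (\<Sum>n. f n z) $ i $ j) holomorphic_on S"
    by (rule holomorphic_transform) (simp add: eq)
qed

text \<open>By continuity. It serves the real points of Q and of the discs, which include points of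
  the band, where nothing is known about the glued function.\<close>

lemma matrix_holomorphic_zero_off_real:
  assumes hol: "matrix_holomorphic_on f S" and S: "open S" and z: "z \<in> S"
    and 0: "\<And>z. z \<in> S \<Longrightarrow> Im z \<noteq> 0 \<Longrightarrow> f z = 0"
  shows "f z = 0"
proof (cases "Im z = 0")
  case True
  then have zx: "z = of_real (Re z)" by (simp add: complex_eq_iff)
  have "(f \<longlongrightarrow> f z) (at z within {z. Im z > 0})" by (rule matrix_holomorphic_on_tendsto[OF hol S z])
  moreover have "\<forall>\<^sub>F w in at z within {z. Im z > 0}. f w = 0"
    unfolding eventually_at_filter using eventually_nhds_in_open[OF S z]
    by (rule eventually_mono) (auto intro: 0)
  then have "(f \<longlongrightarrow> 0) (at z within {z. Im z > 0})" by (rule tendsto_eventually)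
  moreover have "at z within {z. Im z > 0} \<noteq> bot" using at_upper_half_plane_neq_bot zx by metis
  ultimately show ?thesis using tendsto_unique by blast
qed (use 0 z in blast)

lemma matrix_Laurent_splitting:
  fixes f :: "complex \<Rightarrow> complex^'n^'m"
  assumes hol: "matrix_holomorphic_on f {z. r < norm (z - m) \<and> norm (z - m) < R}"
    and r: "0 \<le> r" "r < R"
    and B: "\<And>z. r < norm (z - m) \<Longrightarrow> norm (z - m) < R \<Longrightarrow> norm (f z) \<le> B"
  shows "\<exists>p q C. matrix_holomorphic_on p {z. r < norm (z - m)} \<and> matrix_holomorphic_on q (ball m R) \<and>
    (\<forall>z. r < norm (z - m) \<longrightarrow> norm (p z) * (1 + norm z) \<le> C) \<and> (\<forall>z\<in>ball m R. norm (q z) \<le> C) \<and>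
    (\<forall>z. r < norm (z - m) \<longrightarrow> norm (z - m) < R \<longrightarrow> f z = p z - q z)"
proof -
  have "\<exists>p q C. p holomorphic_on {z. r < norm (z - m)} \<and> q holomorphic_on ball m R \<and>
    (\<forall>z. r < norm (z - m) \<longrightarrow> norm (p z) \<le> C / (1 + norm z)) \<and> (\<forall>z\<in>ball m R. norm (q z) \<le> C) \<and>
    (\<forall>z. r < norm (z - m) \<longrightarrow> norm (z - m) < R \<longrightarrow> f z $ i $ j = p z - q z)" for i j
  proof -
    have h: "(\<lambda>z. f z $ i $ j) holomorphic_on {z. r < norm (z - m) \<and> norm (z - m) < R}"
      using hol by (simp add: matrix_holomorphic_on_def)
    have b: "norm (f z $ i $ j) \<le> B" if "r < norm (z - m)" "norm (z - m) < R" for z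
      using B[OF that] norm_entry_le[of "f z" i j] by linarith
    obtain p q C C' where pq: "p holomorphic_on {z. r < norm (z - m)}" "q holomorphic_on ball m R"
      "\<And>z. r < norm (z - m) \<Longrightarrow> norm (p z) \<le> C / (1 + norm z)" "\<And>z. z \<in> ball m R \<Longrightarrow> norm (q z) \<le> C'"
      "\<And>z. r < norm (z - m) \<Longrightarrow> norm (z - m) < R \<Longrightarrow> f z $ i $ j = p z - q z"
      using Laurent_splitting[OF h r b] by blast
    have "norm (p z) \<le> max C C' / (1 + norm z)" if "r < norm (z - m)" for z
      using pq(3)[OF that] divide_right_mono[of C "max C C'" "1 + norm z"] norm_ge_zero[of z] by auto
    moreover have "norm (q z) \<le> max C C'" if "z \<in> ball m R" for z
      using pq(4)[OF that] by simp
    ultimately show ?thesis using pq(1,2,5) by blast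
  qed
  then obtain p q C where pq: "\<And>i j. p i j holomorphic_on {z. r < norm (z - m)}" "\<And>i j. q i j holomorphic_on ball m R"
      "\<And>i j z. r < norm (z - m) \<Longrightarrow> norm (p i j z) \<le> C i j / (1 + norm z)"
      "\<And>i j z. z \<in> ball m R \<Longrightarrow> norm (q i j z) \<le> C i j"
      "\<And>i j z. r < norm (z - m) \<Longrightarrow> norm (z - m) < R \<Longrightarrow> f z $ i $ j = p i j z - q i j z"
    by metis
  define P where "P z = (\<chi> i j. p i j z)" for z
  define Q where "Q z = (\<chi> i j. q i j z)" for z
  define c where "c = (\<Sum>i\<in>UNIV. \<Sum>j\<in>UNIV. \<bar>C i j\<bar>)"
  have F1: "norm (P z) * (1 + norm z) \<le> c" if "r < norm (z - m)" for z
  proof -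
    have pos: "1 + norm z > 0" by (simp add: add_pos_nonneg)
    have "norm (P z) \<le> (\<Sum>i\<in>UNIV. \<Sum>j\<in>UNIV. norm (P z $ i $ j))" by (rule norm_matrix_le_sum)
    also have "\<dots> \<le> (\<Sum>i\<in>UNIV. \<Sum>j\<in>UNIV. \<bar>C i j\<bar> / (1 + norm z))"
    proof (intro sum_mono)
      fix i j
      have "norm (P z $ i $ j) \<le> C i j / (1 + norm z)" using pq(3)[OF that] by (simp add: P_def)
      also have "\<dots> \<le> \<bar>C i j\<bar> / (1 + norm z)" using pos by (intro divide_right_mono) auto
      finally show "norm (P z $ i $ j) \<le> \<bar>C i j\<bar> / (1 + norm z)" .
    qed
    also have "\<dots> = c / (1 + norm z)" by (simp add: c_def sum_divide_distrib)
    finally show ?thesis using pos by (simp add: pos_le_divide_eq)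
  qed
  have F2: "norm (Q z) \<le> c" if "z \<in> ball m R" for z
  proof -
    have "norm (Q z) \<le> (\<Sum>i\<in>UNIV. \<Sum>j\<in>UNIV. norm (Q z $ i $ j))" by (rule norm_matrix_le_sum)
    also have "\<dots> \<le> c" unfolding c_def
    proof (intro sum_mono)
      fix i j
      have "norm (q i j z) \<le> C i j" by (rule pq(4)[OF that])
      then show "norm (Q z $ i $ j) \<le> \<bar>C i j\<bar>" by (simp add: Q_def)
    qed
    finally show ?thesis .
  qed
  have F3: "matrix_holomorphic_on P {z. r < norm (z - m)}" "matrix_holomorphic_on Q (ball m R)"
    using pq(1,2) by (simp_all add: matrix_holomorphic_on_def P_def Q_def)
  have F4: "f z = P z - Q z" if "r < norm (z - m)" "norm (z - m) < R" for z
    using pq(5)[OF that] by (simp add: vec_eq_iff P_def Q_def)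
  show ?thesis
    by (rule exI[of _ P], rule exI[of _ Q], rule exI[of _ c]) (intro conjI allI impI ballI F1 F2 F3 F4; assumption)
qed

context bands
begin

text \<open>A pair \<open>(X, Y)\<close> is sought with \<open>X - Y\<^sub>j G(K\<^sub>j, \<tau>) = u\<^sub>j\<close> on the annuli; the original problem is the
  case \<open>u\<^sub>j = -1\<close>. The weight \<open>1 + |z|\<close> encodes the decay of \<open>X\<close> at infinity.\<close>

definition adm :: "(complex \<Rightarrow> complex^('r::finite + 'r)^('r + 'r)) \<Rightarrow> (nat \<Rightarrow> complex \<Rightarrow> complex^('r + 'r)^('r + 'r)) \<Rightarrow> real \<Rightarrow> bool" where
  "adm X Y B \<longleftrightarrow> matrix_holomorphic_on X Q \<and> (\<forall>j\<in>{1..g}. matrix_holomorphic_on (Y j) (P j)) \<and>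
     (\<forall>z\<in>Q. norm (X z) * (1 + norm z) \<le> B) \<and> (\<forall>j\<in>{1..g}. \<forall>z\<in>P j. norm (Y j z) \<le> B)"

definition res :: "(nat \<Rightarrow> complex^'r^'r) \<Rightarrow> (complex \<Rightarrow> complex^('r::finite + 'r)^('r + 'r)) \<Rightarrow>
    (nat \<Rightarrow> complex \<Rightarrow> complex^('r + 'r)^('r + 'r)) \<Rightarrow> nat \<Rightarrow> complex \<Rightarrow> complex^('r + 'r)^('r + 'r)" where
  "res K X Y j z = X z - Y j z ** G (K j) (\<tau> z)"

text \<open>The bound \<open>C\<close> of the solution is left free here;
  \<open>uniform_apriori\<close> later makes it linear in the size of the data.\<close>

definition solvable :: "(nat \<Rightarrow> complex^'r::finite^'r) \<Rightarrow> bool" where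
  "solvable K \<longleftrightarrow> (\<forall>u B. (\<forall>j\<in>{1..g}. matrix_holomorphic_on (u j) (Ann j)) \<longrightarrow>
     (\<forall>j\<in>{1..g}. \<forall>z\<in>Ann j. norm (u j z) \<le> B) \<longrightarrow>
     (\<exists>X Y C. adm X Y C \<and> (\<forall>j\<in>{1..g}. \<forall>z\<in>Ann j. res K X Y j z = u j z)))"

lemma adm_tendsto_0: assumes "adm X Y B" shows "(X \<longlongrightarrow> 0) at_infinity"
proof -
  define \<rho> where "\<rho> = (\<Sum>j\<in>{1..g}. \<bar>mid j\<bar> + \<bar>rad 1 j\<bar>)"
  have "z \<in> Q" if "norm z \<ge> \<rho> + 1" for z
    unfolding Q_def
  proof (intro CollectI ballI)
    fix j assume "j \<in> {1..g}"
    then have "\<bar>mid j\<bar> + \<bar>rad 1 j\<bar> \<le> \<rho>" unfolding \<rho>_def by (intro member_le_sum) auto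
    moreover have "norm z \<le> cmod (z - of_real (mid j)) + \<bar>mid j\<bar>"
      using norm_triangle_ineq[of "z - of_real (mid j)" "of_real (mid j)"] by simp
    ultimately show "rad 1 j < cmod (z - of_real (mid j))" using that by linarith
  qed
  then have "norm (X z) \<le> norm (B * inverse (1 + norm z))" if "norm z \<ge> \<rho> + 1" for z
  proof -
    have "norm (X z) * (1 + norm z) \<le> B" using assms that \<open>\<And>z. norm z \<ge> \<rho> + 1 \<Longrightarrow> z \<in> Q\<close> by (auto simp: adm_def)
    moreover have "1 + norm z > 0" by (simp add: add_pos_nonneg)
    ultimately have "norm (X z) \<le> B * inverse (1 + norm z)" by (simp add: field_simps)
    then show ?thesis by simp
  qed
  then have "\<forall>\<^sub>F z in at_infinity. norm (X z) \<le> norm (B * inverse (1 + norm z))"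
    unfolding eventually_at_infinity by blast
  moreover have "((\<lambda>z::complex. norm (B * inverse (1 + norm z))) \<longlongrightarrow> 0) at_infinity"
  proof (rule tendsto_norm_zero)
    have "filterlim (\<lambda>z::complex. 1 + norm z) at_top at_infinity"
      by (intro filterlim_tendsto_add_at_top[OF tendsto_const] filterlim_norm_at_top)
    from tendsto_mult[OF tendsto_const[of B] tendsto_inverse_0_at_top[OF this]]
    show "((\<lambda>z::complex. B * inverse (1 + norm z)) \<longlongrightarrow> 0) at_infinity" by simp
  qed
  ultimately show ?thesis by (rule Lim_null_comparison)
qed

lemma G_\<tau>_holomorphic: "j \<in> {1..g} \<Longrightarrow> matrix_holomorphic_on (\<lambda>z. G K (\<tau> z)) (Ann j)"
proof (rule matrix_holomorphic_on_G)
  assume j: "j \<in> {1..g}"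
  have sub: "Ann j \<subseteq> offcut (j - 1) \<union> offcut j" using cl_Ann_offcut[OF j] Ann_subset_cl[of j] by blast
  show "\<tau> holomorphic_on Ann j" by (rule holomorphic_on_subset[OF \<tau>_cl_Ann(1)[OF j] sub])
  show "\<tau> z \<noteq> 0" if "z \<in> Ann j" for z using \<tau>_cl_Ann(2)[OF j] sub that by blast
qed

lemma \<tau>_nonzero_Ann: "j \<in> {1..g} \<Longrightarrow> z \<in> Ann j \<Longrightarrow> \<tau> z \<noteq> 0"
  using \<tau>_cl_Ann(2)[of j z] cl_Ann_offcut[of j] Ann_subset_cl[of j] by blast

text \<open>Glued together, X and Y solve the homogeneous problem. So they vanish after
  multiplication by M(\<gamma>) and, in the discs, by the gauge, both of which are
  invertible.\<close>

lemma kernel_trivial: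
  fixes K :: "nat \<Rightarrow> complex^'r::finite^'r"
  assumes K: "\<And>j. j \<in> {1..g} \<Longrightarrow> unitary_matrix (K j)" and adm: "adm X Y B"
    and res: "\<And>j z. j \<in> {1..g} \<Longrightarrow> z \<in> Ann j \<Longrightarrow> res K X Y j z = 0"
  shows "z \<in> Q \<Longrightarrow> X z = 0" and "j \<in> {1..g} \<Longrightarrow> z \<in> P j \<Longrightarrow> Y j z = 0"
proof -
  have X_hol: "matrix_holomorphic_on X Q" and Y_hol: "\<And>j. j \<in> {1..g} \<Longrightarrow> matrix_holomorphic_on (Y j) (P j)"
    using adm by (auto simp: adm_def)
  have XY: "X z = Y j z ** G (K j) (\<tau> z)" if "j \<in> {1..g}" "z \<in> Ann j" for j z
    using res[OF that] by (simp add: res_def)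
  note glue = K X_hol adm_tendsto_0[OF adm] Y_hol XY
  have N0: "glue K X Y z = 0" if "z \<in> D" for z
  proof (rule homogeneous_problem_zero[OF glue_holomorphic[OF glue] glue_cut[OF glue] glue_gap[OF glue] _ glue_endpoint[OF glue] that])
    show "(\<lambda>z. norm (glue K X Y z)) \<in> O[at_infinity](\<lambda>z. norm (inverse z))"
      using glue_infinity[OF glue] by simp
  qed
  have inv: "A = 0" if "A ** M (\<gamma> z) = 0" "Im z \<noteq> 0" for A :: "complex^('r + 'r)^('r + 'r)" and z
  proof -
    have "\<gamma> z \<noteq> 0" using \<gamma>_nonzero_D in_D_if_Im that(2) by blast
    have "A = A ** (M (\<gamma> z) ** M (1 / \<gamma> z))" by (simp add: M_mult_inverse[OF \<open>\<gamma> z \<noteq> 0\<close>] matrix_mul_rid)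
    also have "\<dots> = 0" unfolding matrix_mul_assoc that(1) by (simp add: matrix_matrix_mult_def vec_eq_iff)
    finally show ?thesis .
  qed
  have X0: "X z = 0" if "z \<in> Q" "Im z \<noteq> 0" for z
    using N0[OF in_D_if_Im[OF that(2)]] glue_Q[OF glue that(1) in_D_if_Im[OF that(2)]] inv that(2) by auto
  have Y0: "Y j z = 0" if j: "j \<in> {1..g}" "z \<in> P j" "Im z \<noteq> 0" for j z
  proof (rule inv[OF _ that(3)])
    have U: "K j ** conj_transpose (K j) = mat 1" using K[OF j(1)] by (simp add: unitary_matrix_def)
    have gg: "gauge (K j) z ** gauge (conj_transpose (K j)) z = mat 1"
      by (simp add: gauge_def block_matrix_mult U flip: block_matrix_one)
    have "Y j z ** M (\<gamma> z) ** gauge (K j) z = 0"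
      using N0[OF in_D_if_Im[OF j(3)]] glue_P[OF glue j(1,2)] by simp
    then have "Y j z ** M (\<gamma> z) ** (gauge (K j) z ** gauge (conj_transpose (K j)) z) = 0"
      unfolding matrix_mul_assoc by (simp add: matrix_matrix_mult_def vec_eq_iff)
    then show "Y j z ** M (\<gamma> z) = 0" unfolding gg by (simp add: matrix_mul_rid)
  qed
  show "X z = 0" if "z \<in> Q"
    by (rule matrix_holomorphic_zero_off_real[OF X_hol open_Q that X0])
  show "Y j z = 0" if "j \<in> {1..g}" "z \<in> P j"
    by (rule matrix_holomorphic_zero_off_real[OF Y_hol[OF that(1)] open_P that(2) Y0[OF that(1)]])
qed

text \<open>With G = 1 the problem is additive. Split u_j = p_j - q_j by Laurent; X collects all
  p_i, and Y_j collects q_j and the p_i with i other than j, which are analytic on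
  \<open>P j\<close> because the discs are disjoint.\<close>

lemma solvable_mat_1: "solvable (\<lambda>j. mat 1 :: complex^'r::finite^'r)"
  unfolding solvable_def
proof (intro allI impI)
  fix u :: "nat \<Rightarrow> complex \<Rightarrow> complex^('r + 'r)^('r + 'r)" and B
  assume u: "\<forall>j\<in>{1..g}. matrix_holomorphic_on (u j) (Ann j)" "\<forall>j\<in>{1..g}. \<forall>z\<in>Ann j. norm (u j z) \<le> B"
  define S where "S j p q C \<longleftrightarrow> matrix_holomorphic_on p {z. rad 1 j < cmod (z - complex_of_real (mid j))} \<and> matrix_holomorphic_on q (P j) \<and>
    (\<forall>z. rad 1 j < cmod (z - complex_of_real (mid j)) \<longrightarrow> norm (p z) * (1 + norm z) \<le> C) \<and> (\<forall>z\<in>P j. norm (q z) \<le> C) \<and>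
    (\<forall>z. rad 1 j < cmod (z - complex_of_real (mid j)) \<longrightarrow> cmod (z - complex_of_real (mid j)) < rad 2 j \<longrightarrow> u j z = p z - q z)" for j p q C
  have "\<exists>p q C. S j p q C" if j: "j \<in> {1..g}" for j
    unfolding S_def P_def
    by (rule matrix_Laurent_splitting) (use u j rad_pos[OF j, of 1] rad_mono[of 1 2 j] in \<open>auto simp: Ann_def\<close>)
  then obtain p q C where S: "\<And>j. j \<in> {1..g} \<Longrightarrow> S j (p j) (q j) (C j)" by metis
  have pq:
    "\<And>j. j \<in> {1..g} \<Longrightarrow> matrix_holomorphic_on (p j) {z. rad 1 j < cmod (z - complex_of_real (mid j))}"
    "\<And>j. j \<in> {1..g} \<Longrightarrow> matrix_holomorphic_on (q j) (P j)"
    "\<And>j z. j \<in> {1..g} \<Longrightarrow> rad 1 j < cmod (z - complex_of_real (mid j)) \<Longrightarrow> norm (p j z) * (1 + norm z) \<le> C j"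
    "\<And>j z. j \<in> {1..g} \<Longrightarrow> z \<in> P j \<Longrightarrow> norm (q j z) \<le> C j"
    "\<And>j z. j \<in> {1..g} \<Longrightarrow> z \<in> Ann j \<Longrightarrow> u j z = p j z - q j z"
    using S by (simp_all add: S_def Ann_def)
  define X where "X z = (\<Sum>i\<in>{1..g}. p i z)" for z
  define Y where "Y j z = (\<Sum>i\<in>{1..g} - {j}. p i z) + q j z" for j z
  define c where "c = (\<Sum>i\<in>{1..g}. C i)"
  have outside: "rad 1 i < cmod (z - complex_of_real (mid i))" if "i \<in> {1..g} - {j}" "j \<in> {1..g}" "z \<in> P j" for i j z
    using discs_disjoint[of i j z] that rad_mono[of 1 2 i] by (force simp: in_P)
  have C0: "C j \<ge> 0" if j: "j \<in> {1..g}" for j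
  proof -
    have "of_real (mid j) \<in> P j" using rad_pos[OF j, of 2] by (simp add: in_P)
    from pq(4)[OF j this] show ?thesis using norm_ge_zero order_trans by blast
  qed
  have norm_p: "norm (p j z) \<le> C j" if "j \<in> {1..g}" "rad 1 j < cmod (z - complex_of_real (mid j))" for j z
  proof -
    have "norm (p j z) * 1 \<le> norm (p j z) * (1 + norm z)" by (intro mult_left_mono) auto
    then show ?thesis using pq(3)[OF that] by simp
  qed
  have "adm X Y c"
    unfolding adm_def
  proof (intro conjI ballI)
    show "matrix_holomorphic_on X Q" unfolding X_def
      by (intro matrix_holomorphic_on_sum matrix_holomorphic_on_subset[OF pq(1)]) (auto simp: Q_def)
    show "matrix_holomorphic_on (Y j) (P j)" if "j \<in> {1..g}" for j
      unfolding Y_def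
      by (intro matrix_holomorphic_on_add matrix_holomorphic_on_sum matrix_holomorphic_on_subset[OF pq(1)] pq(2))
        (use that outside in auto)
    show "norm (X z) * (1 + norm z) \<le> c" if "z \<in> Q" for z
    proof -
      have "norm (X z) * (1 + norm z) \<le> (\<Sum>i\<in>{1..g}. norm (p i z)) * (1 + norm z)"
        unfolding X_def by (intro mult_right_mono norm_sum) auto
      also have "\<dots> \<le> c" unfolding c_def sum_distrib_right
        by (intro sum_mono pq(3)) (use that in \<open>auto simp: Q_def\<close>)
      finally show ?thesis .
    qed
    show "norm (Y j z) \<le> c" if j: "j \<in> {1..g}" "z \<in> P j" for j z
    proof -
      have "norm (Y j z) \<le> norm (\<Sum>i\<in>{1..g} - {j}. p i z) + norm (q j z)"
        unfolding Y_def by (rule norm_triangle_ineq)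
      also have "\<dots> \<le> (\<Sum>i\<in>{1..g} - {j}. C i) + C j"
        by (intro add_mono sum_norm_le norm_p pq(4)) (use j outside in auto)
      also have "\<dots> = c" unfolding c_def using j by (subst (2) sum.remove[of _ j]) auto
      finally show ?thesis .
    qed
  qed
  moreover have "res (\<lambda>j. mat 1) X Y j z = u j z" if j: "j \<in> {1..g}" "z \<in> Ann j" for j z
  proof -
    have "X z = p j z + (\<Sum>i\<in>{1..g} - {j}. p i z)"
      unfolding X_def using j by (subst sum.remove[of _ j]) auto
    then show ?thesis using pq(5)[OF j] by (simp add: res_def G_mat_1 matrix_mul_rid Y_def)
  qed
  ultimately show "\<exists>X Y C. adm X Y C \<and> (\<forall>j\<in>{1..g}. \<forall>z\<in>Ann j. res (\<lambda>j. mat 1) X Y j z = u j z)" by blast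
qed

text \<open>The solution for \<open>K'\<close> is the Neumann series in the perturbation \<open>G(K', \<tau>) - G(K, \<tau>)\<close>.\<close>

lemma solvable_step:
  fixes K K' :: "nat \<Rightarrow> complex^'r::finite^'r"
  assumes solv: "solvable K"
    and apriori: "\<And>X Y B e. \<lbrakk>adm X Y B; 0 \<le> e; \<And>j z. j \<in> {1..g} \<Longrightarrow> z \<in> Ann j \<Longrightarrow> norm (res K X Y j z) \<le> e\<rbrakk>
        \<Longrightarrow> adm X Y (C * e)"
    and near: "\<And>j z (A :: complex^('r + 'r)^('r + 'r)). \<lbrakk>j \<in> {1..g}; z \<in> Ann j\<rbrakk> \<Longrightarrow> norm (A ** (G (K' j) (\<tau> z) - G (K j) (\<tau> z))) \<le> \<theta> * norm A"
    and C: "C \<ge> 0" "\<theta> \<ge> 0" "\<theta> * C \<le> 1 / 2"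
  shows "solvable K'"
  unfolding solvable_def
proof (intro allI impI)
  fix u :: "nat \<Rightarrow> complex \<Rightarrow> complex^('r + 'r)^('r + 'r)" and B
  assume u: "\<forall>j\<in>{1..g}. matrix_holomorphic_on (u j) (Ann j)" "\<forall>j\<in>{1..g}. \<forall>z\<in>Ann j. norm (u j z) \<le> B"
  define e where "e = \<bar>B\<bar>"
  define \<Delta> where "\<Delta> j z = G (K' j) (\<tau> z) - G (K j) (\<tau> z)" for j z
  \<comment> \<open>Solvability provides a pair with some bound; the a priori estimate replaces that
    bound by C d.\<close>
  have solve: "\<exists>X Y. adm X Y (C * d) \<and> (\<forall>j\<in>{1..g}. \<forall>z\<in>Ann j. res K X Y j z = v j z)"
    if v: "\<forall>j\<in>{1..g}. matrix_holomorphic_on (v j) (Ann j)" "\<forall>j\<in>{1..g}. \<forall>z\<in>Ann j. norm (v j z) \<le> d" "0 \<le> d" for v d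
  proof -
    have "\<exists>X Y C. adm X Y C \<and> (\<forall>j\<in>{1..g}. \<forall>z\<in>Ann j. res K X Y j z = v j z)"
      by (rule solv[unfolded solvable_def, THEN spec, THEN spec, THEN mp, THEN mp, OF v(1) v(2)])
    then obtain X Y B where XY: "adm X Y B" "\<forall>j\<in>{1..g}. \<forall>z\<in>Ann j. res K X Y j z = v j z"
      by (elim exE conjE) (rule that)
    then have "adm X Y (C * d)" using apriori[OF XY(1) v(3)] v(2) by simp
    then show ?thesis using XY(2) by blast
  qed
  define \<P> where "\<P> n XY \<longleftrightarrow> adm (fst XY) (snd XY) (C * (e / 2 ^ n)) \<and>
     (n = 0 \<longrightarrow> (\<forall>j\<in>{1..g}. \<forall>z\<in>Ann j. res K (fst XY) (snd XY) j z = u j z))" for n XY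
  \<comment> \<open>Each pair corrects the error Y_n \<Delta> left by its predecessor. Since
    \<theta> C <= 1/2, the data are halved in every step.\<close>
  have "\<exists>f. \<forall>n. \<P> n (f n) \<and> (\<forall>j\<in>{1..g}. \<forall>z\<in>Ann j. res K (fst (f (Suc n))) (snd (f (Suc n))) j z = snd (f n) j z ** \<Delta> j z)"
  proof (rule dependent_nat_choice)
    have "\<exists>X Y. adm X Y (C * e) \<and> (\<forall>j\<in>{1..g}. \<forall>z\<in>Ann j. res K X Y j z = u j z)"
    proof (rule solve[OF u(1)])
      show "\<forall>j\<in>{1..g}. \<forall>z\<in>Ann j. norm (u j z) \<le> e"
        unfolding e_def by (intro ballI order_trans[OF u(2)[rule_format] abs_ge_self])
    qed (simp add: e_def)
    then show "\<exists>XY. \<P> 0 XY" by (auto simp: \<P>_def)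
    fix XY n assume P: "\<P> n XY"
    have "\<exists>X Y. adm X Y (C * (e / 2 ^ Suc n)) \<and> (\<forall>j\<in>{1..g}. \<forall>z\<in>Ann j. res K X Y j z = snd XY j z ** \<Delta> j z)"
    proof (rule solve)
      show "\<forall>j\<in>{1..g}. matrix_holomorphic_on (\<lambda>z. snd XY j z ** \<Delta> j z) (Ann j)"
      proof
        fix j assume j: "j \<in> {1..g}"
        have "matrix_holomorphic_on (snd XY j) (P j)" using P j by (auto simp: \<P>_def adm_def)
        from matrix_holomorphic_on_subset[OF this Ann_subset_P]
        show "matrix_holomorphic_on (\<lambda>z. snd XY j z ** \<Delta> j z) (Ann j)"
          unfolding \<Delta>_def
          by (rule matrix_holomorphic_on_mult[OF _ matrix_holomorphic_on_diff[OF G_\<tau>_holomorphic[OF j] G_\<tau>_holomorphic[OF j]]])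
      qed
      show "\<forall>j\<in>{1..g}. \<forall>z\<in>Ann j. norm (snd XY j z ** \<Delta> j z) \<le> e / 2 ^ Suc n"
      proof (intro ballI)
        fix j z assume j: "j \<in> {1..g}" "z \<in> Ann j"
        have "norm (snd XY j z ** \<Delta> j z) \<le> \<theta> * norm (snd XY j z)" unfolding \<Delta>_def by (rule near[OF j])
        also have "\<dots> \<le> \<theta> * (C * (e / 2 ^ n))"
          using P j Ann_subset_P[of j] C(2) by (intro mult_left_mono) (auto simp: \<P>_def adm_def)
        also have "\<dots> = (\<theta> * C) * (e / 2 ^ n)" by simp
        also have "\<dots> \<le> (1 / 2) * (e / 2 ^ n)" by (intro mult_right_mono C) (simp add: e_def)
        finally show "norm (snd XY j z ** \<Delta> j z) \<le> e / 2 ^ Suc n" by simp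
      qed
    qed (simp add: e_def)
    then show "\<exists>XY'. \<P> (Suc n) XY' \<and> (\<forall>j\<in>{1..g}. \<forall>z\<in>Ann j. res K (fst XY') (snd XY') j z = snd XY j z ** \<Delta> j z)"
      by (auto simp: \<P>_def)
  qed
  then obtain f where f: "\<And>n. \<P> n (f n)"
    "\<And>n j z. j \<in> {1..g} \<Longrightarrow> z \<in> Ann j \<Longrightarrow> res K (fst (f (Suc n))) (snd (f (Suc n))) j z = snd (f n) j z ** \<Delta> j z"
    by blast
  define X where "X n = fst (f n)" for n
  define Y where "Y n = snd (f n)" for n
  define c where "c = C * e"
  have adm: "adm (X n) (Y n) (c / 2 ^ n)" for n using f(1)[of n] by (simp add: \<P>_def X_def Y_def c_def)
  have res0: "res K (X 0) (Y 0) j z = u j z" if "j \<in> {1..g}" "z \<in> Ann j" for j z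
    using f(1)[of 0] that by (simp add: \<P>_def X_def Y_def)
  have resS: "res K (X (Suc n)) (Y (Suc n)) j z = Y n j z ** \<Delta> j z" if "j \<in> {1..g}" "z \<in> Ann j" for j z n
    using f(2)[OF that] by (simp add: X_def Y_def)
  have X_le: "norm (X n z) * (1 + norm z) \<le> c / 2 ^ n" if "z \<in> Q" for n z using adm that by (auto simp: adm_def)
  have Y_le: "norm (Y n j z) \<le> c / 2 ^ n" if "j \<in> {1..g}" "z \<in> P j" for n j z using adm that by (auto simp: adm_def)
  have X_le': "norm (X n z) \<le> c / 2 ^ n" if "z \<in> Q" for n z
  proof -
    have "norm (X n z) * 1 \<le> norm (X n z) * (1 + norm z)" by (intro mult_left_mono) auto
    then show ?thesis using X_le[OF that, of n] by simp
  qed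
  define X' where "X' z = (\<Sum>n. X n z)" for z
  define Y' where "Y' j z = (\<Sum>n. Y n j z)" for j z
  have sX: "summable (\<lambda>n. X n z)" if "z \<in> Q" for z
    by (rule summable_comparison_test'[OF summable_geometric_half[of c]]) (use X_le' that in auto)
  have sY: "summable (\<lambda>n. Y n j z)" if "j \<in> {1..g}" "z \<in> P j" for j z
    by (rule summable_comparison_test'[OF summable_geometric_half[of c]]) (use Y_le that in auto)
  have "adm X' Y' (2 * c)"
    unfolding adm_def
  proof (intro conjI ballI)
    show "matrix_holomorphic_on X' Q" unfolding X'_def
      by (rule matrix_holomorphic_on_suminf[OF _ open_Q X_le' summable_geometric_half]) (use adm in \<open>auto simp: adm_def\<close>)
    show "matrix_holomorphic_on (Y' j) (P j)" if "j \<in> {1..g}" for j unfolding Y'_def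
      by (rule matrix_holomorphic_on_suminf[OF _ open_P Y_le[OF that] summable_geometric_half]) (use adm that in \<open>auto simp: adm_def\<close>)
    show "norm (X' z) * (1 + norm z) \<le> 2 * c" if z: "z \<in> Q" for z
    proof -
      have pos: "1 + norm z > 0" by (simp add: add_pos_nonneg)
      have le: "norm (X n z) \<le> (c / (1 + norm z)) / 2 ^ n" for n
      proof -
        have "norm (X n z) \<le> (c / 2 ^ n) / (1 + norm z)" using X_le[OF z, of n] pos by (simp only: pos_le_divide_eq)
        then show ?thesis by (simp only: divide_divide_eq_left mult.commute)
      qed
      have s: "summable (\<lambda>n. norm (X n z))"
        by (rule summable_comparison_test'[OF summable_geometric_half[of "c / (1 + norm z)"]]) (use le in auto)
      have "norm (X' z) \<le> (\<Sum>n. norm (X n z))" unfolding X'_def by (rule summable_norm[OF s])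
      also have "\<dots> \<le> (\<Sum>n. (c / (1 + norm z)) / 2 ^ n)" by (rule suminf_le[OF le s summable_geometric_half])
      also have "\<dots> = 2 * (c / (1 + norm z))" by (rule suminf_geometric_half)
      finally show ?thesis using pos by (simp add: field_simps)
    qed
    show "norm (Y' j z) \<le> 2 * c" if z: "j \<in> {1..g}" "z \<in> P j" for j z
    proof -
      have s: "summable (\<lambda>n. norm (Y n j z))"
        by (rule summable_comparison_test'[OF summable_geometric_half[of c]]) (use Y_le[OF z] in auto)
      have "norm (Y' j z) \<le> (\<Sum>n. norm (Y n j z))" unfolding Y'_def by (rule summable_norm[OF s])
      also have "\<dots> \<le> (\<Sum>n. c / 2 ^ n)" by (rule suminf_le[OF Y_le[OF z] s summable_geometric_half])
      finally show ?thesis by (simp add: suminf_geometric_half)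
    qed
  qed
  moreover have "res K' X' Y' j z = u j z" if j: "j \<in> {1..g}" "z \<in> Ann j" for j z
  proof -
    have z: "z \<in> Q" "z \<in> P j" using j Ann_subset_P Ann_subset_Q by auto
    have SX: "(\<lambda>n. X n z) sums X' z" unfolding X'_def by (rule summable_sums[OF sX[OF z(1)]])
    have SY: "(\<lambda>n. Y n j z) sums Y' j z" unfolding Y'_def by (rule summable_sums[OF sY[OF j(1) z(2)]])
    have SYm: "(\<lambda>n. Y n j z ** A) sums (Y' j z ** A)" for A :: "complex^('r + 'r)^('r + 'r)"
      by (rule bounded_linear.sums[OF bounded_bilinear.bounded_linear_left[OF bounded_bilinear_matrix_mult] SY])
    have "(\<lambda>n. res K (X n) (Y n) j z) sums (res K X' Y' j z)"
      unfolding res_def by (rule sums_diff[OF SX SYm])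
    then have "(\<lambda>n. res K (X (Suc n)) (Y (Suc n)) j z) sums (res K X' Y' j z - res K (X 0) (Y 0) j z)"
      using sums_Suc_iff[of "\<lambda>n. res K (X n) (Y n) j z" "res K X' Y' j z - res K (X 0) (Y 0) j z"] by simp
    then have "(\<lambda>n. Y n j z ** \<Delta> j z) sums (res K X' Y' j z - u j z)"
      unfolding resS[OF j] res0[OF j] .
    \<comment> \<open>The sum telescopes to X' - Y' G(K) = u + Y' \<Delta>; moving the last term to
      the left replaces K by K'.\<close>
    with SYm have "res K X' Y' j z - u j z = Y' j z ** \<Delta> j z" using sums_unique2 by blast
    then show ?thesis by (simp add: res_def \<Delta>_def bounded_bilinear.diff_right[OF bounded_bilinear_matrix_mult] algebra_simps)
  qed
  ultimately show "\<exists>X Y C. adm X Y C \<and> (\<forall>j\<in>{1..g}. \<forall>z\<in>Ann j. res K' X Y j z = u j z)" by blast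
qed

section \<open>The a priori bound\<close>

lemma adm_scale:
  assumes "adm X Y B" "s \<ge> 0"
  shows "adm (\<lambda>z. s *\<^sub>R X z) (\<lambda>j z. s *\<^sub>R Y j z) (s * B)"
proof -
  have "norm (s *\<^sub>R X z) * (1 + norm z) \<le> s * B" if "z \<in> Q" for z
  proof -
    have "s * (norm (X z) * (1 + norm z)) \<le> s * B"
      using assms that by (intro mult_left_mono) (auto simp: adm_def)
    then show ?thesis using assms(2) by (simp add: mult.assoc)
  qed
  then show ?thesis
    using assms by (auto simp: adm_def intro!: matrix_holomorphic_on_scaleR mult_left_mono)
qed

lemma res_scale: "res K (\<lambda>z. s *\<^sub>R X z) (\<lambda>j z. s *\<^sub>R Y j z) j z = s *\<^sub>R res K X Y j z"
  by (simp add: res_def bounded_bilinear.scaleR_left[OF bounded_bilinear_matrix_mult] scaleR_diff_right)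

text \<open>The pair is divided by its least admissible bound M. The supremum need not be attained,
  so the lower bound on its size is recorded as failure of the bound 1/2; s t <= 1 holds because t <
  M.\<close>

lemma adm_normalize:
  assumes adm: "adm X Y B" and nadm: "\<not> adm X Y t" and t: "t \<ge> 0"
  shows "\<exists>s>0. adm (\<lambda>z. s *\<^sub>R X z) (\<lambda>j z. s *\<^sub>R Y j z) 1 \<and>
           \<not> adm (\<lambda>z. s *\<^sub>R X z) (\<lambda>j z. s *\<^sub>R Y j z) (1 / 2) \<and> s * t \<le> 1"
proof -
  define V where "V = insert 0 ((\<lambda>z. norm (X z) * (1 + norm z)) ` Q \<union> (\<lambda>(j, z). norm (Y j z)) ` (SIGMA j:{1..g}. P j))"
  define M where "M = Sup V"
  have V_le: "v \<le> max B 0" if "v \<in> V" for v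
    using that adm by (fastforce simp: V_def adm_def le_max_iff_disj)
  then have bdd: "bdd_above V" by (intro bdd_aboveI)
  have M_ge: "v \<le> M" if "v \<in> V" for v unfolding M_def by (rule cSup_upper[OF that bdd])
  have M: "adm X Y M' \<longleftrightarrow> (\<forall>v\<in>V. v \<le> M')" if "M' \<ge> 0" for M'
    using adm that by (auto simp: V_def adm_def)
  have M0: "M \<ge> 0" using M_ge[of 0] by (simp add: V_def)
  have "M > t"
  proof (rule ccontr)
    assume "\<not> M > t"
    then have "adm X Y t" using M[OF t] M_ge by force
    then show False using nadm by contradiction
  qed
  then have pos: "M > 0" using t by linarith
  define s where "s = 1 / M"
  have s: "s > 0" "M * s = 1" using pos by (auto simp: s_def)
  have "adm X Y M" using M[OF M0] M_ge by blast
  from adm_scale[OF this, of s] have "adm (\<lambda>z. s *\<^sub>R X z) (\<lambda>j z. s *\<^sub>R Y j z) 1"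
    using s by (simp add: mult.commute)
  moreover have "\<not> adm (\<lambda>z. s *\<^sub>R X z) (\<lambda>j z. s *\<^sub>R Y j z) (1 / 2)"
  proof
    assume "adm (\<lambda>z. s *\<^sub>R X z) (\<lambda>j z. s *\<^sub>R Y j z) (1 / 2)"
    from adm_scale[OF this M0] have "adm X Y (M / 2)" using s by simp
    then have "\<forall>v\<in>V. v \<le> M / 2" using M[of "M / 2"] M0 by simp
    then have "M \<le> M / 2" unfolding M_def by (intro cSup_least) (auto simp: V_def)
    then show False using pos by simp
  qed
  moreover have "s * t \<le> 1" using \<open>M > t\<close> pos by (simp add: s_def)
  ultimately show ?thesis using s(1) by blast
qed

lemma conj_transpose_tendsto:
  "(f \<longlongrightarrow> A) F \<Longrightarrow> ((\<lambda>x. conj_transpose (f x)) \<longlongrightarrow> conj_transpose A) F"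
  by (simp add: tendsto_matrix_iff tendsto_cnj)

lemma unitary_limit:
  fixes U :: "nat \<Rightarrow> complex^'n^'n"
  assumes lim: "U \<longlonglongrightarrow> A" and U: "\<And>n. unitary_matrix (U n)"
  shows "unitary_matrix A"
proof -
  have "(\<lambda>n. conj_transpose (U n) ** U n) \<longlonglongrightarrow> conj_transpose A ** A"
    by (intro tendsto_matrix_mult conj_transpose_tendsto lim)
  then have "(\<lambda>n. mat 1 :: complex^'n^'n) \<longlonglongrightarrow> conj_transpose A ** A" using U by (simp add: unitary_matrix_def)
  then have 1: "conj_transpose A ** A = mat 1" using LIMSEQ_unique tendsto_const by blast
  have "(\<lambda>n. U n ** conj_transpose (U n)) \<longlonglongrightarrow> A ** conj_transpose A"
    by (intro tendsto_matrix_mult conj_transpose_tendsto lim)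
  then have "(\<lambda>n. mat 1 :: complex^'n^'n) \<longlonglongrightarrow> A ** conj_transpose A" using U by (simp add: unitary_matrix_def)
  then have 2: "A ** conj_transpose A = mat 1" using LIMSEQ_unique tendsto_const by blast
  show ?thesis using 1 2 by (simp add: unitary_matrix_def)
qed

lemma G_tendsto:
  fixes U :: "nat \<Rightarrow> complex^'r::finite^'r"
  assumes "U \<longlonglongrightarrow> A"
  shows "(\<lambda>n. G (U n) t) \<longlonglongrightarrow> G A t"
proof -
  define c where "c = real CARD('r + 'r) * real CARD('r + 'r) * (1 + (norm t + norm (1 / t)))"
  have "(\<lambda>n. c * norm (U n - A)) \<longlonglongrightarrow> c * 0"
    by (intro tendsto_mult tendsto_const tendsto_norm_zero LIM_zero assms)
  then have "(\<lambda>n. c * norm (U n - A)) \<longlonglongrightarrow> 0" by simp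
  then have "(\<lambda>n. G (U n) t - G A t) \<longlonglongrightarrow> 0"
  proof (rule Lim_null_comparison[rotated])
    show "\<forall>\<^sub>F n in sequentially. norm (G (U n) t - G A t) \<le> c * norm (U n - A)"
      unfolding c_def by (intro always_eventually allI G_diff_le) simp_all
  qed
  then show ?thesis by (rule LIM_zero_cancel)
qed

lemma discs_bounded: obtains \<rho> where "\<rho> \<ge> 1" "\<And>j z. j \<in> {1..g} \<Longrightarrow> cmod (z - complex_of_real (mid j)) \<le> rad 2 j \<Longrightarrow> norm z < \<rho>"
proof
  let ?\<rho> = "(\<Sum>j\<in>{1..g}. \<bar>mid j\<bar> + \<bar>rad 2 j\<bar>) + 1"
  show "?\<rho> \<ge> 1" by (simp add: sum_nonneg)
  fix j and z :: complex assume j: "j \<in> {1..g}" and z: "cmod (z - complex_of_real (mid j)) \<le> rad 2 j"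
  have "\<bar>mid j\<bar> + \<bar>rad 2 j\<bar> \<le> (\<Sum>j\<in>{1..g}. \<bar>mid j\<bar> + \<bar>rad 2 j\<bar>)"
    by (rule member_le_sum) (use j in auto)
  moreover have "norm z \<le> cmod (z - of_real (mid j)) + \<bar>mid j\<bar>"
    using norm_triangle_ineq[of "z - of_real (mid j)" "of_real (mid j)"] by simp
  ultimately show "norm z < ?\<rho>" using z by linarith
qed

text \<open>The radii with s = 3/2 lie strictly inside the annuli. So \<open>core \<rho>\<close> is
  compact in Q and the closed discs of radius \<open>rad (3/2) j\<close> are compact in
  \<open>P j\<close>, where locally uniform convergence applies; the points of Q and
  \<open>P j\<close> that they miss lie in annuli or far out.\<close>

definition core :: "real \<Rightarrow> complex set" where
  "core \<rho> = {z. norm z \<le> \<rho> \<and> (\<forall>j\<in>{1..g}. rad (3/2) j \<le> cmod (z - complex_of_real (mid j)))}"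

lemma compact_core: "compact (core \<rho>)"
proof -
  have "core \<rho> = cball 0 \<rho> \<inter> (\<Inter>j\<in>{1..g}. {z. rad (3/2) j \<le> cmod (z - complex_of_real (mid j))})"
    by (auto simp: core_def)
  moreover have "closed (\<Inter>j\<in>{1..g}. {z. rad (3/2) j \<le> cmod (z - complex_of_real (mid j))})"
    by (intro closed_INT ballI closed_Collect_le continuous_intros)
  ultimately show ?thesis by (simp add: compact_Int_closed)
qed

lemma core_subset: "core \<rho> \<subseteq> Q"
  using rad_mono[of 1 "3/2"] by (force simp: core_def Q_def intro: less_le_trans)

text \<open>If \<open>(X, Y)\<close> nearly solves the transmission problem on the annuli, smallness on the compact sets
  \<open>core \<rho>\<close> and \<open>cball (mid j) (rad (3/2) j)\<close> propagates: into the annuli through the transmission relation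
  and to infinity by the maximum principle.\<close>

lemma small_propagates:
  assumes \<rho>: "\<rho>' \<ge> 1" "\<rho> = \<rho>' + 1" "\<And>j z. j \<in> {1..g} \<Longrightarrow> cmod (z - complex_of_real (mid j)) \<le> rad 2 j \<Longrightarrow> norm z < \<rho>'"
  shows "\<exists>c>0. \<forall>(K :: nat \<Rightarrow> complex^'r::finite^'r) X Y B \<eta>. (\<forall>j\<in>{1..g}. unitary_matrix (K j)) \<longrightarrow> adm X Y B \<longrightarrow> \<eta> > 0 \<longrightarrow>
     (\<forall>j\<in>{1..g}. \<forall>z\<in>Ann j. norm (res K X Y j z) \<le> \<eta>) \<longrightarrow>
     (\<forall>z\<in>core \<rho>. norm (X z) \<le> \<eta>) \<longrightarrow>
     (\<forall>j\<in>{1..g}. \<forall>z\<in>cball (of_real (mid j)) (rad (3/2) j). norm (Y j z) \<le> \<eta>) \<longrightarrow> adm X Y (c * \<eta>)"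
proof -
  obtain BT where BT: "BT > 0" "\<And>j z. j \<in> {1..g} \<Longrightarrow> z \<in> cl_Ann j \<Longrightarrow> norm (\<tau> z) \<le> BT \<and> norm (1 / \<tau> z) \<le> BT"
    using \<tau>_bound by blast
  obtain CG where CG: "CG > 0" "\<And>(K :: complex^'r^'r) t. \<lbrakk>norm t \<le> BT; norm (1 / t) \<le> BT; unitary_matrix K\<rbrakk> \<Longrightarrow> norm (G K t) \<le> CG"
    using G_norm_bound by blast
  obtain cm where cm: "cm > 0"
    "\<And>A B. norm (A ** B :: complex^('r + 'r)^('r + 'r)) \<le> cm * norm (A :: complex^('r + 'r)^('r + 'r)) * norm B"
    using matrix_mult_bound by blast
  define n where "n = real CARD('r + 'r) * real CARD('r + 'r)"
  have n1: "n > 0" by (simp add: n_def)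
  have \<rho>1: "\<rho> > 0" "\<rho> \<ge> 1" using \<rho> by auto
  \<comment> \<open>The summands serve X up to radius \<rho>, X beyond it, and Y in the outer half
    of the annuli; the final 1 covers Y on the closed discs.\<close>
  define c where "c = (1 + \<rho>) * (1 + cm * CG) + 2 * (n * \<rho>) + cm * (2 * CG) + 1"
  have c_parts: "(1 + \<rho>) * (1 + cm * CG) \<le> c" "2 * (n * \<rho>) \<le> c" "cm * (2 * CG) \<le> c" "1 \<le> c" "c > 0"
    using \<rho>1 cm(1) CG(1) n1 by (auto simp: c_def intro!: add_nonneg_pos add_nonneg_nonneg)
  have "adm X Y (c * \<eta>)"
    if U: "\<forall>j\<in>{1..g}. unitary_matrix (K j)" and adm: "adm X Y B" and \<eta>: "\<eta> > 0"
      and res: "\<forall>j\<in>{1..g}. \<forall>z\<in>Ann j. norm (res K X Y j z) \<le> \<eta>"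
      and Xs: "\<forall>z\<in>core \<rho>. norm (X z) \<le> \<eta>"
      and Ys: "\<forall>j\<in>{1..g}. \<forall>z\<in>cball (of_real (mid j)) (rad (3/2) j). norm (Y j z) \<le> \<eta>"
    for K :: "nat \<Rightarrow> complex^'r^'r" and X Y B \<eta>
  proof -
    have prod: "norm (A ** H) \<le> cm * CG * d" if "norm A \<le> d" "norm H \<le> CG" for A H :: "complex^('r + 'r)^('r + 'r)" and d
    proof -
      have "d \<ge> 0" using that(1) norm_ge_zero order_trans by blast
      have "norm (A ** H) \<le> cm * (norm A * norm H)" using cm(2)[of A H] by (simp add: mult.assoc)
      also have "\<dots> \<le> cm * (d * CG)" using cm(1) \<open>d \<ge> 0\<close> that by (intro mult_left_mono mult_mono) auto
      finally show ?thesis by (simp add: mult_ac)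
    qed
    have Gb: "norm (G (K j) (\<tau> z)) \<le> CG" "norm (G (conj_transpose (K j)) (\<tau> z)) \<le> CG"
      if "j \<in> {1..g}" "z \<in> Ann j" for j z
      using BT(2)[OF that(1)] Ann_subset_cl that U by (auto intro!: CG(2) unitary_matrix_conj_transpose)
    have near: "norm (X z) * (1 + norm z) \<le> c * \<eta>" if "norm (X z) \<le> (1 + cm * CG) * \<eta>" "norm z \<le> \<rho>" for z
    proof -
      have "norm (X z) * (1 + norm z) \<le> ((1 + cm * CG) * \<eta>) * (1 + \<rho>)"
        using that \<eta> cm(1) CG(1) by (intro mult_mono) auto
      also have "\<dots> = ((1 + \<rho>) * (1 + cm * CG)) * \<eta>" by (simp only: mult_ac)
      also have "\<dots> \<le> c * \<eta>" using c_parts(1) \<eta> by (intro mult_right_mono) auto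
      finally show ?thesis .
    qed
    have X_small: "norm (X z) * (1 + norm z) \<le> c * \<eta>" if z: "z \<in> Q" for z
    proof (cases "norm z \<le> \<rho>")
      case True
      show ?thesis
      proof (cases "z \<in> core \<rho>")
        case core: True
        have "norm (X z) \<le> 1 * \<eta>" using Xs core by simp
        also have "\<dots> \<le> (1 + cm * CG) * \<eta>" using \<eta> cm(1) CG(1) by (intro mult_right_mono) auto
        finally show ?thesis using near True by blast
      next
        case False
        \<comment> \<open>Here z lies in the inner half of an annulus, where Y is small and X is
          read off from the transmission relation.\<close>
        then obtain j where j: "j \<in> {1..g}" "cmod (z - complex_of_real (mid j)) < rad (3/2) j"
          using True by (auto simp: core_def not_le)
        then have zA: "z \<in> Ann j" using z rad_mono[of "3/2" 2 j] by (auto simp: Ann_def Q_def)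
        have "norm (Y j z) \<le> \<eta>" using Ys j by (auto simp: dist_norm norm_minus_commute)
        then have "norm (Y j z ** G (K j) (\<tau> z)) \<le> cm * CG * \<eta>" by (rule prod[OF _ Gb(1)[OF j(1) zA]])
        moreover have "norm (res K X Y j z) \<le> \<eta>" using res j(1) zA by blast
        moreover have "X z = res K X Y j z + Y j z ** G (K j) (\<tau> z)" by (simp add: res_def)
        ultimately have "norm (X z) \<le> \<eta> + cm * CG * \<eta>"
          using norm_triangle_ineq[of "res K X Y j z" "Y j z ** G (K j) (\<tau> z)"] by simp
        then show ?thesis using near True by (simp add: algebra_simps)
      qed
    next
      case False
      have zpos: "norm z > 0" "norm z \<ge> 1" using False \<rho>1 by auto
      \<comment> \<open>All discs lie within radius \<rho>', so the entries of X are analytic beyond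
        it, and the circle of radius \<rho> = \<rho>' + 1 belongs to the core.\<close>
      have ent: "norm (X z $ i $ l) \<le> \<eta> * \<rho> / norm z" for i l
      proof (rule exterior_max_modulus[of "\<lambda>z. X z $ i $ l" \<rho>'])
        have "matrix_holomorphic_on X Q" using adm by (simp add: adm_def)
        then have "(\<lambda>z. X z $ i $ l) holomorphic_on Q" by (simp add: matrix_holomorphic_on_def)
        then show "(\<lambda>z. X z $ i $ l) holomorphic_on {z. \<rho>' < norm z}"
        proof (rule holomorphic_on_subset, intro subsetI)
          fix w assume "w \<in> {z. \<rho>' < cmod z}"
          then have "rad 2 j < cmod (w - complex_of_real (mid j))" if "j \<in> {1..g}" for j
            using \<rho>(3)[OF that, of w] by force
          then show "w \<in> Q"
            unfolding Q_def by (intro CollectI ballI less_trans[OF rad_mono[of 1 2]]) simp_all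
        qed
        show "((\<lambda>z. X z $ i $ l) \<longlongrightarrow> 0) at_infinity"
          using adm_tendsto_0[OF adm] by (simp add: tendsto_matrix_iff)
        show "norm (X w $ i $ l) \<le> \<eta>" if w: "norm w = \<rho>" for w
        proof -
          have "rad (3/2) j \<le> cmod (w - complex_of_real (mid j))" if "j \<in> {1..g}" for j
            using \<rho>(3)[OF that, of w] w \<rho>(2) rad_mono[of "3/2" 2 j] by force
          then have "w \<in> core \<rho>" using w by (simp add: core_def)
          then show ?thesis using Xs norm_entry_le[of "X w" i l] by force
        qed
      qed (use \<rho> \<eta> \<rho>1 False in auto)
      have "norm (X z) \<le> n * (\<eta> * \<rho> / norm z)" unfolding n_def by (rule norm_matrix_le[OF ent])
      then have "norm (X z) * (1 + norm z) \<le> n * (\<eta> * \<rho> / norm z) * (2 * norm z)"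
        using zpos \<eta> \<rho>1 n1 by (intro mult_mono) auto
      also have "\<dots> = (2 * (n * \<rho>)) * \<eta>" using zpos(1) by simp
      also have "\<dots> \<le> c * \<eta>" using c_parts(2) \<eta> by (intro mult_right_mono) auto
      finally show ?thesis .
    qed
    have Y_small: "norm (Y j z) \<le> c * \<eta>" if j: "j \<in> {1..g}" and z: "z \<in> P j" for j z
    proof (cases "cmod (z - complex_of_real (mid j)) \<le> rad (3/2) j")
      case True
      have "norm (Y j z) \<le> 1 * \<eta>" using Ys j True by (auto simp: dist_norm norm_minus_commute)
      also have "\<dots> \<le> c * \<eta>" using c_parts(4) \<eta> by (intro mult_right_mono) auto
      finally show ?thesis .
    next
      case False
      \<comment> \<open>In the outer half of the annulus X is small and the relation is solved for
        Y, the inverse of G at K being G at the adjoint of K.\<close>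
      then have zA: "z \<in> Ann j" using z rad_mono[of 1 "3/2" j] by (auto simp: Ann_def in_P)
      have "rad (3/2) i \<le> cmod (z - complex_of_real (mid i))" if "i \<in> {1..g}" for i
        using discs_disjoint[of i j z] that j z False rad_mono[of "3/2" 2 i] by (cases "i = j") (force simp: in_P)+
      moreover have "norm z \<le> \<rho>" using \<rho>(3)[OF j, of z] z \<rho>(2) by (simp add: in_P)
      ultimately have "z \<in> core \<rho>" by (simp add: core_def)
      then have "norm (X z) \<le> \<eta>" using Xs by blast
      moreover have "norm (res K X Y j z) \<le> \<eta>" using res j zA by blast
      ultimately have "norm (X z - res K X Y j z) \<le> 2 * \<eta>"
        using norm_triangle_ineq4[of "X z" "res K X Y j z"] by simp
      then have "norm ((X z - res K X Y j z) ** G (conj_transpose (K j)) (\<tau> z)) \<le> cm * CG * (2 * \<eta>)"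
        by (rule prod[OF _ Gb(2)[OF j zA]])
      moreover have "(X z - res K X Y j z) ** G (conj_transpose (K j)) (\<tau> z) = Y j z"
      proof -
        have "G (K j) (\<tau> z) ** G (conj_transpose (K j)) (\<tau> z) = mat 1"
          using G_inverse[OF \<tau>_nonzero_Ann[OF j zA]] U j by blast
        then show ?thesis by (simp add: res_def matrix_mul_assoc[symmetric] matrix_mul_rid)
      qed
      ultimately have "norm (Y j z) \<le> (cm * (2 * CG)) * \<eta>" by (simp add: mult_ac)
      also have "\<dots> \<le> c * \<eta>" using c_parts(3) \<eta> by (intro mult_right_mono) auto
      finally show ?thesis .
    qed
    show ?thesis using adm X_small Y_small by (auto simp: adm_def)
  qed
  then show ?thesis using c_parts(5) by (intro exI[of _ c]) blast
qed

text \<open>Normalized counterexamples would converge, along a subsequence, to a solution of the homogeneous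
  problem; the latter vanishes, contradicting the normalization.\<close>

theorem uniform_apriori:
  "\<exists>C\<ge>0. \<forall>(K :: nat \<Rightarrow> complex^'r::finite^'r) X Y B e. (\<forall>j\<in>{1..g}. unitary_matrix (K j)) \<longrightarrow> adm X Y B \<longrightarrow> 0 \<le> e \<longrightarrow>
     (\<forall>j\<in>{1..g}. \<forall>z\<in>Ann j. norm (res K X Y j z) \<le> e) \<longrightarrow> adm X Y (C * e)"
proof (rule ccontr)
  assume contra: "\<not> ?thesis"
  \<comment> \<open>A counterexample to the constant n + 1 after normalization: the pair satisfies
    the bound 1 but not 1/2, while its residual is at most 1 / (n + 1).\<close>
  define Bad where "Bad n T \<longleftrightarrow> (\<forall>j\<in>{1..g}. unitary_matrix (fst T j)) \<and> adm (fst (snd T)) (snd (snd T)) 1 \<and>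
     \<not> adm (fst (snd T)) (snd (snd T)) (1 / 2) \<and>
     (\<forall>j\<in>{1..g}. \<forall>z\<in>Ann j. norm (res (fst T) (fst (snd T)) (snd (snd T)) j z) \<le> 1 / real (Suc n))"
    for n and T :: "(nat \<Rightarrow> complex^'r^'r) \<times> (complex \<Rightarrow> complex^('r + 'r)^('r + 'r)) \<times> (nat \<Rightarrow> complex \<Rightarrow> complex^('r + 'r)^('r + 'r))"
  have "\<exists>T. Bad n T" for n
  proof -
    have "\<not> (\<forall>(K :: nat \<Rightarrow> complex^'r^'r) X Y B e. (\<forall>j\<in>{1..g}. unitary_matrix (K j)) \<longrightarrow> adm X Y B \<longrightarrow> 0 \<le> e \<longrightarrow>
      (\<forall>j\<in>{1..g}. \<forall>z\<in>Ann j. norm (res K X Y j z) \<le> e) \<longrightarrow> adm X Y (real (Suc n) * e))"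
      using contra of_nat_0_le_iff[of "Suc n"] by blast
    then obtain K :: "nat \<Rightarrow> complex^'r^'r" and X Y B e where
      KXY: "\<forall>j\<in>{1..g}. unitary_matrix (K j)" "adm X Y B" "0 \<le> e"
      "\<forall>j\<in>{1..g}. \<forall>z\<in>Ann j. norm (res K X Y j z) \<le> e" "\<not> adm X Y (real (Suc n) * e)"
      by blast
    obtain s where s: "s > 0" "adm (\<lambda>z. s *\<^sub>R X z) (\<lambda>j z. s *\<^sub>R Y j z) 1"
      "\<not> adm (\<lambda>z. s *\<^sub>R X z) (\<lambda>j z. s *\<^sub>R Y j z) (1 / 2)" "s * (real (Suc n) * e) \<le> 1"
      using adm_normalize[OF KXY(2,5)] KXY(3) by (auto simp del: of_nat_Suc)
    have "s * e \<le> 1 / real (Suc n)" using s(4) by (simp add: field_simps)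
    have small: "norm (res K (\<lambda>z. s *\<^sub>R X z) (\<lambda>j z. s *\<^sub>R Y j z) j z) \<le> 1 / real (Suc n)"
      if "j \<in> {1..g}" "z \<in> Ann j" for j z
    proof -
      have "norm (res K (\<lambda>z. s *\<^sub>R X z) (\<lambda>j z. s *\<^sub>R Y j z) j z) = s * norm (res K X Y j z)"
        unfolding res_scale using s(1) by simp
      also have "\<dots> \<le> s * e" using KXY(4) that s(1) by (intro mult_left_mono) auto
      also note \<open>s * e \<le> 1 / real (Suc n)\<close>
      finally show ?thesis .
    qed
    have "Bad n (K, (\<lambda>z. s *\<^sub>R X z), (\<lambda>j z. s *\<^sub>R Y j z))"
      unfolding Bad_def fst_conv snd_conv using KXY(1) s(2,3) small by blast
    then show ?thesis by blast
  qed
  then obtain T where T: "\<And>n. Bad n (T n)" by metis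
  define K where "K n = fst (T n)" for n
  define X where "X n = fst (snd (T n))" for n
  define Y where "Y n = snd (snd (T n))" for n
  have U: "unitary_matrix (K n j)" if "j \<in> {1..g}" for n j using T[of n] that by (simp add: Bad_def K_def)
  have adm: "adm (X n) (Y n) 1" and nadm: "\<not> adm (X n) (Y n) (1 / 2)" for n using T[of n] by (simp_all add: Bad_def X_def Y_def)
  have res: "norm (res (K n) (X n) (Y n) j z) \<le> 1 / real (Suc n)" if "j \<in> {1..g}" "z \<in> Ann j" for n j z
    using T[of n] that unfolding Bad_def X_def Y_def K_def by blast
  have X_le: "norm (X n z) * (1 + norm z) \<le> 1" if "z \<in> Q" for n z using adm[of n] that by (simp add: adm_def)
  have X_le1: "norm (X n z) \<le> 1" if "z \<in> Q" for n z
  proof -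
    have "norm (X n z) * 1 \<le> norm (X n z) * (1 + norm z)" by (intro mult_left_mono) auto
    then show ?thesis using X_le[OF that, of n] by linarith
  qed
  have Y_le: "norm (Y n j z) \<le> 1" if "j \<in> {1..g}" "z \<in> P j" for n j z using adm[of n] that by (simp add: adm_def)
  \<comment> \<open>Matrices are viewed as constant entire functions, so the normal family lemma
    also extracts a convergent subsequence of the bounded K_j, for all j at once.\<close>
  have "\<exists>(r :: nat \<Rightarrow> nat) L. strict_mono r \<and> (\<forall>j\<in>{1..g}. matrix_holomorphic_on (L j) UNIV \<and>
     (\<forall>C. compact C \<longrightarrow> C \<subseteq> UNIV \<longrightarrow> uniform_limit C (\<lambda>n (z::complex). K (r n) j) (L j) sequentially))"
    by (rule Montel_matrix_family[where F="\<lambda>j n z. K n j" and B="real CARD('r) * real CARD('r)"])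
      (use U norm_unitary_le in auto)
  then obtain r1 L1 where r1: "strict_mono (r1 :: nat \<Rightarrow> nat)" and
    L1: "\<forall>j\<in>{1..g}. matrix_holomorphic_on (L1 j) UNIV \<and>
     (\<forall>C. compact C \<longrightarrow> C \<subseteq> UNIV \<longrightarrow> uniform_limit C (\<lambda>n (z::complex). K (r1 n) j) (L1 j) sequentially)"
    by (elim exE conjE) (rule that)
  \<comment> \<open>Index 0 stands for X on Q and j >= 1 for Y_j on \<open>P j\<close>, so that one
    extraction serves all components.\<close>
  define S where "S j = (if j = 0 then Q else P j)" for j :: nat
  define F where "F j n = (if j = 0 then X (r1 n) else Y (r1 n) j)" for j :: nat and n
  have "\<exists>(r :: nat \<Rightarrow> nat) L. strict_mono r \<and> (\<forall>j\<in>{0..g}. matrix_holomorphic_on (L j) (S j) \<and>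
     (\<forall>C. compact C \<longrightarrow> C \<subseteq> S j \<longrightarrow> uniform_limit C (\<lambda>n. F j (r n)) (L j) sequentially))"
  proof (rule Montel_matrix_family[where B=1])
    fix j n assume j: "j \<in> {0..g}"
    show "open (S j)" by (simp add: S_def open_Q open_P)
    show "matrix_holomorphic_on (F j n) (S j)" using adm[of "r1 n"] j by (auto simp: adm_def F_def S_def)
    show "norm (F j n z) \<le> 1" if "z \<in> S j" for z
      using X_le1[of z "r1 n"] Y_le[of j z "r1 n"] j that by (auto simp: F_def S_def split: if_splits)
  qed simp
  then obtain r2 L where r2: "strict_mono (r2 :: nat \<Rightarrow> nat)" and
    L: "\<forall>j\<in>{0..g}. matrix_holomorphic_on (L j) (S j) \<and>
     (\<forall>C. compact C \<longrightarrow> C \<subseteq> S j \<longrightarrow> uniform_limit C (\<lambda>n. F j (r2 n)) (L j) sequentially)"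
    by (elim exE conjE) (rule that)
  define \<sigma> where "\<sigma> n = r1 (r2 n)" for n
  have \<sigma>: "strict_mono \<sigma>" unfolding \<sigma>_def using strict_mono_o[OF r1 r2] by (simp add: o_def)
  have ulX: "uniform_limit C (\<lambda>n. X (\<sigma> n)) (L 0) sequentially" if "compact C" "C \<subseteq> Q" for C
    using L[THEN bspec, of 0] that by (auto simp: F_def S_def \<sigma>_def)
  have ulY: "uniform_limit C (\<lambda>n. Y (\<sigma> n) j) (L j) sequentially" if "j \<in> {1..g}" "compact C" "C \<subseteq> P j" for C j
    using L[THEN bspec, of j] that by (auto simp: F_def S_def \<sigma>_def)
  define K' where "K' j = L1 j 0" for j
  have limK: "(\<lambda>n. K (\<sigma> n) j) \<longlonglongrightarrow> K' j" if j: "j \<in> {1..g}" for j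
  proof -
    have "uniform_limit {0::complex} (\<lambda>n z. K (r1 n) j) (L1 j) sequentially"
      by (rule L1[THEN bspec, OF j, THEN conjunct2, rule_format]) auto
    then have "(\<lambda>n. K (r1 n) j) \<longlonglongrightarrow> K' j" unfolding K'_def by (rule tendsto_uniform_limitI) simp
    from LIMSEQ_subseq_LIMSEQ[OF this r2] show ?thesis by (simp add: o_def \<sigma>_def)
  qed
  have limX: "(\<lambda>n. X (\<sigma> n) z) \<longlonglongrightarrow> L 0 z" if "z \<in> Q" for z
    by (rule tendsto_uniform_limitI[OF ulX[of "{z}"]]) (use that in auto)
  have limY: "(\<lambda>n. Y (\<sigma> n) j z) \<longlonglongrightarrow> L j z" if "j \<in> {1..g}" "z \<in> P j" for j z
    by (rule tendsto_uniform_limitI[OF ulY[of j "{z}"]]) (use that in auto)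
  have U': "unitary_matrix (K' j)" if "j \<in> {1..g}" for j
    by (rule unitary_limit[OF limK[OF that] U[OF that]])
  have adm': "adm (L 0) L 1"
    unfolding adm_def
  proof (intro conjI ballI)
    show "matrix_holomorphic_on (L 0) Q" using L[THEN bspec, of 0] by (simp add: S_def)
    show "matrix_holomorphic_on (L j) (P j)" if "j \<in> {1..g}" for j using L[THEN bspec, of j] that by (simp add: S_def)
    show "norm (L 0 z) * (1 + norm z) \<le> 1" if "z \<in> Q" for z
    proof (rule tendsto_upperbound)
      show "(\<lambda>n. norm (X (\<sigma> n) z) * (1 + norm z)) \<longlonglongrightarrow> norm (L 0 z) * (1 + norm z)"
        by (intro tendsto_mult tendsto_norm limX that tendsto_const)
    qed (use X_le that in auto)
    show "norm (L j z) \<le> 1" if "j \<in> {1..g}" "z \<in> P j" for j z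
      by (rule tendsto_upperbound[OF tendsto_norm[OF limY[OF that]]]) (use Y_le that in auto)
  qed
  have inv_lim: "(\<lambda>n. 1 / real (Suc (\<sigma> n))) \<longlonglongrightarrow> 0"
    using LIMSEQ_subseq_LIMSEQ[OF lim_inverse_n' \<sigma>] LIMSEQ_subseq_LIMSEQ[OF LIMSEQ_inverse_real_of_nat \<sigma>]
    by (simp add: o_def inverse_eq_divide)
  have res': "res K' (L 0) L j z = 0" if j: "j \<in> {1..g}" "z \<in> Ann j" for j z
  proof -
    have z: "z \<in> Q" "z \<in> P j" using j Ann_subset_P Ann_subset_Q by auto
    have "(\<lambda>n. res (K (\<sigma> n)) (X (\<sigma> n)) (Y (\<sigma> n)) j z) \<longlonglongrightarrow> res K' (L 0) L j z"
      unfolding res_def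
      by (intro tendsto_diff tendsto_matrix_mult limX limY G_tendsto limK j z)
    moreover have "(\<lambda>n. res (K (\<sigma> n)) (X (\<sigma> n)) (Y (\<sigma> n)) j z) \<longlonglongrightarrow> 0"
      by (rule Lim_null_comparison[OF _ inv_lim]) (use res j in auto)
    ultimately show ?thesis by (rule LIMSEQ_unique)
  qed
  have L0: "L 0 z = 0" if "z \<in> Q" for z by (rule kernel_trivial(1)[OF U' adm' res' that])
  have Lj: "L j z = 0" if "j \<in> {1..g}" "z \<in> P j" for j z by (rule kernel_trivial(2)[OF U' adm' res' that])
  obtain \<rho> where \<rho>: "\<rho> \<ge> 1" "\<And>j z. j \<in> {1..g} \<Longrightarrow> cmod (z - complex_of_real (mid j)) \<le> rad 2 j \<Longrightarrow> norm z < \<rho>"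
    using discs_bounded by blast
  have "\<exists>c>0. \<forall>(K :: nat \<Rightarrow> complex^'r^'r) X Y B \<eta>. (\<forall>j\<in>{1..g}. unitary_matrix (K j)) \<longrightarrow> adm X Y B \<longrightarrow> \<eta> > 0 \<longrightarrow>
     (\<forall>j\<in>{1..g}. \<forall>z\<in>Ann j. norm (res K X Y j z) \<le> \<eta>) \<longrightarrow>
     (\<forall>z\<in>core (\<rho> + 1). norm (X z) \<le> \<eta>) \<longrightarrow>
     (\<forall>j\<in>{1..g}. \<forall>z\<in>cball (of_real (mid j)) (rad (3/2) j). norm (Y j z) \<le> \<eta>) \<longrightarrow> adm X Y (c * \<eta>)"
    by (rule small_propagates[OF \<rho>(1) refl \<rho>(2)])
  then obtain c where c: "c > 0" and small: "\<And>(K :: nat \<Rightarrow> complex^'r^'r) X Y B \<eta>. \<lbrakk>\<forall>j\<in>{1..g}. unitary_matrix (K j); adm X Y B; \<eta> > 0;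
     \<forall>j\<in>{1..g}. \<forall>z\<in>Ann j. norm (res K X Y j z) \<le> \<eta>; \<forall>z\<in>core (\<rho> + 1). norm (X z) \<le> \<eta>;
     \<forall>j\<in>{1..g}. \<forall>z\<in>cball (of_real (mid j)) (rad (3/2) j). norm (Y j z) \<le> \<eta>\<rbrakk> \<Longrightarrow> adm X Y (c * \<eta>)"
    by blast
  \<comment> \<open>Chosen so that c \<eta> = 1/2, the bound that every normalized pair
    violates.\<close>
  define \<eta> where "\<eta> = 1 / (2 * c)"
  have \<eta>: "\<eta> > 0" "c * \<eta> = 1 / 2" using c by (auto simp: \<eta>_def)
  have "\<forall>\<^sub>F n in sequentially. \<forall>z\<in>core (\<rho> + 1). dist (X (\<sigma> n) z) (L 0 z) < \<eta>"
    by (rule uniform_limitD[OF ulX[OF compact_core core_subset] \<eta>(1)])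
  moreover have "\<forall>\<^sub>F n in sequentially. \<forall>j\<in>{1..g}. \<forall>z\<in>cball (of_real (mid j)) (rad (3/2) j). dist (Y (\<sigma> n) j z) (L j z) < \<eta>"
  proof (rule eventually_ball_finite, simp, rule ballI)
    fix j assume j: "j \<in> {1..g}"
    have "cball (of_real (mid j)) (rad (3/2) j) \<subseteq> P j"
      using rad_mono[of "3/2" 2 j] by (auto simp: P_def)
    then show "\<forall>\<^sub>F n in sequentially. \<forall>z\<in>cball (of_real (mid j)) (rad (3/2) j). dist (Y (\<sigma> n) j z) (L j z) < \<eta>"
      by (intro uniform_limitD[OF ulY[OF j] \<eta>(1)]) auto
  qed
  moreover have "\<forall>\<^sub>F n in sequentially. 1 / real (Suc (\<sigma> n)) < \<eta>"
    by (rule order_tendstoD(2)[OF inv_lim \<eta>(1)])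
  ultimately have "\<forall>\<^sub>F n in sequentially. adm (X (\<sigma> n)) (Y (\<sigma> n)) (c * \<eta>)"
  proof eventually_elim
    case (elim n)
    show ?case
    proof (rule small[OF _ adm \<eta>(1)])
      show "\<forall>j\<in>{1..g}. unitary_matrix (K (\<sigma> n) j)" using U by blast
      show "\<forall>j\<in>{1..g}. \<forall>z\<in>Ann j. norm (res (K (\<sigma> n)) (X (\<sigma> n)) (Y (\<sigma> n)) j z) \<le> \<eta>"
        using res elim(3) by (meson less_imp_le order_trans)
      show "\<forall>z\<in>core (\<rho> + 1). norm (X (\<sigma> n) z) \<le> \<eta>"
      proof
        fix z assume "z \<in> core (\<rho> + 1)"
        then show "norm (X (\<sigma> n) z) \<le> \<eta>" using elim(1) L0[of z] core_subset by force
      qed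
      show "\<forall>j\<in>{1..g}. \<forall>z\<in>cball (of_real (mid j)) (rad (3/2) j). norm (Y (\<sigma> n) j z) \<le> \<eta>"
      proof (intro ballI)
        fix j z assume j: "j \<in> {1..g}" "z \<in> cball (complex_of_real (mid j)) (rad (3/2) j)"
        then have "z \<in> P j" using rad_mono[of "3/2" 2 j] by (auto simp: P_def)
        moreover have "dist (Y (\<sigma> n) j z) (L j z) < \<eta>" using elim(2) j by blast
        ultimately show "norm (Y (\<sigma> n) j z) \<le> \<eta>" using Lj[OF j(1), of z] by simp
      qed
    qed
  qed
  then obtain n where "adm (X (\<sigma> n)) (Y (\<sigma> n)) (c * \<eta>)" by (auto simp: eventually_sequentially)
  then show False using nadm \<eta>(2) by simp
qed

end

section \<open>Paths of unitary matrices\<close>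

text \<open>Cramer's formula, which makes the continuity of the inverse evident.\<close>

definition inverse_by_det :: "complex^'n^'n \<Rightarrow> complex^'n^'n" where
  "inverse_by_det A = (\<chi> k l. det (\<chi> i j. if j = k then axis l 1 $ i else A $ i $ j) / det A)"

lemma mult_inverse_by_det: assumes "det A \<noteq> 0" shows "A ** inverse_by_det A = mat 1"
proof -
  have "(A ** inverse_by_det A) $ i $ l = (mat 1 :: complex^'a^'a) $ i $ l" for i l
  proof -
    let ?x = "\<chi> k. inverse_by_det A $ k $ l"
    have "A *v ?x = axis l 1"
      by (subst cramer[OF assms]) (simp add: inverse_by_det_def)
    then have "(A *v ?x) $ i = axis l 1 $ i" by simp
    then show ?thesis
      by (simp add: matrix_vector_mult_def matrix_matrix_mult_def axis_def mat_def)
  qed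
  then show ?thesis by (simp add: vec_eq_iff)
qed

lemma continuous_on_det:
  "(\<And>i j. continuous_on S (\<lambda>t. f t $ i $ j)) \<Longrightarrow> continuous_on S (\<lambda>t. det (f t :: complex^'n^'n))"
  unfolding det_def
  by (intro continuous_on_sum continuous_on_mult continuous_on_const continuous_on_prod)

lemma continuous_on_inverse_by_det:
  assumes "continuous_on S f" "\<And>t. t \<in> S \<Longrightarrow> det (f t) \<noteq> 0"
  shows "continuous_on S (\<lambda>t. inverse_by_det (f t))"
  unfolding continuous_on_matrix_iff
proof (intro allI)
  fix k l
  have f: "continuous_on S (\<lambda>t. f t $ i $ j)" for i j using assms(1) by (simp add: continuous_on_matrix_iff)
  have "continuous_on S (\<lambda>t. det (\<chi> i j. if j = k then axis l 1 $ i else f t $ i $ j))"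
  proof (rule continuous_on_det)
    fix i j
    show "continuous_on S (\<lambda>t. (\<chi> i j. if j = k then axis l 1 $ i else f t $ i $ j) $ i $ j)"
      by (cases "j = k") (simp_all add: f)
  qed
  then show "continuous_on S (\<lambda>t. inverse_by_det (f t) $ k $ l)"
    unfolding inverse_by_det_def vec_lambda_beta
    by (rule continuous_on_divide[OF _ continuous_on_det[OF f]]) (use assms(2) in auto)
qed

text \<open>The determinant is a polynomial in \<mu>. Were it zero on the whole unit circle, the
  maximum principle would make it zero at \<mu> = 0, where it equals 1.\<close>

lemma unitary_scalar_shift:
  fixes K :: "complex^'n^'n"
  assumes "unitary_matrix K"
  shows "\<exists>\<mu>. norm \<mu> = 1 \<and> det (mat 1 + mat \<mu> ** K) \<noteq> 0"
proof (rule ccontr)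
  assume "\<not> ?thesis"
  then have 0: "det (mat 1 + mat \<mu> ** K) = 0" if "norm \<mu> = 1" for \<mu> using that by blast
  have hol: "(\<lambda>\<mu>. det (mat 1 + mat \<mu> ** K)) holomorphic_on S" for S
    unfolding det_def
    by (intro holomorphic_on_sum holomorphic_on_mult holomorphic_on_const holomorphic_on_prod)
      (auto intro!: holomorphic_intros)
  have "norm (det (mat 1 + mat 0 ** K)) \<le> 0"
  proof (rule maximum_modulus_frontier[of "\<lambda>\<mu>. det (mat 1 + mat \<mu> ** K)" "ball 0 1"])
    show "continuous_on (closure (ball 0 1)) (\<lambda>\<mu>. det (mat 1 + mat \<mu> ** K))"
      using hol holomorphic_on_imp_continuous_on by blast
    show "norm (det (mat 1 + mat z ** K)) \<le> 0" if "z \<in> frontier (ball 0 1)" for z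
      using 0[of z] that by (simp add: dist_norm)
  qed (use hol in auto)
  moreover have "mat 1 + mat 0 ** K = mat 1" by (simp add: vec_eq_iff)
  ultimately show False by simp
qed

text \<open>If x = - s K x, then |x| = |s| |x| because K preserves norms, and |s| < 1 leaves only x
  = 0.\<close>

lemma unitary_pencil_det:
  fixes K :: "complex^'n^'n"
  assumes K: "unitary_matrix K" and s: "norm s < 1"
  shows "det (mat 1 + mat s ** K) \<noteq> 0"
proof -
  let ?A = "mat 1 + mat s ** K"
  have "x = 0" if x: "?A *v x = 0" for x
  proof -
    \<comment> \<open>Repeating x in every column turns the vector equation into matrix
      identities.\<close>
    define X where "X = (\<chi> (i::'n) (j::'n). x $ i)"
    have "?A ** X = 0"
      using x by (simp add: X_def vec_eq_iff matrix_vector_mult_def matrix_matrix_mult_def)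
    then have "X + mat s ** K ** X = 0" by (simp add: bounded_bilinear.add_left[OF bounded_bilinear_matrix_mult])
    then have X: "X = - (mat s ** K ** X)" by (simp add: eq_neg_iff_add_eq_0)
    have e: "X $ i $ j = - (s * (K ** X) $ i $ j)" for i j
      using arg_cong[OF X, of "\<lambda>A. A $ i $ j"] by (simp add: matrix_mul_assoc[symmetric])
    have "conj_transpose (K ** X) ** (K ** X) = conj_transpose X ** (conj_transpose K ** K) ** X"
      by (simp add: conj_transpose_mult matrix_mul_assoc)
    also have "\<dots> = conj_transpose X ** X" using K by (simp add: unitary_matrix_def matrix_mul_rid)
    finally have KX: "conj_transpose (K ** X) ** (K ** X) = conj_transpose X ** X" .
    have sq: "(conj_transpose A ** A) $ j $ j = of_real (\<Sum>i\<in>UNIV. (norm (A $ i $ j))\<^sup>2)" for A :: "complex^'n^'n" and j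
      by (simp add: matrix_matrix_mult_def complex_norm_square mult.commute del: of_real_power)
    have norm_eq: "(\<Sum>i\<in>UNIV. (norm ((K ** X) $ i $ j))\<^sup>2) = (\<Sum>i\<in>UNIV. (norm (X $ i $ j))\<^sup>2)" for j
      using arg_cong[OF KX, of "\<lambda>A. A $ j $ j"] unfolding sq by (simp only: of_real_eq_iff)
    have "(\<Sum>i\<in>UNIV. (norm (X $ i $ j))\<^sup>2) = (norm s)\<^sup>2 * (\<Sum>i\<in>UNIV. (norm ((K ** X) $ i $ j))\<^sup>2)" for j
      unfolding sum_distrib_left by (subst e) (simp add: norm_mult power_mult_distrib)
    then have "(1 - (norm s)\<^sup>2) * (\<Sum>i\<in>UNIV. (norm (X $ i $ j))\<^sup>2) = 0" for j
      unfolding norm_eq by (simp add: algebra_simps)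
    moreover have "1 - (norm s)\<^sup>2 \<noteq> 0"
      using s power_strict_mono[of "norm s" 1 2] by simp
    ultimately have "(\<Sum>i\<in>UNIV. (norm (X $ i $ j))\<^sup>2) = 0" for j by simp
    then have "X $ i $ j = 0" for i j by (simp add: sum_nonneg_eq_0_iff)
    then show "x = 0" by (simp add: X_def vec_eq_iff)
  qed
  then have "\<exists>B. B ** ?A = mat 1" using matrix_left_invertible_ker by blast
  then show ?thesis using invertible_left_inverse invertible_det_nz by blast
qed

lemma scaled_matrix_mult: "mat s ** A ** (mat r ** B) = mat (s * r) ** (A ** B)"
  for A B :: "complex^'n^'n"
proof -
  have mult_nth: "(X ** Y) $ i $ j = (\<Sum>k\<in>UNIV. X $ i $ k * Y $ k $ j)" for X Y :: "complex^'n^'n" and i j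
    by (simp add: matrix_matrix_mult_def)
  have "(mat s ** A ** (mat r ** B)) $ i $ j = (mat (s * r) ** (A ** B)) $ i $ j" for i j
    unfolding mult_nth[of "mat s ** A"] mat_mult_nth mult_nth[of A] by (simp add: sum_distrib_left mult_ac)
  then show ?thesis by (simp add: vec_eq_iff)
qed

lemma conj_transpose_scaled: "conj_transpose (mat c ** A) = mat (cnj c) ** conj_transpose A"
  for A :: "complex^'n^'n"
  by (simp add: vec_eq_iff)

text \<open>The path is \<open>t \<mapsto> (1 + t \<mu> K) (1 + t \<mu>\<^sup>* K\<^sup>*)\<^sup>-\<^sup>1\<close>.\<close>

lemma unitary_path_scaled:
  fixes K :: "complex^'n^'n"
  assumes K: "unitary_matrix K" and \<mu>: "norm \<mu> = 1" "det (mat 1 + mat \<mu> ** K) \<noteq> 0"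
  shows "\<exists>q. continuous_on {0..1::real} q \<and> q 0 = mat 1 \<and> q 1 = mat \<mu> ** K \<and> (\<forall>t\<in>{0..1}. unitary_matrix (q t))"
proof -
  define A where "A t = mat 1 + mat (of_real t * \<mu>) ** K" for t :: real
  define A' where "A' t = mat 1 + mat (cnj (of_real t * \<mu>)) ** conj_transpose K" for t :: real
  have A': "A' t = conj_transpose (A t)" for t
    by (auto simp: A_def A'_def vec_eq_iff mat_nth)
  have det: "det (A t) \<noteq> 0" if "t \<in> {0..1}" for t
  proof (cases "t = 1")
    case True then show ?thesis using \<mu> by (simp add: A_def)
  next
    case False
    then show ?thesis unfolding A_def using that \<mu> by (intro unitary_pencil_det[OF K]) (simp add: norm_mult)
  qed
  have inv: "A t ** inverse_by_det (A t) = mat 1" "inverse_by_det (A t) ** A t = mat 1" if "t \<in> {0..1}" for t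
    using mult_inverse_by_det[OF det[OF that]] matrix_left_right_inverse by auto
  define B where "B t = inverse_by_det (A t)" for t
  define q where "q t = A t ** conj_transpose (B t)" for t
  have AB: "A t ** B t = mat 1" "B t ** A t = mat 1" if "t \<in> {0..1}" for t using inv[OF that] by (simp_all add: B_def)
  have BA': "conj_transpose (B t) ** A' t = mat 1" "A' t ** conj_transpose (B t) = mat 1" if "t \<in> {0..1}" for t
    unfolding A' by (simp_all add: conj_transpose_mult[symmetric] AB[OF that])
  \<comment> \<open>A t commutes with its adjoint because K does. The inverse inherits this, which
    is what makes q t unitary.\<close>
  have normal: "A t ** A' t = A' t ** A t" for t
  proof -
    have KK: "K ** conj_transpose K = mat 1" "conj_transpose K ** K = mat 1" using K by (simp_all add: unitary_matrix_def)
    have comm: "mat s ** K ** (mat r ** conj_transpose K) = mat r ** conj_transpose K ** (mat s ** K)" for s r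
      unfolding scaled_matrix_mult KK by (simp only: mult.commute)
    show ?thesis unfolding A_def A'_def
      by (simp add: bounded_bilinear.add_left[OF bounded_bilinear_matrix_mult]
          bounded_bilinear.add_right[OF bounded_bilinear_matrix_mult] comm matrix_mul_lid matrix_mul_rid add_ac)
  qed
  have uq: "unitary_matrix (q t)" if t: "t \<in> {0..1}" for t
  proof -
    have "B t ** conj_transpose (B t) = conj_transpose (B t) ** B t"
    proof -
      have "B t ** conj_transpose (B t) = (conj_transpose (B t) ** B t ** (A t ** A' t)) ** (B t ** conj_transpose (B t))"
      proof -
        have "conj_transpose (B t) ** B t ** (A t ** A' t) = conj_transpose (B t) ** (B t ** A t) ** A' t"
          by (simp only: matrix_mul_assoc)
        also have "\<dots> = mat 1" by (simp add: AB[OF t] BA'[OF t] matrix_mul_rid)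
        finally show ?thesis by (simp add: matrix_mul_lid)
      qed
      also have "\<dots> = conj_transpose (B t) ** B t ** (A' t ** (A t ** B t) ** conj_transpose (B t))"
        unfolding normal by (simp only: matrix_mul_assoc)
      also have "\<dots> = conj_transpose (B t) ** B t" by (simp add: AB[OF t] BA'[OF t] matrix_mul_rid)
      finally show ?thesis .
    qed
    note BB = this
    have "q t ** conj_transpose (q t) = A t ** (conj_transpose (B t) ** B t) ** A' t"
      unfolding q_def A' by (simp add: conj_transpose_mult matrix_mul_assoc)
    also have "\<dots> = (A t ** B t) ** (conj_transpose (B t) ** A' t)"
      unfolding BB[symmetric] by (simp only: matrix_mul_assoc)
    also have "\<dots> = mat 1" by (simp add: AB[OF t] BA'[OF t] matrix_mul_rid)
    finally have "q t ** conj_transpose (q t) = mat 1" .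
    then show ?thesis using matrix_left_right_inverse by (auto simp: unitary_matrix_def)
  qed
  have q1: "q 1 = mat \<mu> ** K"
  proof -
    have "mat \<mu> ** K ** A' 1 = A 1"
    proof -
      have "\<mu> * cnj \<mu> = 1" using complex_norm_square[of \<mu>] \<mu>(1) by simp
      moreover have "mat \<mu> ** K ** (mat (cnj \<mu>) ** conj_transpose K) = mat (\<mu> * cnj \<mu>) ** (K ** conj_transpose K)"
        by (rule scaled_matrix_mult)
      ultimately have "mat \<mu> ** K ** (mat (cnj \<mu>) ** conj_transpose K) = mat 1"
        using K by (simp add: unitary_matrix_def matrix_mul_rid)
      then show ?thesis
        by (simp add: A_def A'_def bounded_bilinear.add_right[OF bounded_bilinear_matrix_mult] matrix_mul_rid add.commute)
    qed
    then have "q 1 = mat \<mu> ** K ** (A' 1 ** conj_transpose (B 1))" unfolding q_def by (simp add: matrix_mul_assoc)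
    then show ?thesis using BA'(2)[of 1] by (simp add: matrix_mul_rid)
  qed
  have q0: "q 0 = mat 1"
  proof -
    have A0: "A 0 = mat 1" by (simp add: A_def vec_eq_iff)
    then have "B 0 = mat 1" using AB(1)[of 0] by (simp add: matrix_mul_lid)
    then show ?thesis by (simp add: q_def A0 matrix_mul_lid)
  qed
  have cA: "continuous_on {0..1} A"
    unfolding A_def continuous_on_matrix_iff by (auto intro!: continuous_intros)
  have cB: "continuous_on {0..1} B"
    unfolding B_def by (rule continuous_on_inverse_by_det[OF cA det])
  have "continuous_on {0..1} (\<lambda>t. conj_transpose (B t))"
    using cB unfolding continuous_on_matrix_iff by (auto intro!: continuous_intros)
  then have "continuous_on {0..1} q"
    unfolding q_def by (rule continuous_on_matrix_mult[OF cA])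
  then show ?thesis using q0 q1 uq by blast
qed

text \<open>The scalar \<mu> keeps 1 + t \<mu> K invertible up to t = 1; rotating by the phase
  -\<theta> t along the path removes it again at the end.\<close>

lemma unitary_path:
  fixes K :: "complex^'n^'n"
  assumes K: "unitary_matrix K"
  shows "\<exists>p. continuous_on {0..1::real} p \<and> p 0 = mat 1 \<and> p 1 = K \<and> (\<forall>t\<in>{0..1}. unitary_matrix (p t))"
proof -
  obtain \<mu> where \<mu>: "norm \<mu> = 1" "det (mat 1 + mat \<mu> ** K) \<noteq> 0" using unitary_scalar_shift[OF K] by blast
  obtain q where q: "continuous_on {0..1::real} q" "q 0 = mat 1" "q 1 = mat \<mu> ** K" "\<And>t. t \<in> {0..1} \<Longrightarrow> unitary_matrix (q t)"
    using unitary_path_scaled[OF K \<mu>] by blast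
  define \<theta> where "\<theta> = Arg \<mu>"
  have \<mu>\<theta>: "\<mu> = cis \<theta>" using \<mu>(1) rcis_cmod_Arg[of \<mu>] by (simp add: \<theta>_def rcis_def)
  define p where "p t = mat (cis (- \<theta> * t)) ** q t" for t
  have "continuous_on {0..1} p"
    unfolding p_def continuous_on_matrix_iff using q(1)
    by (auto simp: continuous_on_matrix_iff cis_conv_exp intro!: continuous_intros)
  moreover have "p 0 = mat 1" by (simp add: p_def q(2) matrix_mul_lid)
  moreover have "p 1 = K"
    by (simp add: p_def q(3) \<mu>\<theta> vec_eq_iff mult.assoc[symmetric] cis_mult)
  moreover have "unitary_matrix (p t)" if "t \<in> {0..1}" for t
  proof -
    have c: "cnj (cis x) * cis x = 1" "cis x * cnj (cis x) = 1" for x by (simp_all add: cis_cnj cis_mult)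
    have 1: "conj_transpose (mat c ** A) ** (mat c ** A) = mat (cnj c * c) ** (conj_transpose A ** A)"
      and 2: "(mat c ** A) ** conj_transpose (mat c ** A) = mat (c * cnj c) ** (A ** conj_transpose A)" for c and A :: "complex^'n^'n"
      unfolding conj_transpose_scaled by (rule scaled_matrix_mult)+
    show ?thesis
      using q(4)[OF that] unfolding unitary_matrix_def p_def 1 2 c by (simp add: matrix_mul_lid)
  qed
  ultimately show ?thesis by blast
qed

section \<open>Existence and uniqueness\<close>

text \<open>The limits are taken within the open half planes and never meet the values on the real
  axis.\<close>

lemma has_jump_cong:
  assumes eq: "\<And>z. Im z \<noteq> 0 \<Longrightarrow> N z = N' z"
  shows "has_jump N I V \<longleftrightarrow> has_jump N' I V"
proof -
  have "(N \<longlongrightarrow> L) (at x within {z. Im z > 0}) \<longleftrightarrow> (N' \<longlongrightarrow> L) (at x within {z. Im z > 0})"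
    "(N \<longlongrightarrow> L) (at x within {z. Im z < 0}) \<longleftrightarrow> (N' \<longlongrightarrow> L) (at x within {z. Im z < 0})" for x L
    by (auto intro!: tendsto_cong simp: eventually_at_filter eq)
  then show ?thesis by (simp add: has_jump_def has_boundary_values_def)
qed

lemma has_jump_diff:
  fixes N N' :: "complex \<Rightarrow> complex^'n^'m"
  assumes "has_jump N I V" "has_jump N' I V"
  shows "has_jump (\<lambda>z. N z - N' z) I V"
proof (rule has_jumpI)
  fix x assume x: "x \<in> I"
  obtain A B where AB: "(N \<longlongrightarrow> A) (at (complex_of_real x) within {z. Im z > 0})"
    "(N \<longlongrightarrow> B) (at (complex_of_real x) within {z. Im z < 0})" "A = B ** V"
    using has_jumpD[OF assms(1) x] by blast
  obtain A' B' where AB': "(N' \<longlongrightarrow> A') (at (complex_of_real x) within {z. Im z > 0})"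
    "(N' \<longlongrightarrow> B') (at (complex_of_real x) within {z. Im z < 0})" "A' = B' ** V"
    using has_jumpD[OF assms(2) x] by blast
  note t1 = tendsto_diff[OF AB(1) AB'(1)] and t2 = tendsto_diff[OF AB(2) AB'(2)]
  have eq: "A - A' = (B - B') ** V" unfolding AB(3) AB'(3)
    by (simp add: bounded_bilinear.diff_left[OF bounded_bilinear_matrix_mult])
  show "\<exists>P M. ((\<lambda>z. N z - N' z) \<longlongrightarrow> P) (at (complex_of_real x) within {z. 0 < Im z}) \<and>
      ((\<lambda>z. N z - N' z) \<longlongrightarrow> M) (at (complex_of_real x) within {z. Im z < 0}) \<and> P = M ** V"
    using t1 t2 eq by (intro exI conjI)
qed

lemma bigo_norm_diff:
  fixes f h :: "'a \<Rightarrow> 'b::real_normed_vector" and k :: "'a \<Rightarrow> real"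
  assumes "(\<lambda>x. norm (f x)) \<in> O[F](k)" "(\<lambda>x. norm (h x)) \<in> O[F](k)"
  shows "(\<lambda>x. norm (f x - h x)) \<in> O[F](k)"
proof -
  have "(\<lambda>x. norm (f x - h x)) \<in> O[F](\<lambda>x. norm (f x) + norm (h x))"
    by (rule landau_o.bigI[of 1]) (auto intro!: always_eventually norm_triangle_ineq4)
  also have "(\<lambda>x. norm (f x) + norm (h x)) \<in> O[F](k)" using assms by (rule sum_in_bigo)
  finally show ?thesis .
qed

context bands
begin

text \<open>The admissible step \<delta> is built from the a priori constant and the bounds of
  \<tau> alone, not from K, so finitely many steps traverse a path.\<close>

lemma uniform_step:
  "\<exists>\<delta>>0. \<forall>(K :: nat \<Rightarrow> complex^'r::finite^'r) K'. solvable K \<longrightarrow> (\<forall>j\<in>{1..g}. unitary_matrix (K j)) \<longrightarrow>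
     (\<forall>j\<in>{1..g}. norm (K' j - K j) \<le> \<delta>) \<longrightarrow> solvable K'"
proof -
  have "\<exists>C\<ge>0. \<forall>(K :: nat \<Rightarrow> complex^'r::finite^'r) X Y B e. (\<forall>j\<in>{1..g}. unitary_matrix (K j)) \<longrightarrow> adm X Y B \<longrightarrow> 0 \<le> e \<longrightarrow>
     (\<forall>j\<in>{1..g}. \<forall>z\<in>Ann j. norm (res K X Y j z) \<le> e) \<longrightarrow> adm X Y (C * e)"
    by (rule uniform_apriori)
  then obtain C where C: "C \<ge> 0" "\<And>(K :: nat \<Rightarrow> complex^'r::finite^'r) X Y B e. \<lbrakk>\<forall>j\<in>{1..g}. unitary_matrix (K j); adm X Y B; 0 \<le> e;
     \<forall>j\<in>{1..g}. \<forall>z\<in>Ann j. norm (res K X Y j z) \<le> e\<rbrakk> \<Longrightarrow> adm X Y (C * e)"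
    by blast
  obtain BT where BT: "BT > 0" "\<And>j z. j \<in> {1..g} \<Longrightarrow> z \<in> cl_Ann j \<Longrightarrow> norm (\<tau> z) \<le> BT \<and> norm (1 / \<tau> z) \<le> BT"
    using \<tau>_bound by blast
  obtain cm where cm: "cm > 0"
    "\<And>A B. norm (A ** B :: complex^('r + 'r)^('r + 'r)) \<le> cm * norm (A :: complex^('r + 'r)^('r + 'r)) * norm B"
    using matrix_mult_bound by blast
  define L where "L = real CARD('r + 'r) * real CARD('r + 'r) * (1 + BT)"
  have L: "L > 0" using BT(1) by (auto simp: L_def)
  \<comment> \<open>With \<theta> = cm L \<delta> this gives \<theta> C = C / (2 (C + 1)) <= 1/2;
    using C + 1 keeps the denominator positive when C = 0.\<close>
  define \<delta> where "\<delta> = 1 / (2 * (cm * L) * (C + 1))"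
  have \<delta>: "\<delta> > 0" using cm(1) L C(1) by (auto simp: \<delta>_def intro!: divide_pos_pos mult_pos_pos)
  have \<theta>: "cm * L * \<delta> * C \<le> 1 / 2"
  proof -
    have "cm * L * \<delta> * C = C / (2 * (C + 1))" unfolding \<delta>_def using cm(1) L C(1) by simp
    also have "\<dots> \<le> 1 / 2" using C(1) by (simp add: field_simps)
    finally show ?thesis .
  qed
  have "solvable K'" if s1: "solvable K" and s2: "\<forall>j\<in>{1..g}. unitary_matrix (K j)"
    and s3: "\<forall>j\<in>{1..g}. norm (K' j - K j) \<le> \<delta>"
    for K K' :: "nat \<Rightarrow> complex^'r^'r"
  proof (rule solvable_step[OF s1, where C=C and \<theta>="cm * L * \<delta>"])
    show "adm X Y (C * e)" if "adm X Y B" "0 \<le> e" "\<And>j z. j \<in> {1..g} \<Longrightarrow> z \<in> Ann j \<Longrightarrow> norm (res K X Y j z) \<le> e" for X Y B e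
      using C(2)[OF s2 that(1,2)] that(3) by blast
    fix j z and A :: "complex^('r + 'r)^('r + 'r)"
    assume j: "j \<in> {1..g}" "z \<in> Ann j"
    have t: "norm (\<tau> z) \<le> BT" "norm (1 / \<tau> z) \<le> BT" using BT(2)[OF j(1)] j(2) Ann_subset_cl by blast+
    have "norm (G (K' j) (\<tau> z) - G (K j) (\<tau> z)) \<le> L * norm (K' j - K j)"
      unfolding L_def by (rule G_diff_le[OF t])
    also have "\<dots> \<le> L * \<delta>" using s3 j(1) L by (intro mult_left_mono) auto
    finally have le: "norm (G (K' j) (\<tau> z) - G (K j) (\<tau> z)) \<le> L * \<delta>" .
    have "norm (A ** (G (K' j) (\<tau> z) - G (K j) (\<tau> z))) \<le> cm * norm A * norm (G (K' j) (\<tau> z) - G (K j) (\<tau> z))"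
      by (rule cm(2))
    also have "\<dots> \<le> cm * norm A * (L * \<delta>)" using le cm(1) by (intro mult_left_mono) auto
    finally show "norm (A ** (G (K' j) (\<tau> z) - G (K j) (\<tau> z))) \<le> cm * L * \<delta> * norm A" by (simp add: mult_ac)
  qed (use C(1) cm(1) L \<delta> \<theta> in auto)
  then show ?thesis using \<delta> by blast
qed

theorem solvable_unitary:
  fixes K :: "nat \<Rightarrow> complex^'r::finite^'r"
  assumes K: "\<And>j. j \<in> {1..g} \<Longrightarrow> unitary_matrix (K j)"
  shows "solvable K"
proof -
  have "\<exists>p. continuous_on {0..1::real} p \<and> p 0 = mat 1 \<and> p 1 = K j \<and> (\<forall>t\<in>{0..1}. unitary_matrix (p t))"
    if "j \<in> {1..g}" for j
    by (rule unitary_path[OF K[OF that]])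
  then obtain p where p: "\<And>j. j \<in> {1..g} \<Longrightarrow> continuous_on {0..1::real} (p j) \<and> p j 0 = mat 1 \<and> p j 1 = K j \<and> (\<forall>t\<in>{0..1}. unitary_matrix (p j t))"
    by metis
  have "\<exists>\<delta>>0. \<forall>(K :: nat \<Rightarrow> complex^'r::finite^'r) K'. solvable K \<longrightarrow> (\<forall>j\<in>{1..g}. unitary_matrix (K j)) \<longrightarrow>
     (\<forall>j\<in>{1..g}. norm (K' j - K j) \<le> \<delta>) \<longrightarrow> solvable K'" by (rule uniform_step)
  then obtain \<delta> where \<delta>: "\<delta> > 0" "\<And>(K :: nat \<Rightarrow> complex^'r::finite^'r) K'. \<lbrakk>solvable K; \<forall>j\<in>{1..g}. unitary_matrix (K j);
     \<forall>j\<in>{1..g}. norm (K' j - K j) \<le> \<delta>\<rbrakk> \<Longrightarrow> solvable K'" by blast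
  have "\<exists>d>0. \<forall>s\<in>{0..1}. \<forall>t\<in>{0..1}. dist t s < d \<longrightarrow> dist (p j t) (p j s) < \<delta>" if j: "j \<in> {1..g}" for j
  proof -
    have "uniformly_continuous_on {0..1} (p j)" using p[OF j] by (intro compact_uniformly_continuous) auto
    then show ?thesis using \<delta>(1) unfolding uniformly_continuous_on_def by blast
  qed
  then obtain d where d: "\<And>j. j \<in> {1..g} \<Longrightarrow> d j > 0"
    "\<And>j s t. j \<in> {1..g} \<Longrightarrow> s \<in> {0..1} \<Longrightarrow> t \<in> {0..1} \<Longrightarrow> dist t s < d j \<Longrightarrow> dist (p j t) (p j s) < \<delta>" by metis
  \<comment> \<open>The element 1 keeps the minimum defined when g = 0 and there are no
    gaps.\<close>
  define m where "m = Min (insert 1 (d ` {1..g}))"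
  have m: "m > 0" "\<And>j. j \<in> {1..g} \<Longrightarrow> m \<le> d j"
    unfolding m_def using d(1) by (simp add: Min_gr_iff, intro Min_le, auto)
  obtain n :: nat where n: "n > 0" "1 / real n < m"
    using reals_Archimedean[OF m(1)] by (metis inverse_eq_divide zero_less_Suc)
  have "solvable (\<lambda>j. p j (real i / real n))" if "i \<le> n" for i
    using that
  proof (induction i)
    case 0
    show ?case
    \<comment> \<open>The family at t = 0 equals 1 only at the indices 1..g, so it may differ from
      the constant family as a function; a step of size 0 bridges this. The same device leads to
      \<open>K\<close> at the end.\<close>
    proof (rule \<delta>(2)[OF solvable_mat_1])
      show "\<forall>j\<in>{1..g}. norm (p j (real 0 / real n) - mat 1) \<le> \<delta>" using p \<delta>(1) by simp
    qed simp
  next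
    case (Suc i)
    have in01: "real i / real n \<in> {0..1}" "real (Suc i) / real n \<in> {0..1}"
      using Suc.prems n(1) by auto
    show ?case
    proof (rule \<delta>(2))
      show "solvable (\<lambda>j. p j (real i / real n))" using Suc by simp
      show "\<forall>j\<in>{1..g}. unitary_matrix (p j (real i / real n))" using p in01(1) by blast
      show "\<forall>j\<in>{1..g}. norm (p j (real (Suc i) / real n) - p j (real i / real n)) \<le> \<delta>"
      proof
        fix j assume j: "j \<in> {1..g}"
        have "dist (real (Suc i) / real n) (real i / real n) = 1 / real n"
          using n(1) by (simp add: dist_real_def diff_divide_distrib[symmetric])
        then have "dist (real (Suc i) / real n) (real i / real n) < d j" using n(2) m(2)[OF j] by linarith
        from d(2)[OF j in01 this] show "norm (p j (real (Suc i) / real n) - p j (real i / real n)) \<le> \<delta>"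
          by (simp add: dist_norm)
      qed
    qed
  qed
  from this[of n] have s: "solvable (\<lambda>j. p j 1)" using n(1) by simp
  show ?thesis
  proof (rule \<delta>(2)[OF s])
    show "\<forall>j\<in>{1..g}. unitary_matrix (p j 1)" using p K by simp
    show "\<forall>j\<in>{1..g}. norm (K j - p j 1) \<le> \<delta>" using p \<delta>(1) by simp
  qed
qed

text \<open>The inverse of the unitary K_j is written as its adjoint, the form used by the
  homogeneous problem. The values of N on the band are left free.\<close>

definition solution :: "(nat \<Rightarrow> complex^'r::finite^'r) \<Rightarrow> (complex \<Rightarrow> complex^('r + 'r)^('r + 'r)) \<Rightarrow> bool" where
  "solution K N \<longleftrightarrow> matrix_holomorphic_on N D \<and>
    (\<forall>k\<in>{0..g}. has_jump N {a k<..<b k} J) \<and>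
    (\<forall>j\<in>{1..g}. has_jump N {b (j - 1)<..<a j} (block_matrix (K j) 0 0 (conj_transpose (K j)))) \<and>
    (\<lambda>z. norm (N z - mat 1)) \<in> O[at_infinity](\<lambda>z. norm (inverse z)) \<and>
    (\<forall>e\<in>E. (\<lambda>z. norm (N z)) \<in> O[at (complex_of_real e) within D](\<lambda>z. norm (z - of_real e) powr (- 1 / 4)))"

lemma solution_exists:
  fixes K :: "nat \<Rightarrow> complex^'r::finite^'r"
  assumes K: "\<And>j. j \<in> {1..g} \<Longrightarrow> unitary_matrix (K j)"
  shows "\<exists>N. solution K N"
proof -
  have "\<exists>X Y C. adm X Y C \<and> (\<forall>j\<in>{1..g}. \<forall>z\<in>Ann j. res K X Y j z = - mat 1)"
    by (rule solvable_unitary[OF K, unfolded solvable_def, THEN spec, THEN spec[of _ "norm (mat 1 :: complex^('r + 'r)^('r + 'r))"],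
          THEN mp, THEN mp]) (simp_all only: matrix_holomorphic_on_const norm_minus_cancel, simp_all)
  then obtain X Y C where XY: "adm X Y C" "\<forall>j\<in>{1..g}. \<forall>z\<in>Ann j. res K X Y j z = - mat 1"
    by (elim exE conjE) (rule that)
  have X_hol: "matrix_holomorphic_on (\<lambda>z. mat 1 + X z) Q"
    using XY(1) by (intro matrix_holomorphic_on_add) (simp_all add: adm_def)
  have X_inf: "((\<lambda>z. mat 1 + X z) \<longlongrightarrow> mat 1) at_infinity"
    using tendsto_add[OF tendsto_const[of "mat 1"] adm_tendsto_0[OF XY(1)]] by simp
  have Y_hol: "\<And>j. j \<in> {1..g} \<Longrightarrow> matrix_holomorphic_on (Y j) (P j)" using XY(1) by (simp add: adm_def)
  have rel: "mat 1 + X z = Y j z ** G (K j) (\<tau> z)" if "j \<in> {1..g}" "z \<in> Ann j" for j z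
  proof -
    have "X z - Y j z ** G (K j) (\<tau> z) = - mat 1" using XY(2) that unfolding res_def by blast
    then show ?thesis by (simp add: algebra_simps add_eq_0_iff)
  qed
  note glue = K X_hol X_inf Y_hol rel
  have "solution K (glue K (\<lambda>z. mat 1 + X z) Y)"
    unfolding solution_def
    using glue_holomorphic[OF glue] glue_cut[OF glue] glue_gap[OF glue] glue_infinity[OF glue] glue_endpoint[OF glue]
    by simp
  then show ?thesis by blast
qed

lemma solution_unique:
  fixes K :: "nat \<Rightarrow> complex^'r::finite^'r"
  assumes N: "solution K N" and N': "solution K N'" and z: "z \<in> D"
  shows "N z = N' z"
proof -
  have "N z - N' z = 0"
  proof (rule homogeneous_problem_zero[where N="\<lambda>z. N z - N' z", OF _ _ _ _ _ z])
    show "matrix_holomorphic_on (\<lambda>z. N z - N' z) D"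
      using N N' by (intro matrix_holomorphic_on_diff) (simp_all add: solution_def)
    show "has_jump (\<lambda>z. N z - N' z) {a k<..<b k} J" if "k \<in> {0..g}" for k
      using N N' that by (intro has_jump_diff) (simp_all add: solution_def)
    show "has_jump (\<lambda>z. N z - N' z) {b (j - 1)<..<a j} (block_matrix (K j) 0 0 (conj_transpose (K j)))" if "j \<in> {1..g}" for j
      using N N' that by (intro has_jump_diff) (simp_all add: solution_def)
    have "(\<lambda>z. norm ((N z - mat 1) - (N' z - mat 1))) \<in> O[at_infinity](\<lambda>z. norm (inverse z))"
      using N N' by - (rule bigo_norm_diff; simp add: solution_def)
    then show "(\<lambda>z. norm (N z - N' z)) \<in> O[at_infinity](\<lambda>z. norm (inverse z))" by simp
    show "(\<lambda>z. norm (N z - N' z)) \<in> O[at (complex_of_real e) within D](\<lambda>z. norm (z - of_real e) powr (- 1 / 4))" if "e \<in> E" for e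
      using N N' that by - (rule bigo_norm_diff; simp add: solution_def)
  qed
  then show ?thesis by simp
qed

lemma eventually_in_D_at_infinity: "\<forall>\<^sub>F z in at_infinity. z \<in> D"
  unfolding eventually_at_infinity
proof (intro exI allI impI)
  fix z :: complex assume "\<bar>a 0\<bar> + \<bar>b g\<bar> + 1 \<le> norm z"
  then show "z \<in> D" by (auto simp: D_def)
qed

text \<open>All conditions refer to N on D only: the one-sided limits are taken off the real axis,
  and D contains a neighbourhood of infinity.\<close>

lemma solution_cong:
  assumes eq: "\<And>z. z \<in> D \<Longrightarrow> N z = N' z"
  shows "solution K N \<longleftrightarrow> solution K N'"
proof -
  have 1: "matrix_holomorphic_on N D \<longleftrightarrow> matrix_holomorphic_on N' D" by (rule matrix_holomorphic_on_cong[OF eq])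
  have 2: "has_jump N I V \<longleftrightarrow> has_jump N' I V" for I V by (rule has_jump_cong) (use eq in_D_if_Im in blast)
  have 3: "(\<lambda>z. norm (N z - mat 1)) \<in> O[at_infinity](h) \<longleftrightarrow> (\<lambda>z. norm (N' z - mat 1)) \<in> O[at_infinity](h)" for h :: "complex \<Rightarrow> real"
    by (rule landau_o.big.in_cong) (rule eventually_mono[OF eventually_in_D_at_infinity], simp add: eq)
  have 4: "(\<lambda>z. norm (N z)) \<in> O[at e within D](h) \<longleftrightarrow> (\<lambda>z. norm (N' z)) \<in> O[at e within D](h)" for e and h :: "complex \<Rightarrow> real"
    by (rule landau_o.big.in_cong) (simp add: eventually_at_filter eq)
  show ?thesis unfolding solution_def 1 2 3 4 ..
qed

end

theorem proposition4p9:
  fixes g :: nat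
    and a b :: "nat \<Rightarrow> real"
    and K :: "nat \<Rightarrow> complex^'r^'r"
    and D :: "complex set"
  assumes cuts: "\<And>k. k \<le> g \<Longrightarrow> a k < b k"
    and gaps: "\<And>j. j \<in> {1..g} \<Longrightarrow> b (j - 1) < a j"
    and K: "\<And>j. j \<in> {1..g} \<Longrightarrow> unitary_matrix (K j)"
    and D: "D = - complex_of_real ` {a 0..b g}"
  shows "\<exists>!N :: complex \<Rightarrow> complex^('r + 'r)^('r + 'r).
    N \<in> D \<rightarrow>\<^sub>E UNIV \<and>
    matrix_holomorphic_on N D \<and>
    (\<forall>k\<in>{0..g}. has_jump N {a k<..<b k} (block_matrix 0 (mat 1) (- mat 1) 0)) \<and>
    (\<forall>j\<in>{1..g}. has_jump N {b (j - 1)<..<a j} (block_matrix (K j) 0 0 (matrix_inv (K j)))) \<and>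
    (\<lambda>z. norm (N z - mat 1)) \<in> O[at_infinity](\<lambda>z. norm (inverse z)) \<and>
    (\<forall>e\<in>a ` {0..g} \<union> b ` {0..g}.
      (\<lambda>z. norm (N z)) \<in> O[at (complex_of_real e) within D](\<lambda>z. norm (z - of_real e) powr (- 1 / 4)))"
proof -
  interpret bands g a b by unfold_locales (use cuts gaps in auto)
  have D_eq: "D = bands.D g a b" by (simp add: D D_def)
  have "matrix_inv (K j) = conj_transpose (K j)" if "j \<in> {1..g}" for j
    using matrix_inv_unitary[OF K[OF that]] .
  then have sol: "(matrix_holomorphic_on N D \<and>
    (\<forall>k\<in>{0..g}. has_jump N {a k<..<b k} (block_matrix 0 (mat 1) (- mat 1) 0)) \<and>
    (\<forall>j\<in>{1..g}. has_jump N {b (j - 1)<..<a j} (block_matrix (K j) 0 0 (matrix_inv (K j)))) \<and>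
    (\<lambda>z. norm (N z - mat 1)) \<in> O[at_infinity](\<lambda>z. norm (inverse z)) \<and>
    (\<forall>e\<in>a ` {0..g} \<union> b ` {0..g}.
      (\<lambda>z. norm (N z)) \<in> O[at (complex_of_real e) within D](\<lambda>z. norm (z - of_real e) powr (- 1 / 4))))
    \<longleftrightarrow> solution K N" for N
    unfolding solution_def D_eq E_def by simp
  obtain N where N: "solution K N" using solution_exists[of K] K by blast
  show ?thesis
    unfolding sol
  \<comment> \<open>Solutions are determined on D only; restriction picks the representative that is
    \<open>undefined\<close> outside D.\<close>
  proof (rule ex1I[of _ "restrict N D"])
    have "solution K (restrict N D) \<longleftrightarrow> solution K N"
      by (rule solution_cong) (simp add: D_eq)
    then show "restrict N D \<in> D \<rightarrow>\<^sub>E UNIV \<and> solution K (restrict N D)" using N by simp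
    fix N' assume N': "N' \<in> D \<rightarrow>\<^sub>E UNIV \<and> solution K N'"
    show "N' = restrict N D"
    proof
      fix z
      show "N' z = restrict N D z"
        using solution_unique[of K N' N z] N N' by (cases "z \<in> D") (auto simp: D_eq PiE_def extensional_def)
    qed
  qed
qed

end
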